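(* Let $m<1$ and $d\ge 3$. There is a constant $c_{m,d}>0$ depending only on $m,d$ such that the following holds. Let $\Omega\subset\mathbb{R}^d$ be a domain containing the ball $B_{R_0}(x_0)$ and let $0<R<R_0$. Let $u\in C((0,T);L^1_{loc}(\Omega))$ be a nonnegative weak solution of $\partial_tu=\Delta(u^m/m)$, and assume that $u(t,\cdot)\in L^p_{loc}(\Omega)$ for some $p\ge 1$ with $p>1-m$ and for all $0<t<T$. Then for any $0\le s\le t<T$ $$\left[\int_{B_R(x_0)}|u(t,x)|^p\,dx\right]^{(1-m)/p}\le\left[\int_{B_{R_0}(x_0)}|u(s,x)|^p\,dx\right]^{(1-m)/p}+K_{R,R_0,p}\,(t-s),$$ where $$K_{R,R_0,p}=\frac{p\,c_{m,d}}{(R_0-R)^2}\,\mathrm{Vol}\big(B_{R_0}\setminus B_R\big)^{(1-m)/p}>0.$$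
   Context: $B_r(x_0)$ is the open ball of radius $r$ centered at $x_0$ (abbreviated $B_r$). For $s=0$, $u(0,\cdot)$ denotes the initial data $u_0$. For $m=0$, $u^m/m$ is read as $\log u$. Values $m\le 0$ are allowed. By existing theory, solutions are assumed positive and smooth as long as they do not extinguish identically. *)

theory Defs
  imports "HOL-Analysis.Analysis"
begin

definition dir_deriv :: "('a::euclidean_space \<Rightarrow> real) \<Rightarrow> 'a \<Rightarrow> 'a \<Rightarrow> real" where
  "dir_deriv f v = (\<lambda>z. frechet_derivative f (at z) v)"

(* \<open>Ck_on k f S\<close> is meant for open \<open>S\<close>. *)
fun Ck_on :: "nat \<Rightarrow> ('a::euclidean_space \<Rightarrow> real) \<Rightarrow> 'a set \<Rightarrow> bool" where
  "Ck_on 0 f S \<longleftrightarrow> continuous_on S f"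
| "Ck_on (Suc k) f S \<longleftrightarrow>
     (\<forall>z\<in>S. f differentiable (at z)) \<and> (\<forall>v. Ck_on k (dir_deriv f v) S)"

definition smooth_on :: "('a::euclidean_space \<Rightarrow> real) \<Rightarrow> 'a set \<Rightarrow> bool" where
  "smooth_on f S \<longleftrightarrow> (\<forall>k. Ck_on k f S)"

definition test_functions :: "'a::euclidean_space set \<Rightarrow> ('a \<Rightarrow> real) set" where
  "test_functions S = {\<phi>. smooth_on \<phi> UNIV \<and> compact (closure {z. \<phi> z \<noteq> 0})
                           \<and> closure {z. \<phi> z \<noteq> 0} \<subseteq> S}"

definition dt :: "(real \<times> 'a::euclidean_space \<Rightarrow> real) \<Rightarrow> real \<times> 'a \<Rightarrow> real" where
  "dt \<phi> = dir_deriv \<phi> (1, 0)"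

(* the Laplacian in the space variable only *)
definition laplace_x :: "(real \<times> 'a::euclidean_space \<Rightarrow> real) \<Rightarrow> real \<times> 'a \<Rightarrow> real" where
  "laplace_x \<phi> = (\<lambda>z. \<Sum>b\<in>Basis. dir_deriv (dir_deriv \<phi> (0, b)) (0, b) z)"

definition Lp_loc :: "real \<Rightarrow> 'a::euclidean_space set \<Rightarrow> ('a \<Rightarrow> real) \<Rightarrow> bool" where
  "Lp_loc p \<Omega> f \<longleftrightarrow> set_borel_measurable lebesgue \<Omega> f \<and>
     (\<forall>K. compact K \<and> K \<subseteq> \<Omega> \<longrightarrow> set_integrable lebesgue K (\<lambda>x. \<bar>f x\<bar> powr p))"

definition L1_loc_limit ::
    "'a::euclidean_space set \<Rightarrow> (real \<Rightarrow> 'a \<Rightarrow> real) \<Rightarrow> ('a \<Rightarrow> real) \<Rightarrow> real filter \<Rightarrow> bool" where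
  "L1_loc_limit \<Omega> u g F \<longleftrightarrow>
     (\<forall>K. compact K \<and> K \<subseteq> \<Omega> \<longrightarrow> ((\<lambda>r. LINT x:K|lebesgue. \<bar>u r x - g x\<bar>) \<longlongrightarrow> 0) F)"

definition continuous_L1_loc ::
    "real \<Rightarrow> 'a::euclidean_space set \<Rightarrow> (real \<Rightarrow> 'a \<Rightarrow> real) \<Rightarrow> bool" where
  "continuous_L1_loc T \<Omega> u \<longleftrightarrow>
     (\<forall>t\<in>{0<..<T}. Lp_loc 1 \<Omega> (u t) \<and> L1_loc_limit \<Omega> u (u t) (at t))"

(* \<open>u 0\<close> is the initial datum of the solution: it is attained in \<open>L^1_loc\<close>. *)
definition initial_datum :: "'a::euclidean_space set \<Rightarrow> (real \<Rightarrow> 'a \<Rightarrow> real) \<Rightarrow> bool" where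
  "initial_datum \<Omega> u \<longleftrightarrow> Lp_loc 1 \<Omega> (u 0) \<and> L1_loc_limit \<Omega> u (u 0) (at_right 0)"

definition fde_flux :: "real \<Rightarrow> real \<Rightarrow> real" where
  "fde_flux m v = (if m = 0 then ln v else v powr m / m)"

(* For \<open>m \<le> 0\<close> the quantity \<open>u^m/m\<close> (or \<open>log u\<close>) is undefined where \<open>u = 0\<close>; the equation is
   then tested only by functions supported where \<open>u > 0\<close>, i.e. before extinction. For \<open>m > 0\<close>
   all test functions on \<open>(0,T) \<times> \<Omega>\<close> are used. *)
definition weak_solution ::
    "real \<Rightarrow> real \<Rightarrow> 'a::euclidean_space set \<Rightarrow> (real \<Rightarrow> 'a \<Rightarrow> real) \<Rightarrow> bool" where
  "weak_solution m T \<Omega> u \<longleftrightarrow>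
     continuous_L1_loc T \<Omega> u \<and>
     (\<forall>\<phi>\<in>test_functions {(t, x). t \<in> {0<..<T} \<and> x \<in> \<Omega> \<and> (m > 0 \<or> u t x > 0)}.
        has_bochner_integral lebesgue
          (\<lambda>(t, x). u t x * dt \<phi> (t, x) + fde_flux m (u t x) * laplace_x \<phi> (t, x)) 0)"

(* Standing regularity assumption: at the times at which the solution is not identically zero,
   it is positive and smooth. (That set of times is open for a solution that is continuous
   into \<open>L^1_loc\<close>.) *)
definition positive_smooth_unless_extinct ::
    "real \<Rightarrow> 'a::euclidean_space set \<Rightarrow> (real \<Rightarrow> 'a \<Rightarrow> real) \<Rightarrow> bool" where
  "positive_smooth_unless_extinct T \<Omega> u \<longleftrightarrow>
     (let Q = {(t, x). t \<in> {0<..<T} \<and> x \<in> \<Omega> \<and> (\<exists>y\<in>\<Omega>. u t y \<noteq> 0)} in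
        (\<forall>(t, x)\<in>Q. u t x > 0) \<and> smooth_on (\<lambda>(t, x). u t x) Q)"

(* Real powers of extended nonnegative reals, for positive exponents. *)
definition ennpowr :: "ennreal \<Rightarrow> real \<Rightarrow> ennreal" where
  "ennpowr X a = (if X = \<infinity> then \<infinity> else ennreal (enn2real X powr a))"

(* The integral over the open ball may be infinite, since only local integrability
   in \<open>\<Omega>\<close> is available. *)
definition ball_mass :: "real \<Rightarrow> 'a::euclidean_space \<Rightarrow> real \<Rightarrow> ('a \<Rightarrow> real) \<Rightarrow> ennreal" where
  "ball_mass p x0 r f = (\<integral>\<^sup>+x\<in>ball x0 r. ennreal (\<bar>f x\<bar> powr p) \<partial>lebesgue)"

definition K_const :: "real \<Rightarrow> real \<Rightarrow> 'a::euclidean_space \<Rightarrow> real \<Rightarrow> real \<Rightarrow> real \<Rightarrow> real" where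
  "K_const c m x0 R R0 p =
     p * c / (R0 - R)\<^sup>2 * measure lebesgue (ball x0 R0 - ball x0 R) powr ((1 - m) / p)"

end

theory Submission
  imports Defs
begin

text \<open>
  The proof compares the solution with an explicit barrier. Let \<open>q = p / (1 - m) > 1\<close>, let
  \<open>R < R1 < R0\<close>, and put
  \<open>U = (\<kappa> R1\<^sup>2 \<theta>) powr (1 / (1 - m)) * (R1\<^sup>2 - dist x x0 ^ 2) powr (- 2 / (1 - m))\<close>,
  where \<open>\<theta>\<close> is the time elapsed since the start, increased by an arbitrarily small \<open>\<rho> > 0\<close>. This
  function blows up at the boundary of \<open>ball x0 R1\<close>, it is small at the start, and if \<open>\<kappa>\<close> is a suitable
  multiple of \<open>q\<close> then \<open>U\<^sup>m (\<Delta> log U + (p - 1 + m) |\<nabla> log U|\<^sup>2) \<le> \<partial>\<^sub>t U\<close>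
  (\<open>barrier_supersolution\<close>).

  Let \<open>\<eta>\<close> be a nondecreasing step from 0 at 1 to 1 at 2, and consider the energy
  \<open>\<integral> J\<close> with \<open>J = \<integral>\<^sub>0\<^sup>u p v\<^bsup>p-1\<^esup> \<eta> (v / U) dv\<close>. The density vanishes where \<open>u \<le> U\<close>, hence near the
  boundary of the ball, so that integrations by parts have no boundary terms. In
  \<open>- \<nabla>(u\<^bsup>p-1\<^esup> \<eta> (u/U)) \<bullet> u\<^bsup>m-1\<^esup> \<nabla>u\<close> the derivative of the power has a sign because \<open>p \<ge> 1\<close>. For the
  derivative of \<open>\<eta>\<close>, write \<open>\<nabla> log u = \<nabla> log U + \<nabla> log (u/U)\<close>: one gets minus a square, and a term that is linear in
  \<open>\<nabla>(u/U)\<close>. Up to a divergence the latter is at most a nonnegative multiple of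
  \<open>\<Delta> log U + (p - 1 + m) |\<nabla> log U|\<^sup>2\<close>, and the contribution of \<open>\<partial>\<^sub>t U\<close> to \<open>\<partial>\<^sub>t J\<close> absorbs it
  (\<open>flux_dissipation\<close>). Therefore the energy is nonincreasing
  (\<open>truncated_energy_decreasing\<close>).

  Since \<open>J \<le> u\<^sup>p \<le> J + (2U)\<^sup>p\<close>, monotonicity gives
  \<open>\<integral> u(t)\<^sup>p \<le> \<integral> u(s)\<^sup>p + \<integral> (2U(t))\<^sup>p\<close>, the outer integrals over \<open>ball x0 R\<close> and the middle one over
  \<open>ball x0 R1\<close>. The last integral is at most a constant times
  \<open>(\<kappa>\<theta>)\<^sup>q (R1 - R)\<^bsup>-2q\<^esup>\<close> times the volume of the shell (\<open>barrier_mass\<close>). Taking the power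
  \<open>1/q \<le> 1\<close>, which is subadditive, turns this into the claim, with coefficient 1 in front of the initial
  term. Testing instead with \<open>u\<^bsup>p-1\<^esup>\<close> times a fixed cutoff in space leads to factors such as
  \<open>p / (p - 1 + m)\<close> or \<open>p / (p - 1)\<close>, which for \<open>m = 0\<close> are unbounded as \<open>p\<close> tends to 1; the barrier gives a
  factor that is linear in \<open>p\<close>.

  Two points need care. The solution attains its value at the initial time, or at a time of extinction,
  only in \<open>L\<^sup>1\<^sub>l\<^sub>o\<^sub>c\<close>. For this reason \<open>u\<^sup>p\<close> is first replaced by a power that is capped to linear growth;
  the cap is removed by Fatou's lemma. Moreover the equation is given in weak form only. Where the solution is alive it is
  positive and smooth, and testing with bump functions yields the equation pointwise
  (\<open>classical_equation\<close>).
\<close>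

section \<open>Smooth bump functions\<close>

lemma dir_deriv_eq:
  assumes "(f has_derivative f') (at z)"
  shows "dir_deriv f v z = f' v"
  unfolding dir_deriv_def using frechet_derivative_at[OF assms] by simp

lemma dir_deriv_line:
  fixes f :: "'a::euclidean_space \<Rightarrow> real"
  assumes "f differentiable (at z)"
  shows "((\<lambda>h. f (z + h *\<^sub>R v)) has_real_derivative dir_deriv f v z) (at 0)"
proof -
  have f: "(f has_derivative frechet_derivative f (at z)) (at z)"
    using assms frechet_derivative_works by blast
  have l: "((\<lambda>h::real. z + h *\<^sub>R v) has_derivative (\<lambda>h. h *\<^sub>R v)) (at 0)"
    by (auto intro!: derivative_eq_intros)
  have "((f \<circ> (\<lambda>h. z + h *\<^sub>R v)) has_derivative (frechet_derivative f (at z) \<circ> (\<lambda>h. h *\<^sub>R v))) (at 0)"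
    by (rule diff_chain_at[OF l]) (use f in simp)
  moreover have "frechet_derivative f (at z) \<circ> (\<lambda>h. h *\<^sub>R v) = (*) (dir_deriv f v z)"
    using linear_scale[OF has_derivative_linear[OF f]] by (auto simp: dir_deriv_def)
  ultimately show ?thesis
    by (simp add: has_field_derivative_def o_def)
qed

lemma Ck_on_imp_continuous_on:
  assumes "Ck_on k f S"
  shows "continuous_on S f"
proof (cases k)
  case (Suc j)
  then show ?thesis
    using assms by (intro continuous_at_imp_continuous_on) (auto intro: differentiable_imp_continuous_within)
qed (use assms in simp)

lemma Ck_on_Suc_imp: "Ck_on (Suc k) f S \<Longrightarrow> Ck_on k f S"
proof (induction k arbitrary: f)
  case 0 then show ?case using Ck_on_imp_continuous_on by (metis Ck_on.simps(1))
next
  case (Suc k) then show ?case by simp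
qed

lemma Ck_on_const: "Ck_on k (\<lambda>z. c) S"
proof (induction k arbitrary: c)
  case (Suc k)
  have "dir_deriv (\<lambda>z::'a. c) v = (\<lambda>z. 0)" for v
    by (rule ext, rule dir_deriv_eq) simp
  then show ?case using Suc by simp
qed simp

lemma Ck_on_add:
  assumes "Ck_on k f UNIV" "Ck_on k g UNIV"
  shows "Ck_on k (\<lambda>z. f z + g z) UNIV"
  using assms
proof (induction k arbitrary: f g)
  case (Suc k)
  have "dir_deriv (\<lambda>z. f z + g z) v = (\<lambda>z. dir_deriv f v z + dir_deriv g v z)" for v
  proof (rule ext, rule dir_deriv_eq)
    fix z
    show "((\<lambda>z. f z + g z) has_derivative (\<lambda>v. dir_deriv f v z + dir_deriv g v z)) (at z)"
      using Suc.prems by (auto intro!: has_derivative_add simp: dir_deriv_def frechet_derivative_works)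
  qed
  then show ?case using Suc by simp
qed (auto intro: continuous_intros)

lemma Ck_on_mult:
  assumes "Ck_on k f UNIV" "Ck_on k g UNIV"
  shows "Ck_on k (\<lambda>z. f z * g z) UNIV"
  using assms
proof (induction k arbitrary: f g)
  case (Suc k)
  have "dir_deriv (\<lambda>z. f z * g z) v = (\<lambda>z. f z * dir_deriv g v z + dir_deriv f v z * g z)" for v
  proof (rule ext, rule dir_deriv_eq)
    fix z
    show "((\<lambda>z. f z * g z) has_derivative (\<lambda>v. f z * dir_deriv g v z + dir_deriv f v z * g z)) (at z)"
      using Suc.prems by (auto intro!: has_derivative_mult simp: dir_deriv_def frechet_derivative_works)
  qed
  moreover have "Ck_on k f UNIV" "Ck_on k g UNIV" using Suc.prems Ck_on_Suc_imp by blast+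
  ultimately show ?case using Suc by (simp add: Ck_on_add)
qed (auto intro: continuous_intros)

text \<open>The classical flat function \<open>exp (-1/y)\<close> is the member \<open>n = 0\<close>. The other members are there
  because the span of the family is closed under differentiation, so that smoothness of all members
  can be proved by one induction.\<close>

definition flat_exp :: "nat \<Rightarrow> real \<Rightarrow> real" where
  "flat_exp n y = (if y > 0 then inverse y ^ n * exp (- inverse y) else 0)"

lemma flat_exp_pos: "y > 0 \<Longrightarrow> flat_exp n y > 0"
  by (simp add: flat_exp_def)

lemma flat_exp_tendsto_0: "(flat_exp n \<longlongrightarrow> 0) (at 0)"
proof -
  have "((\<lambda>y. inverse y ^ n / exp (inverse y)) \<longlongrightarrow> (0::real)) (at_right 0)"
    by (rule filterlim_compose[OF tendsto_power_div_exp_0 filterlim_inverse_at_top_right])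
  then have R: "(flat_exp n \<longlongrightarrow> 0) (at_right 0)"
    by (rule Lim_transform_eventually)
       (auto simp: flat_exp_def exp_minus field_simps eventually_at intro!: exI[of _ 1])
  have "(flat_exp n \<longlongrightarrow> 0) (at_left 0)"
    by (rule tendsto_eventually) (auto simp: flat_exp_def eventually_at intro!: exI[of _ 1])
  with R show ?thesis by (simp add: filterlim_at_split)
qed

lemma flat_exp_deriv:
  "(flat_exp n has_real_derivative (flat_exp (n + 2) y - real n * flat_exp (Suc n) y)) (at y)"
proof -
  consider "y > 0" | "y < 0" | "y = 0" by linarith
  then show ?thesis
  proof cases
    case 1
    have "((\<lambda>x. x ^ n * exp (- x)) has_real_derivative
        (real n * x ^ (n - 1) - x ^ n) * exp (- x)) (at x)" for x :: real
      by (auto intro!: derivative_eq_intros simp: algebra_simps)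
    from DERIV_chain2[OF this DERIV_inverse[of y]]
    have "((\<lambda>y. inverse y ^ n * exp (- inverse y)) has_real_derivative
        (flat_exp (n + 2) y - real n * flat_exp (Suc n) y)) (at y)"
      using 1 by (cases n) (auto simp: flat_exp_def algebra_simps power2_eq_square)
    then show ?thesis
      by (rule has_field_derivative_transform_within_open[of _ _ _ "{0<..}"])
         (use 1 in \<open>auto simp: flat_exp_def\<close>)
  next
    case 2
    have "((\<lambda>y. 0) has_real_derivative (flat_exp (n + 2) y - real n * flat_exp (Suc n) y)) (at y)"
      using 2 by (auto simp: flat_exp_def)
    then show ?thesis
      by (rule has_field_derivative_transform_within_open[of _ _ _ "{..<0}"])
         (use 2 in \<open>auto simp: flat_exp_def\<close>)
  next
    case 3
    have "((\<lambda>h. flat_exp n h / h) \<longlongrightarrow> 0) (at 0)"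
      by (rule Lim_transform_eventually[OF flat_exp_tendsto_0[of "Suc n"]])
         (auto simp: flat_exp_def field_simps)
    then show ?thesis using 3 by (simp add: has_field_derivative_iff flat_exp_def)
  qed
qed

lemma Ck_on_flat_exp:
  assumes g: "\<And>k. Ck_on k g UNIV"
  shows "Ck_on k (\<lambda>z. flat_exp n (g z)) UNIV"
proof (induction k arbitrary: n)
  case 0
  have "continuous_on UNIV (flat_exp n)"
    using flat_exp_deriv by (intro DERIV_continuous_on) (auto intro: DERIV_subset)
  then show ?case
    using g[of 0] continuous_on_compose2[of UNIV "flat_exp n" UNIV g] by simp
next
  case (Suc k)
  have d: "((\<lambda>z. flat_exp n (g z)) has_derivative
      (\<lambda>v. (flat_exp (n + 2) (g z) + - real n * flat_exp (Suc n) (g z)) * dir_deriv g v z)) (at z)" for z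
  proof -
    have "(g has_derivative (\<lambda>v. dir_deriv g v z)) (at z)"
      using g[of 1] by (simp add: dir_deriv_def frechet_derivative_works)
    from has_derivative_compose[OF this flat_exp_deriv[unfolded has_field_derivative_def]]
    show ?thesis by (simp add: mult_ac)
  qed
  have "dir_deriv (\<lambda>z. flat_exp n (g z)) v =
      (\<lambda>z. (flat_exp (n + 2) (g z) + - real n * flat_exp (Suc n) (g z)) * dir_deriv g v z)" for v
    by (rule ext, rule dir_deriv_eq, rule d)
  moreover have "Ck_on k (dir_deriv g v) UNIV" for v using g[of "Suc k"] by simp
  moreover have "Ck_on k (\<lambda>z. (flat_exp (n + 2) (g z) + - real n * flat_exp (Suc n) (g z)) * h z) UNIV"
    if "Ck_on k h UNIV" for h
    by (intro Ck_on_mult Ck_on_add Suc Ck_on_const that)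
  ultimately show ?case
    unfolding Ck_on.simps using d by (metis differentiable_def)
qed

lemma Ck_on_paraboloid:
  fixes z0 :: "'a::euclidean_space"
  shows "Ck_on k (\<lambda>z. \<rho> - (z - z0) \<bullet> (z - z0)) UNIV"
proof -
  have lin: "Ck_on k (\<lambda>z. (z - z0) \<bullet> w) UNIV" for k w
  proof (cases k)
    case (Suc j)
    have d: "((\<lambda>z. (z - z0) \<bullet> w) has_derivative (\<lambda>v. v \<bullet> w)) (at z)" for z
      by (auto intro!: derivative_eq_intros)
    have "dir_deriv (\<lambda>z. (z - z0) \<bullet> w) v = (\<lambda>z. v \<bullet> w)" for v
      by (rule ext, rule dir_deriv_eq, rule d)
    with d show ?thesis by (auto simp: Suc Ck_on_const differentiable_def)
  qed (auto intro!: continuous_intros)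
  show ?thesis
  proof (cases k)
    case (Suc j)
    have d: "((\<lambda>z. \<rho> - (z - z0) \<bullet> (z - z0)) has_derivative (\<lambda>v. (-2) * ((z - z0) \<bullet> v))) (at z)" for z
      by (auto intro!: derivative_eq_intros simp: inner_commute)
    have "dir_deriv (\<lambda>z. \<rho> - (z - z0) \<bullet> (z - z0)) v = (\<lambda>z. (-2) * ((z - z0) \<bullet> v))" for v
      by (rule ext, rule dir_deriv_eq, rule d)
    moreover have "Ck_on j (\<lambda>z. (-2) * ((z - z0) \<bullet> v)) UNIV" for v
      by (rule Ck_on_mult[OF Ck_on_const lin])
    ultimately show ?thesis using d by (auto simp: Suc differentiable_def)
  qed (auto intro!: continuous_intros)
qed

text \<open>Composing the flat function with a paraboloid that is positive exactly inside the ball gives the usual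
  bump.\<close>

lemma bump_test_function:
  fixes z0 :: "'a::euclidean_space"
  assumes "\<rho> > 0" "cball z0 \<rho> \<subseteq> S"
  obtains \<phi> where "\<phi> \<in> test_functions S" "\<And>z. \<phi> z \<ge> 0" "\<phi> z0 > 0" "\<And>z. z \<notin> cball z0 \<rho> \<Longrightarrow> \<phi> z = 0"
proof
  define \<phi> where "\<phi> = (\<lambda>z. flat_exp 0 (\<rho>\<^sup>2 - (z - z0) \<bullet> (z - z0)))"
  show out: "z \<notin> cball z0 \<rho> \<Longrightarrow> \<phi> z = 0" for z
    using assms(1) power_strict_mono[of \<rho> "norm (z - z0)" 2]
    by (auto simp: \<phi>_def flat_exp_def dist_norm norm_minus_commute dot_square_norm)
  show "\<phi> z \<ge> 0" for z by (simp add: \<phi>_def flat_exp_def)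
  show "\<phi> z0 > 0" using assms(1) by (simp add: \<phi>_def flat_exp_pos)
  have sub: "closure {z. \<phi> z \<noteq> 0} \<subseteq> cball z0 \<rho>"
    using out by (intro closure_minimal closed_cball) blast
  then have "compact (closure {z. \<phi> z \<noteq> 0})"
    using bounded_subset[OF bounded_cball] closed_closure compact_eq_bounded_closed by blast
  moreover have "smooth_on \<phi> UNIV"
    unfolding smooth_on_def \<phi>_def by (intro allI Ck_on_flat_exp Ck_on_paraboloid)
  ultimately show "\<phi> \<in> test_functions S"
    using order_trans[OF sub assms(2)] unfolding test_functions_def by blast
qed

section \<open>Integration by parts\<close>

lemma continuous_on_zero_extension:
  fixes g :: "'a::t2_space \<Rightarrow> real"
  assumes "open S" "closed K" "K \<subseteq> S" "continuous_on S g" "\<And>x. x \<in> S - K \<Longrightarrow> g x = 0"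
  shows "continuous_on UNIV (\<lambda>x. if x \<in> S then g x else 0)"
proof -
  have "continuous_on S (\<lambda>x. if x \<in> S then g x else 0)"
    using assms(4) by (rule continuous_on_eq) simp
  moreover have "continuous_on (- K) (\<lambda>x. if x \<in> S then g x else 0)"
    by (rule continuous_on_eq[OF continuous_on_const[of _ 0]]) (use assms(5) in auto)
  moreover have "S \<union> - K = UNIV" using assms(3) by auto
  ultimately show ?thesis
    using continuous_on_open_Un[OF assms(1) open_Compl[OF assms(2)]] by metis
qed

text \<open>By translation invariance \<open>\<integral> g (x + h v) dx\<close> does not depend on \<open>h\<close>, and differentiating under
  the integral at \<open>h = 0\<close> gives the claim. The open set \<open>S\<close> allows for functions that are only controlled
  there; outside \<open>K\<close> they vanish and are extended by zero. All integrations by parts below, in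
  space-time and in space, are instances of this lemma.\<close>

lemma integral_directional_derivative_eq_0:
  fixes g g' :: "'a::euclidean_space \<Rightarrow> real"
  assumes S: "open S" "compact K" "K \<subseteq> S"
    and cont: "continuous_on S g" "continuous_on S g'"
    and zero: "\<And>x. x \<in> S - K \<Longrightarrow> g x = 0"
    and deriv: "\<And>x. x \<in> S \<Longrightarrow> ((\<lambda>h. g (x + h *\<^sub>R v)) has_real_derivative g' x) (at 0)"
  shows "((\<lambda>x. if x \<in> S then g' x else 0) has_integral 0) UNIV"
proof -
  define G where "G = (\<lambda>x. if x \<in> S then g x else 0)"
  define G' where "G' = (\<lambda>x. if x \<in> S then g' x else 0)"
  have K: "closed K" using S(2) by (rule compact_imp_closed)
  have lim: "((\<lambda>h::real. x + h *\<^sub>R v) \<longlongrightarrow> x) (at 0)" for x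
    by (auto intro!: tendsto_eq_intros)
  have Gzero: "G x = 0" if "x \<notin> K" for x using zero that by (auto simp: G_def)
  have G'0: "G' x = 0" if x: "x \<notin> K" for x
  proof (cases "x \<in> S")
    case True
    have "\<forall>\<^sub>F h in nhds 0. x + h *\<^sub>R v \<in> S - K"
      using topological_tendstoD[OF lim[of x], of "S - K"] True x S(1) K
      by (auto simp: eventually_nhds_conv_at)
    then have "\<forall>\<^sub>F h in nhds 0. g (x + h *\<^sub>R v) = 0"
      by eventually_elim (rule zero)
    then have "((\<lambda>h. 0) has_real_derivative g' x) (at 0)"
      using deriv[OF True] by (subst (asm) DERIV_cong_ev) auto
    then have "g' x = 0" using DERIV_const DERIV_unique by blast
    then show ?thesis by (simp add: G'_def)
  qed (simp add: G'_def)
  have contG: "continuous_on UNIV G" "continuous_on UNIV G'"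
    unfolding G_def G'_def
    by (intro continuous_on_zero_extension[OF S(1) K S(3)] cont zero, assumption)
       (intro continuous_on_zero_extension[OF S(1) K S(3)] cont, use G'0 in \<open>force simp: G'_def\<close>)
  have d0: "((\<lambda>h. G (x + h *\<^sub>R v)) has_real_derivative G' x) (at 0)" for x
  proof (cases "x \<in> S")
    case True
    have "\<forall>\<^sub>F h in nhds 0. x + h *\<^sub>R v \<in> S"
      using topological_tendstoD[OF lim[of x], of S] True S(1)
      by (auto simp: eventually_nhds_conv_at)
    then have "\<forall>\<^sub>F h in nhds 0. G (x + h *\<^sub>R v) = g (x + h *\<^sub>R v)"
      by eventually_elim (simp add: G_def)
    then show ?thesis
      using deriv[OF True] True by (subst DERIV_cong_ev) (auto simp: G'_def)
  next
    case False
    then have "x \<in> - K" using S(3) by auto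
    then have "\<forall>\<^sub>F h in nhds 0. x + h *\<^sub>R v \<in> - K"
      using topological_tendstoD[OF lim[of x], of "- K"] K
      by (auto simp: eventually_nhds_conv_at)
    then have "\<forall>\<^sub>F h in nhds 0. G (x + h *\<^sub>R v) = 0"
      by eventually_elim (simp add: Gzero)
    then show ?thesis
      using False by (subst DERIV_cong_ev) (auto simp: G'_def)
  qed
  have d: "((\<lambda>h. G (x + h *\<^sub>R v)) has_real_derivative G' (x + h *\<^sub>R v)) (at h)" for x h
  proof -
    have "((\<lambda>k. G (x + (h + k) *\<^sub>R v)) has_real_derivative G' (x + h *\<^sub>R v)) (at 0)"
      using d0[of "x + h *\<^sub>R v"] by (simp add: scaleR_add_left add.assoc)
    then show ?thesis
      using DERIV_at_within_shift[of "\<lambda>h. G (x + h *\<^sub>R v)" "G' (x + h *\<^sub>R v)" h 0 UNIV] by (simp add: surj_plus)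
  qed
  \<comment> \<open>A box that contains the support of all translates with \<open>\<bar>h\<bar> \<le> 1\<close>.\<close>
  obtain a where a: "K \<subseteq> cbox (- a) a" and a': "(\<Union>h\<in>{-1..1}. (\<lambda>x. x - h *\<^sub>R v) ` K) \<subseteq> cbox (- a) a"
  proof -
    have "compact ((\<lambda>(h, x). x - h *\<^sub>R v) ` ({-1..1::real} \<times> K))"
      by (intro compact_continuous_image compact_Times S(2)) (auto intro!: continuous_intros simp: split_beta)
    then obtain a where "(\<lambda>(h, x). x - h *\<^sub>R v) ` ({-1..1::real} \<times> K) \<subseteq> cbox (- a) a"
      using bounded_subset_cbox_symmetric compact_imp_bounded by metis
    then have *: "x - h *\<^sub>R v \<in> cbox (-a) a" if "x \<in> K" "h \<in> {-1..1}" for x h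
      using that by (auto dest!: subsetD[OF _ imageI[of "(h, x)"]])
    show ?thesis
      by (rule that[of a]) (use *[of _ 0] * in auto)
  qed
  define F where "F = (\<lambda>h. integral (cbox (-a) a) (\<lambda>x. G (x + h *\<^sub>R v)))"
  have intG: "(G has_integral integral (cbox (-a) a) G) (cbox (-a) a)"
    by (intro integrable_integral integrable_continuous continuous_on_subset[OF contG(1)]) auto
  have Fconst: "F h = integral UNIV G" if h: "h \<in> {-1..1}" for h
  proof -
    let ?c = "h *\<^sub>R v"
    have i: "(G has_integral integral (cbox (-a + ?c) (a + ?c)) G) (cbox (-a + ?c) (a + ?c))"
      by (intro integrable_integral integrable_continuous continuous_on_subset[OF contG(1)]) auto
    have o: "G x = 0" if "x \<notin> cbox (-a + ?c) (a + ?c)" for x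
    proof (rule Gzero, rule notI)
      assume "x \<in> K"
      with h have "x - ?c \<in> (\<Union>h\<in>{-1..1}. (\<lambda>x. x - h *\<^sub>R v) ` K)" by blast
      with a' have "x - ?c \<in> cbox (-a) a" by blast
      then show False using that by (auto simp: mem_box algebra_simps)
    qed
    have "(G has_integral integral (cbox (-a + ?c) (a + ?c)) G) UNIV"
      using has_integral_on_superset[OF i] o by auto
    moreover have "((\<lambda>x. G (x + ?c)) has_integral integral (cbox (-a + ?c) (a + ?c)) G) (cbox (-a) a)"
      using i has_integral_shift_cbox_iff[of G ?c _ "-a" a] by (simp add: o_def add.commute)
    ultimately show ?thesis unfolding F_def by (metis integral_unique)
  qed
  have "(F has_real_derivative integral (cbox (-a) a) (\<lambda>x. G' (x + 0 *\<^sub>R v))) (at 0 within {-1..1})"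
    unfolding F_def
  proof (rule leibniz_rule_field_derivative)
    show "((\<lambda>h. G (x + h *\<^sub>R v)) has_real_derivative G' (x + h *\<^sub>R v)) (at h within {-1..1})" for h x
      using d by (rule DERIV_subset) simp
    show "(\<lambda>x. G (x + h *\<^sub>R v)) integrable_on cbox (- a) a" for h
      by (intro integrable_continuous continuous_on_compose2[OF contG(1)] continuous_intros) auto
    show "continuous_on ({-1..1} \<times> cbox (- a) a) (\<lambda>(h, x). G' (x + h *\<^sub>R v))"
      unfolding split_beta
      by (intro continuous_on_compose2[OF contG(2)] continuous_intros) auto
  qed auto
  then have "(F has_real_derivative integral (cbox (-a) a) G') (at 0)"
    by (simp add: at_within_Icc_at)
  moreover have "(F has_real_derivative 0) (at 0)"
    by (rule has_field_derivative_transform_within_open[of "\<lambda>_. integral UNIV G" _ _ "{-1<..<1}"])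
       (auto simp: Fconst)
  ultimately have "integral (cbox (-a) a) G' = 0" using DERIV_unique by blast
  moreover have "(G' has_integral integral (cbox (-a) a) G') (cbox (-a) a)"
    by (intro integrable_integral integrable_continuous continuous_on_subset[OF contG(2)]) auto
  ultimately have "(G' has_integral 0) UNIV"
    using has_integral_on_superset[of G' 0 "cbox (-a) a" UNIV] a G'0 by auto
  then show ?thesis by (simp add: G'_def)
qed

section \<open>The pointwise equation\<close>

text \<open>The space-time region before extinction.\<close>

definition live_set :: "real \<Rightarrow> 'a::euclidean_space set \<Rightarrow> (real \<Rightarrow> 'a \<Rightarrow> real) \<Rightarrow> (real \<times> 'a) set" where
  "live_set T \<Omega> u = {(t, x). t \<in> {0<..<T} \<and> x \<in> \<Omega> \<and> (\<exists>y\<in>\<Omega>. u t y \<noteq> 0)}"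

lemma live_setD:
  assumes "positive_smooth_unless_extinct T \<Omega> u"
  shows "z \<in> live_set T \<Omega> u \<Longrightarrow> case_prod u z > 0" "smooth_on (case_prod u) (live_set T \<Omega> u)"
  using assms by (auto simp: positive_smooth_unless_extinct_def live_set_def Let_def)

text \<open>Differentiability at a point is differentiability in a full neighbourhood, so the solution is
  continuous there as a function on all of space-time. Positivity therefore persists nearby, which keeps the
  neighbouring times alive.\<close>

lemma open_live_set:
  assumes "positive_smooth_unless_extinct T \<Omega> u" "open \<Omega>"
  shows "open (live_set T \<Omega> u)"
proof (subst open_subopen, safe)
  fix t x assume z: "(t, x) \<in> live_set T \<Omega> u"
  have "Ck_on 1 (case_prod u) (live_set T \<Omega> u)"
    using live_setD(2)[OF assms(1)] unfolding smooth_on_def by blast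
  then have "case_prod u differentiable (at (t, x))"
    using z unfolding One_nat_def Ck_on.simps by blast
  from differentiable_imp_continuous_within[OF this]
  have "(case_prod u \<longlongrightarrow> case_prod u (t, x)) (nhds (t, x))"
    unfolding continuous_within tendsto_at_iff_tendsto_nhds .
  then have ev1: "\<forall>\<^sub>F y in nhds (t, x). case_prod u y > 0"
    using order_tendstoD(1)[of "case_prod u"] live_setD(1)[OF assms(1) z] by blast
  have ev2: "\<forall>\<^sub>F y in nhds (t, x). y \<in> {0<..<T} \<times> \<Omega>"
    using z assms(2) by (intro eventually_nhds_in_open open_Times) (auto simp: live_set_def)
  have "\<forall>\<^sub>F y in nhds (t, x). y \<in> live_set T \<Omega> u"
    using ev1 ev2
  proof eventually_elim
    case (elim y)
    then show ?case by (cases y) (force simp: live_set_def)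
  qed
  then show "\<exists>U. open U \<and> (t, x) \<in> U \<and> U \<subseteq> live_set T \<Omega> u"
    unfolding eventually_nhds by blast
qed

lemma dir_deriv_eq_0_open:
  assumes "open V" "z \<in> V" "\<And>y. y \<in> V \<Longrightarrow> f y = 0"
  shows "dir_deriv f v z = 0"
proof -
  have "(f has_derivative (\<lambda>v. 0)) (at z)"
    by (rule has_derivative_transform_within_open[of "\<lambda>_. 0" _ _ _ V]) (use assms in auto)
  then show ?thesis by (rule dir_deriv_eq)
qed

lemma fde_flux_deriv:
  assumes "v > 0"
  shows "(fde_flux m has_real_derivative v powr (m - 1)) (at v)"
proof (cases "m = 0")
  case True
  have "(ln has_real_derivative v powr (m - 1)) (at v)"
    using assms True by (auto intro!: derivative_eq_intros simp: powr_minus divide_simps)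
  then show ?thesis
    using True by (simp add: fde_flux_def[abs_def])
next
  case False
  have "((\<lambda>v. v powr m / m) has_real_derivative v powr (m - 1)) (at v)"
    using assms False by (auto intro!: derivative_eq_intros)
  then show ?thesis
    using False by (simp add: fde_flux_def[abs_def])
qed

lemma continuous_nonneg_has_integral_0:
  fixes f :: "'a::euclidean_space \<Rightarrow> real"
  assumes "continuous_on UNIV f" "\<And>x. f x \<ge> 0" "(f has_integral 0) UNIV"
  shows "f x = 0"
proof -
  let ?C = "cbox (x - One) (x + One)"
  have i: "f integrable_on ?C"
    by (intro integrable_continuous continuous_on_subset[OF assms(1)]) auto
  have "integral ?C f \<le> integral UNIV f"
    by (rule integral_subset_le) (use i assms in auto)
  moreover have "integral ?C f \<ge> 0" by (rule integral_nonneg) (use i assms in auto)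
  ultimately have "(f has_integral 0) ?C"
    using i assms(3) integral_unique by (metis antisym_conv integrable_integral)
  then show ?thesis
    by (rule has_integral_0_cbox_imp_0[rotated 2])
       (use assms in \<open>auto intro: continuous_on_subset simp: box_ne_empty mem_box inner_diff_left inner_add_left\<close>)
qed

text \<open>This is the fundamental lemma of the calculus of variations. One integration by parts in time and two
  in space move all derivatives from the test function to \<open>u\<close>, so that \<open>\<partial>\<^sub>t u\<close> minus the expanded Laplacian of
  \<open>u\<^sup>m/m\<close> is orthogonal to all test functions supported in the live set. If it were nonzero at some point, a bump
  near that point would contradict this.\<close>

lemma classical_equation:
  fixes u :: "real \<Rightarrow> 'a::euclidean_space \<Rightarrow> real"
  defines "w \<equiv> case_prod u"
  assumes weak: "weak_solution m T \<Omega> u" and smooth: "positive_smooth_unless_extinct T \<Omega> u"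
    and \<Omega>: "open \<Omega>" and z0: "z0 \<in> live_set T \<Omega> u"
  shows "dt w z0 = (\<Sum>b\<in>Basis. w z0 powr (m - 1) * dir_deriv (dir_deriv w (0, b)) (0, b) z0
            + (m - 1) * w z0 powr (m - 2) * (dir_deriv w (0, b) z0)\<^sup>2)"
proof -
  define Q where "Q = live_set T \<Omega> u"
  define rhs where "rhs = (\<lambda>z b. w z powr (m - 1) * dir_deriv (dir_deriv w (0, b)) (0, b) z
            + (m - 1) * w z powr (m - 2) * (dir_deriv w (0, b) z)\<^sup>2)"
  define h where "h = (\<lambda>z. dt w z - (\<Sum>b\<in>Basis. rhs z b))"
  have Q: "open Q" unfolding Q_def using open_live_set[OF smooth \<Omega>] .
  have pos: "w z > 0" if "z \<in> Q" for z using live_setD(1)[OF smooth] that by (simp add: Q_def w_def)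
  have Ck: "Ck_on k w Q" for k
    using live_setD(2)[OF smooth] by (simp add: smooth_on_def w_def Q_def)
  have Ck1: "Ck_on k (dir_deriv w v) Q" for k v
    using Ck[of "Suc k"] unfolding Ck_on.simps by blast
  have Ck2: "Ck_on k (dir_deriv (dir_deriv w v) v') Q" for k v v'
    using Ck1[of "Suc k"] unfolding Ck_on.simps by blast
  have dw: "w differentiable (at z)" "dir_deriv w v differentiable (at z)" if "z \<in> Q" for z v
    using Ck[of 1] Ck1[of 1] that unfolding One_nat_def Ck_on.simps by blast+
  note cont = Ck_on_imp_continuous_on[OF Ck] Ck_on_imp_continuous_on[OF Ck1] Ck_on_imp_continuous_on[OF Ck2]
  have conth: "continuous_on Q h"
    unfolding h_def rhs_def dt_def by (intro continuous_intros cont) (use pos in force)+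
  have contF: "continuous_on Q (\<lambda>z. fde_flux m (w z))"
    by (rule continuous_on_compose2[of "{0<..}" "fde_flux m"])
       (use pos in \<open>auto intro!: DERIV_continuous_on cont intro: DERIV_subset[OF fde_flux_deriv]\<close>)
  have key: "((\<lambda>z. if z \<in> Q then h z * \<phi> z else 0) has_integral 0) UNIV"
    if phi: "\<phi> \<in> test_functions Q" for \<phi>
  proof -
    define K where "K = closure {z. \<phi> z \<noteq> 0}"
    have K: "compact K" "K \<subseteq> Q" "open (- K)"
      using phi by (auto simp: test_functions_def K_def)
    have P: "Ck_on k \<phi> UNIV" for k using phi by (auto simp: test_functions_def smooth_on_def)
    have P1: "Ck_on k (dir_deriv \<phi> v) UNIV" for k v
      using P[of "Suc k"] unfolding Ck_on.simps by blast
    have P2: "Ck_on k (dir_deriv (dir_deriv \<phi> v) v') UNIV" for k v v'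
      using P1[of "Suc k"] unfolding Ck_on.simps by blast
    have dP: "\<phi> differentiable (at z)" "dir_deriv \<phi> v differentiable (at z)" for z v
      using P[of 1] P1[of 1] unfolding One_nat_def Ck_on.simps by blast+
    have contP: "continuous_on Q \<phi>" "continuous_on Q (dir_deriv \<phi> v)"
       "continuous_on Q (dir_deriv (dir_deriv \<phi> v) v')" for v v'
      by (rule continuous_on_subset[OF Ck_on_imp_continuous_on subset_UNIV], rule P P1 P2)+
    have Z0: "\<phi> z = 0" if "z \<in> - K" for z
      using that closure_subset[of "{z. \<phi> z \<noteq> 0}"] by (auto simp: K_def)
    have Z1: "dir_deriv \<phi> v z = 0" if "z \<in> - K" for z v
      using dir_deriv_eq_0_open[OF K(3) that Z0] .
    have Z2: "dir_deriv (dir_deriv \<phi> v) v' z = 0" if "z \<in> - K" for z v v'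
      using dir_deriv_eq_0_open[OF K(3) that Z1] .
    \<comment> \<open>The total derivatives \<open>\<partial>\<^sub>t (w \<phi>)\<close> and, for each \<open>b\<close>, \<open>\<partial>\<^sub>b (\<Psi> \<partial>\<^sub>b \<phi> - \<phi> \<partial>\<^sub>b \<Psi>)\<close>, where \<open>\<Psi>\<close> is the flux of \<open>w\<close>.\<close>
    have T: "((\<lambda>z. if z \<in> Q then dt w z * \<phi> z + w z * dt \<phi> z else 0) has_integral 0) UNIV"
    proof (rule integral_directional_derivative_eq_0[OF Q K(1,2)])
      show "continuous_on Q (\<lambda>z. w z * \<phi> z)" "continuous_on Q (\<lambda>z. dt w z * \<phi> z + w z * dt \<phi> z)"
        unfolding dt_def by (intro continuous_intros cont contP)+
      show "((\<lambda>h. w (z + h *\<^sub>R (1, 0)) * \<phi> (z + h *\<^sub>R (1, 0))) has_real_derivative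
              dt w z * \<phi> z + w z * dt \<phi> z) (at 0)" if "z \<in> Q" for z
        by (rule DERIV_cong[OF DERIV_mult[OF dir_deriv_line[OF dw(1)[OF that]] dir_deriv_line[OF dP(1)]]])
           (simp add: dt_def zero_prod_def[symmetric])
    qed (use Z0 in auto)
    have X: "((\<lambda>z. if z \<in> Q then fde_flux m (w z) * dir_deriv (dir_deriv \<phi> (0, b)) (0, b) z
                 - \<phi> z * rhs z b else 0) has_integral 0) UNIV" for b :: 'a
    proof -
      define v where "v = (0 :: real, b)"
      have rhs_v: "rhs z b = w z powr (m - 1) * dir_deriv (dir_deriv w v) v z
            + (m - 1) * w z powr (m - 2) * (dir_deriv w v z)\<^sup>2" for z
        by (simp add: rhs_def v_def)
      show ?thesis unfolding v_def[symmetric]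
      proof (rule integral_directional_derivative_eq_0[OF Q K(1,2)])
        show "continuous_on Q (\<lambda>z. fde_flux m (w z) * dir_deriv \<phi> v z - \<phi> z * (w z powr (m - 1) * dir_deriv w v z))"
          by (intro continuous_intros cont contP contF) (use pos in force)
        show "continuous_on Q (\<lambda>z. fde_flux m (w z) * dir_deriv (dir_deriv \<phi> v) v z - \<phi> z * rhs z b)"
          unfolding rhs_v by (intro continuous_intros cont contP contF) (use pos in force)+
        show "((\<lambda>h. fde_flux m (w (z + h *\<^sub>R v)) * dir_deriv \<phi> v (z + h *\<^sub>R v) -
            \<phi> (z + h *\<^sub>R v) * (w (z + h *\<^sub>R v) powr (m - 1) * dir_deriv w v (z + h *\<^sub>R v)))
            has_real_derivative fde_flux m (w z) * dir_deriv (dir_deriv \<phi> v) v z - \<phi> z * rhs z b) (at 0)"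
          if z: "z \<in> Q" for z
        proof -
          note 1 = dir_deriv_line[OF dw(1)[OF z], of v] and 2 = dir_deriv_line[OF dw(2)[OF z], of v v]
            and 3 = dir_deriv_line[OF dP(1), of z v] and 4 = dir_deriv_line[OF dP(2), of v z v]
          have F: "((\<lambda>h. fde_flux m (w (z + h *\<^sub>R v))) has_real_derivative
              w z powr (m - 1) * dir_deriv w v z) (at 0)"
            using DERIV_chain2[OF _ 1, of "fde_flux m"] fde_flux_deriv[OF pos[OF z], of m] by simp
          have W: "((\<lambda>h. w (z + h *\<^sub>R v) powr (m - 1)) has_real_derivative
              (m - 1) * w z powr (m - 2) * dir_deriv w v z) (at 0)"
            using DERIV_fun_powr[OF 1, of "m - 1"] pos[OF z] by (simp add: mult_ac)
          show ?thesis
            by (rule DERIV_cong[OF DERIV_diff[OF DERIV_mult[OF F 4] DERIV_mult[OF 3 DERIV_mult[OF W 2]]]])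
               (simp add: rhs_v algebra_simps power2_eq_square)
        qed
      qed (use Z0 Z1 in auto)
    qed
    have A: "((\<lambda>z. (if z \<in> Q then dt w z * \<phi> z + w z * dt \<phi> z else 0) +
        (\<Sum>b\<in>Basis. if z \<in> Q then fde_flux m (w z) * dir_deriv (dir_deriv \<phi> (0, b)) (0, b) z
                 - \<phi> z * rhs z b else 0)) has_integral 0 + (\<Sum>b\<in>(Basis::'a set). 0)) UNIV"
      by (intro has_integral_add T has_integral_sum X finite_Basis)
    have "Q \<subseteq> {(t, x). t \<in> {0<..<T} \<and> x \<in> \<Omega> \<and> (m > 0 \<or> u t x > 0)}"
      using pos by (auto simp: Q_def live_set_def w_def)
    then have "\<phi> \<in> test_functions {(t, x). t \<in> {0<..<T} \<and> x \<in> \<Omega> \<and> (m > 0 \<or> u t x > 0)}"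
      using phi by (auto simp: test_functions_def)
    then have "has_bochner_integral lebesgue
          (\<lambda>(t, x). u t x * dt \<phi> (t, x) + fde_flux m (u t x) * laplace_x \<phi> (t, x)) 0"
      using weak by (simp add: weak_solution_def)
    then have "has_bochner_integral lebesgue (\<lambda>z. w z * dt \<phi> z + fde_flux m (w z) * laplace_x \<phi> z) 0"
      by (simp add: w_def case_prod_beta')
    then have "integrable lebesgue (\<lambda>z. w z * dt \<phi> z + fde_flux m (w z) * laplace_x \<phi> z)"
      "integral\<^sup>L lebesgue (\<lambda>z. w z * dt \<phi> z + fde_flux m (w z) * laplace_x \<phi> z) = 0"
      unfolding has_bochner_integral_iff by blast+
    then have B: "((\<lambda>z. w z * dt \<phi> z + fde_flux m (w z) * laplace_x \<phi> z) has_integral 0) UNIV"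
      using has_integral_integral_lebesgue[of "\<lambda>z. w z * dt \<phi> z + fde_flux m (w z) * laplace_x \<phi> z"]
      by simp
    have eq: "(if z \<in> Q then dt w z * \<phi> z + w z * dt \<phi> z else 0) +
        (\<Sum>b\<in>Basis. if z \<in> Q then fde_flux m (w z) * dir_deriv (dir_deriv \<phi> (0, b)) (0, b) z
                 - \<phi> z * rhs z b else 0) - (w z * dt \<phi> z + fde_flux m (w z) * laplace_x \<phi> z) =
        (if z \<in> Q then h z * \<phi> z else 0)" for z
    proof (cases "z \<in> Q")
      case True
      then show ?thesis
        by (simp add: h_def laplace_x_def sum_subtractf sum_distrib_left[symmetric] algebra_simps)
    next
      case False
      then have "z \<in> - K" using K(2) by auto
      then show ?thesis using False Z1 Z2 by (simp add: laplace_x_def dt_def)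
    qed
    show ?thesis using has_integral_diff[OF A B] unfolding eq by simp
  qed
  have z0: "z0 \<in> Q" using z0 by (simp add: Q_def)
  have "h z0 = 0"
  proof (rule ccontr)
    assume "h z0 \<noteq> 0"
    \<comment> \<open>Multiplying by the sign at \<open>z0\<close> treats both signs at once.\<close>
    define N where "N = {z \<in> Q. sgn (h z0) * h z > 0}"
    have N: "N = Q \<inter> (\<lambda>z. sgn (h z0) * h z) -` {0<..}" by (auto simp: N_def)
    have "open N"
      unfolding N by (intro continuous_open_preimage Q continuous_intros conth)
    moreover have "z0 \<in> N" using z0 \<open>h z0 \<noteq> 0\<close> by (auto simp: N_def sgn_if)
    ultimately obtain \<rho> where \<rho>: "\<rho> > 0" "cball z0 \<rho> \<subseteq> N" using open_contains_cball by blast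
    then have \<rho>Q: "cball z0 \<rho> \<subseteq> Q" by (auto simp: N_def)
    obtain \<phi> where \<phi>: "\<phi> \<in> test_functions Q" "\<And>z. \<phi> z \<ge> 0" "\<phi> z0 > 0" "\<And>z. z \<notin> cball z0 \<rho> \<Longrightarrow> \<phi> z = 0"
      using bump_test_function[OF \<rho>(1) \<rho>Q] by blast
    let ?f = "\<lambda>z. if z \<in> Q then sgn (h z0) * (h z * \<phi> z) else 0"
    have "?f z0 = 0"
    proof (rule continuous_nonneg_has_integral_0[of ?f z0])
      have "Ck_on 0 \<phi> UNIV" using \<phi>(1) by (auto simp: test_functions_def smooth_on_def)
      then show "continuous_on UNIV ?f"
        using \<phi>(4) by (intro continuous_on_zero_extension[OF Q closed_cball \<rho>Q] continuous_intros conth)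
             (auto intro: continuous_on_subset)
      show "?f z \<ge> 0" for z
      proof (cases "z \<in> cball z0 \<rho>")
        case True
        then have "z \<in> N" using \<rho>(2) by blast
        then show ?thesis using \<phi>(2)[of z] by (auto simp: N_def mult.assoc[symmetric])
      qed (simp add: \<phi>(4))
      show "(?f has_integral 0) UNIV"
        using has_integral_mult_right[OF key[OF \<phi>(1)], of "sgn (h z0)"]
        by (simp add: if_distrib cong: if_cong)
    qed
    then show False using \<open>h z0 \<noteq> 0\<close> z0 \<phi>(3) by (auto simp: sgn_if split: if_splits)
  qed
  then show ?thesis by (simp add: h_def rhs_def)
qed

section \<open>A cutoff and integrals up to a moving endpoint\<close>

lemma pos_part_square_deriv:
  "((\<lambda>y. (max 0 y)\<^sup>2) has_real_derivative 2 * max 0 y) (at (y::real))"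
proof -
  consider "y > 0" | "y < 0" | "y = 0" by linarith
  then show ?thesis
  proof cases
    case 1
    have "((\<lambda>y. y\<^sup>2) has_real_derivative 2 * max 0 y) (at y)"
      using 1 by (auto intro!: derivative_eq_intros)
    then show ?thesis
      by (rule has_field_derivative_transform_within_open[of _ _ _ "{0<..}"]) (use 1 in auto)
  next
    case 2
    have "((\<lambda>y. 0) has_real_derivative 2 * max 0 y) (at y)"
      using 2 by auto
    then show ?thesis
      by (rule has_field_derivative_transform_within_open[of _ _ _ "{..<0}"]) (use 2 in auto)
  next
    case 3
    have eq: "max 0 h = (max 0 h)\<^sup>2 / h" if "h \<noteq> 0" for h :: real
      using that by (cases "h > 0") (simp_all add: power2_eq_square)
    have "((\<lambda>h. max 0 h) \<longlongrightarrow> max 0 (0::real)) (at 0)"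
      by (intro tendsto_intros)
    then have "((\<lambda>h::real. (max 0 h)\<^sup>2 / h) \<longlongrightarrow> max 0 0) (at 0)"
      by (rule Lim_transform_eventually) (use eq in \<open>auto simp: eventually_at_filter\<close>)
    then show ?thesis using 3 by (simp add: has_field_derivative_iff)
  qed
qed

text \<open>One continuous derivative is all that the flux in \<open>truncated_energy_decreasing\<close> asks of the step, so squares
  of positive parts are smooth enough.\<close>

definition cutoff :: "real \<Rightarrow> real" where
  "cutoff z = (max 0 (z - 1))\<^sup>2 / ((max 0 (z - 1))\<^sup>2 + (max 0 (2 - z))\<^sup>2)"

definition cutoff' :: "real \<Rightarrow> real" where
  "cutoff' z = (2 * max 0 (z - 1) * (max 0 (2 - z))\<^sup>2 + (max 0 (z - 1))\<^sup>2 * (2 * max 0 (2 - z)))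
     / ((max 0 (z - 1))\<^sup>2 + (max 0 (2 - z))\<^sup>2)\<^sup>2"

lemma cutoff_denominator_pos: "(max 0 (z - 1))\<^sup>2 + (max 0 (2 - z))\<^sup>2 > (0::real)"
proof (cases "z > 1")
  case True
  then have "(max 0 (z - 1))\<^sup>2 > 0" by simp
  then show ?thesis by (simp add: add_pos_nonneg)
next
  case False
  then have "(max 0 (2 - z))\<^sup>2 > 0" by simp
  then show ?thesis by (simp add: add_nonneg_pos)
qed

lemma cutoff_deriv: "(cutoff has_real_derivative cutoff' z) (at z)"
proof -
  have d1: "((\<lambda>z. (max 0 (z - 1))\<^sup>2) has_real_derivative 2 * max 0 (z - 1)) (at z)"
  proof -
    have "((\<lambda>z. z - 1) has_real_derivative 1) (at z)" by (auto intro!: derivative_eq_intros)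
    from DERIV_chain2[OF pos_part_square_deriv this] show ?thesis by simp
  qed
  have d2: "((\<lambda>z. (max 0 (2 - z))\<^sup>2) has_real_derivative - (2 * max 0 (2 - z))) (at z)"
  proof -
    have "((\<lambda>z. 2 - z) has_real_derivative - 1) (at z)" by (auto intro!: derivative_eq_intros)
    from DERIV_chain2[OF pos_part_square_deriv this] show ?thesis by simp
  qed
  have alg: "(A' * (A + B) - A * (A' + - B')) / (D * D) = (A' * B + A * B') / D\<^sup>2" for A A' B B' D :: real
    by (simp add: power2_eq_square algebra_simps)
  have "(max 0 (z - 1))\<^sup>2 + (max 0 (2 - z))\<^sup>2 \<noteq> 0"
    by (rule cutoff_denominator_pos[THEN less_imp_neq, THEN not_sym])
  from DERIV_divide[OF d1 DERIV_add[OF d1 d2] this] show ?thesis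
    unfolding alg cutoff_def[abs_def] cutoff'_def .
qed

lemma continuous_on_cutoff': "continuous_on S cutoff'"
  unfolding cutoff'_def
  using cutoff_denominator_pos[THEN less_imp_neq, THEN not_sym] by (intro continuous_intros) auto

lemma cutoff'_nonneg: "cutoff' z \<ge> 0"
  unfolding cutoff'_def by (intro divide_nonneg_nonneg add_nonneg_nonneg mult_nonneg_nonneg) auto

lemma cutoff_left: "z \<le> 1 \<Longrightarrow> cutoff z = 0" "z \<le> 1 \<Longrightarrow> cutoff' z = 0"
  by (simp_all add: cutoff_def cutoff'_def)

lemma cutoff_right: "z \<ge> 2 \<Longrightarrow> cutoff z = 1" "z \<ge> 2 \<Longrightarrow> cutoff' z = 0"
  by (simp_all add: cutoff_def cutoff'_def)

lemma cutoff_le_1: "cutoff z \<le> 1"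
  unfolding cutoff_def using cutoff_denominator_pos[of z] by (intro divide_le_eq_1[THEN iffD2]) simp

lemma cutoff_nonneg: "cutoff z \<ge> 0"
  by (simp add: cutoff_def)

text \<open>For weights \<open>\<omega>\<close> that vanish on \<open>{..1}\<close> this is the integral of \<open>a (U * s) * \<omega> s\<close> over
  \<open>s \<in> {1..z}\<close> (and 0 for \<open>z \<le> 1\<close>), pulled back to the unit interval. On a fixed interval, joint continuity in both
  parameters is continuity under the integral sign. The base point \<open>1/2\<close> is any point of \<open>{0<..<1}\<close>: it keeps
  the arguments of \<open>a\<close> positive.\<close>

definition layer :: "(real \<Rightarrow> real) \<Rightarrow> (real \<Rightarrow> real) \<Rightarrow> real \<Rightarrow> real \<Rightarrow> real" where
  "layer a \<omega> U z = integral {0..1} (\<lambda>r. (z - 1/2) * (a (U * (1/2 + (z - 1/2) * r)) * \<omega> (1/2 + (z - 1/2) * r)))"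

lemma layer_eq_0:
  fixes \<omega> :: "real \<Rightarrow> real"
  assumes "z \<le> 1" "\<And>s. s \<le> 1 \<Longrightarrow> \<omega> s = 0"
  shows "layer a \<omega> U z = 0"
proof -
  have "\<omega> (1/2 + (z - 1/2) * r) = 0" if "r \<in> {0..1}" for r
  proof (rule assms(2))
    have "(z - 1/2) * r \<le> 1/2 * r" using that assms(1) by (intro mult_right_mono) auto
    then show "1/2 + (z - 1/2) * r \<le> 1" using that by simp
  qed
  then have "layer a \<omega> U z = integral {0..1::real} (\<lambda>r. 0)"
    unfolding layer_def by (intro integral_cong) simp
  then show ?thesis by simp
qed

lemma continuous_on_layer_integrand:
  fixes a \<omega> :: "real \<Rightarrow> real"
  assumes "continuous_on {0<..} a" "continuous_on {0<..} \<omega>" "U > 0" "c > 0"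
  shows "continuous_on {c..d} (\<lambda>s. a (U * s) * \<omega> s)"
proof -
  have "U * s > 0" if "s \<in> {c..d}" for s using that assms(3,4) by auto
  then show ?thesis
    using assms(4) by (intro continuous_intros continuous_on_compose2[OF assms(1)] continuous_on_compose2[OF assms(2)])
       auto
qed

lemma layer_eq_integral:
  fixes a \<omega> :: "real \<Rightarrow> real"
  assumes "continuous_on {0<..} a" "continuous_on {0<..} \<omega>" "U > 0" "z \<ge> 1/2"
  shows "layer a \<omega> U z = integral {1/2..z} (\<lambda>s. a (U * s) * \<omega> s)"
proof -
  have "((\<lambda>r. (z - 1/2) *\<^sub>R (a (U * (1/2 + (z - 1/2) * r)) * \<omega> (1/2 + (z - 1/2) * r))) has_integral
     integral {1/2 + (z - 1/2) * 0..1/2 + (z - 1/2) * 1} (\<lambda>s. a (U * s) * \<omega> s)) {0..1}"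
  proof (rule has_integral_substitution[where c = "1/2" and d = z])
    show "(\<lambda>r. 1/2 + (z - 1/2) * r) ` {0..1} \<subseteq> {1/2..z}"
    proof (rule image_subsetI)
      fix r :: real assume "r \<in> {0..1}"
      then have "0 \<le> (z - 1/2) * r" "(z - 1/2) * r \<le> (z - 1/2) * 1"
        using assms(4) by (auto intro!: mult_left_mono simp del: mult_1_right)
      then show "1/2 + (z - 1/2) * r \<in> {1/2..z}" by simp
    qed
  qed (use assms in \<open>auto intro!: derivative_eq_intros continuous_on_layer_integrand\<close>)
  from integral_unique[OF this] show ?thesis unfolding layer_def by simp
qed

lemma continuous_on_layer:
  fixes a \<omega> :: "real \<Rightarrow> real"
  assumes "continuous_on {0<..} a" "continuous_on {0<..} \<omega>"
  shows "continuous_on ({0<..} \<times> {0<..}) (\<lambda>(U, z). layer a \<omega> U z)"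
proof -
  have pos: "0 < 1/2 + (z - 1/2) * r" if "z > 0" "r \<in> {0..1}" for z r :: real
  proof -
    have "1/2 + (z - 1/2) * r = 1/2 * (1 - r) + z * r" by (simp add: field_simps)
    also have "\<dots> > 0" using that by (cases "r = 0") (auto intro!: add_nonneg_pos)
    finally show ?thesis .
  qed
  have pos': "0 < fst (fst x) * (1/2 + (snd (fst x) - 1/2) * snd x)"
      "0 < 1/2 + (snd (fst x) - 1/2) * snd x"
    if "x \<in> ({0<..} \<times> {0<..}) \<times> {0..1}" for x :: "(real \<times> real) \<times> real"
    using that pos[of "snd (fst x)" "snd x"] by auto
  have "continuous_on ({0<..} \<times> {0<..}) (\<lambda>x. integral (cbox 0 1)
      (\<lambda>r. (snd x - 1/2) * (a (fst x * (1/2 + (snd x - 1/2) * r)) * \<omega> (1/2 + (snd x - 1/2) * r))))"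
    by (rule integral_continuous_on_param, unfold split_beta,
        intro continuous_intros continuous_on_compose2[OF assms(1)] continuous_on_compose2[OF assms(2)])
       (use pos' in auto)
  then show ?thesis by (simp add: layer_def split_beta)
qed

lemma layer_mono:
  fixes a b \<omega> \<psi> :: "real \<Rightarrow> real"
  assumes "continuous_on {0<..} a" "continuous_on {0<..} \<omega>" "\<And>s. s \<le> 1 \<Longrightarrow> \<omega> s = 0"
    and "continuous_on {0<..} b" "continuous_on {0<..} \<psi>" "\<And>s. s \<le> 1 \<Longrightarrow> \<psi> s = 0"
    and "U > 0" "\<And>s. 1 \<le> s \<Longrightarrow> s \<le> z \<Longrightarrow> c * (a (U * s) * \<omega> s) \<le> d * (b (U * s) * \<psi> s)"
  shows "c * layer a \<omega> U z \<le> d * layer b \<psi> U z"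
proof (cases "z \<le> 1")
  case True
  then show ?thesis using assms(3,6) by (simp add: layer_eq_0)
next
  case False
  have "integral {1/2..z} (\<lambda>s. c * (a (U * s) * \<omega> s)) \<le> integral {1/2..z} (\<lambda>s. d * (b (U * s) * \<psi> s))"
  proof (rule integral_le)
    show "c * (a (U * s) * \<omega> s) \<le> d * (b (U * s) * \<psi> s)" if "s \<in> {1/2..z}" for s
      using assms(3,6)[of s] assms(8)[of s] that by (cases "s \<le> 1") auto
  qed (intro integrable_continuous_interval continuous_on_mult_left continuous_on_layer_integrand
        assms; simp)+
  then show ?thesis
    using False assms(1,2,4,5,7) by (simp add: layer_eq_integral)
qed

text \<open>The partial derivative in \<open>z\<close> is the integrand at the endpoint, the one in \<open>U\<close> is found under the
  integral sign and has the same form with \<open>a'\<close> and the weight \<open>s * \<omega> s\<close>. The chain rule is stated along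
  curves because both the time derivative and the space derivatives are taken along lines.\<close>

lemma layer_has_real_derivative:
  fixes a a' \<omega> :: "real \<Rightarrow> real"
  assumes a: "\<And>x. x > 0 \<Longrightarrow> (a has_real_derivative a' x) (at x)" "continuous_on {0<..} a'"
    and \<omega>: "continuous_on {0<..} \<omega>" "\<And>s. s \<le> 1 \<Longrightarrow> \<omega> s = 0"
    and U: "(U has_real_derivative U') (at h)" "U h > 0"
    and z: "(z has_real_derivative z') (at h)" "z h > 0"
  shows "((\<lambda>h. layer a \<omega> (U h) (z h)) has_real_derivative
      U' * layer a' (\<lambda>s. s * \<omega> s) (U h) (z h) + z' * (a (U h * z h) * \<omega> (z h))) (at h)"
proof -
  let ?P = "{0<..} :: real set"
  have conta: "continuous_on ?P a" using a(1) by (intro DERIV_continuous_on) (auto intro: DERIV_subset)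
  have in_z: "((\<lambda>y. layer a \<omega> x y) has_real_derivative a (x * y) * \<omega> y) (at y)" if "x > 0" "y > 0" for x y
  proof (cases "y < 1")
    case True
    have "((\<lambda>y. 0) has_real_derivative a (x * y) * \<omega> y) (at y)" using True \<omega>(2) by simp
    then show ?thesis
      by (rule has_field_derivative_transform_within_open[of _ _ _ "{..<1}"])
         (use True \<omega>(2) in \<open>auto simp: layer_eq_0\<close>)
  next
    case False
    have "((\<lambda>t. integral {1/2..t} (\<lambda>s. a (x * s) * \<omega> s)) has_real_derivative a (x * y) * \<omega> y)
        (at y within {1/2..y + 1})"
      by (rule integral_has_real_derivative)
         (use False conta \<omega>(1) that in \<open>auto intro!: continuous_on_layer_integrand\<close>)
    then have "((\<lambda>t. integral {1/2..t} (\<lambda>s. a (x * s) * \<omega> s)) has_real_derivative a (x * y) * \<omega> y) (at y)"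
      using False by (simp add: at_within_Icc_at)
    then show ?thesis
      by (rule has_field_derivative_transform_within_open[of _ _ _ "{1/2<..}"])
         (use False conta \<omega>(1) that in \<open>auto simp: layer_eq_integral\<close>)
  qed
  have in_U: "((\<lambda>x. layer a \<omega> x y) has_real_derivative layer a' (\<lambda>s. s * \<omega> s) x y) (at x within ?P)"
    if "x > 0" "y > 0" for x y
  proof (cases "y \<le> 1")
    case True
    then show ?thesis using \<omega>(2) by (simp add: layer_eq_0)
  next
    case False
    have c: "continuous_on ?P (\<lambda>s. s * \<omega> s)" by (intro continuous_intros \<omega>)
    have "((\<lambda>x. integral (cbox (1/2) y) (\<lambda>s. a (x * s) * \<omega> s)) has_real_derivative
        integral (cbox (1/2) y) (\<lambda>s. a' (x * s) * (s * \<omega> s))) (at x within ?P)"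
    proof (rule leibniz_rule_field_derivative)
      show "((\<lambda>x. a (x * s) * \<omega> s) has_real_derivative a' (x * s) * (s * \<omega> s)) (at x within ?P)"
        if "x \<in> ?P" "s \<in> cbox (1/2) y" for x s
      proof -
        have "(a has_real_derivative a' (x * s)) (at (x * s))" using that by (intro a) auto
        moreover have "((\<lambda>x. x * s) has_real_derivative s) (at x within ?P)"
          by (auto intro!: derivative_eq_intros)
        ultimately have "((\<lambda>x. a (x * s)) has_real_derivative a' (x * s) * s) (at x within ?P)"
          by (rule DERIV_chain2)
        then show ?thesis by (auto intro!: derivative_eq_intros)
      qed
      show "(\<lambda>s. a (x * s) * \<omega> s) integrable_on cbox (1/2) y" if "x \<in> ?P" for x
        using that conta \<omega> by (auto intro!: integrable_continuous_interval continuous_on_layer_integrand)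
      show "continuous_on (?P \<times> cbox (1/2) y) (\<lambda>(x, s). a' (x * s) * (s * \<omega> s))"
        unfolding split_beta
        by (intro continuous_intros continuous_on_compose2[OF a(2)] continuous_on_compose2[OF \<omega>(1)]) auto
    qed (use that in auto)
    then have "((\<lambda>x. integral {1/2..y} (\<lambda>s. a (x * s) * \<omega> s)) has_real_derivative
        layer a' (\<lambda>s. s * \<omega> s) x y) (at x within ?P)"
      using False that a(2) c by (simp add: layer_eq_integral)
    then show ?thesis
      by (rule has_field_derivative_transform_within[of _ _ _ _ 1])
         (use False that conta \<omega>(1) in \<open>auto simp: layer_eq_integral\<close>)
  qed
  have "((\<lambda>(x, y). layer a \<omega> x y) has_derivative
      (\<lambda>(tx, ty). layer a' (\<lambda>s. s * \<omega> s) (U h) (z h) * tx + blinfun_mult_right (a (U h * z h) * \<omega> (z h)) ty))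
      (at (U h, z h) within ?P \<times> ?P)"
  proof (rule has_derivative_partialsI[where fy = "\<lambda>x y. blinfun_mult_right (a (x * y) * \<omega> y)"])
    show "((\<lambda>x. layer a \<omega> x (z h)) has_derivative (*) (layer a' (\<lambda>s. s * \<omega> s) (U h) (z h))) (at (U h) within ?P)"
      using in_U[OF U(2) z(2)] by (simp add: has_field_derivative_def)
    show "((\<lambda>y. layer a \<omega> x y) has_derivative blinfun_mult_right (a (x * y) * \<omega> y)) (at y within ?P)"
      if "x \<in> ?P" "y \<in> ?P" for x y
      using in_z[of x y] that DERIV_subset[of _ _ y UNIV]
      by (simp add: has_field_derivative_def has_derivative_at_withinI)
    have "continuous_on (?P \<times> ?P) (\<lambda>(x, y). blinfun_mult_right (a (x * y) * \<omega> y))"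
      unfolding split_beta
      by (intro bounded_linear.continuous_on[OF bounded_linear_blinfun_mult_right] continuous_intros
            continuous_on_compose2[OF conta] continuous_on_compose2[OF \<omega>(1)]) auto
    then show "continuous (at (U h, z h) within ?P \<times> ?P) (\<lambda>(x, y). blinfun_mult_right (a (x * y) * \<omega> y))"
      using U(2) z(2) by (simp add: continuous_on_eq_continuous_within)
  qed (use z in auto)
  moreover have "at (U h, z h) within ?P \<times> ?P = at (U h, z h)"
    using U(2) z(2) by (intro at_within_open open_Times) auto
  ultimately have D: "((\<lambda>(x, y). layer a \<omega> x y) has_derivative
      (\<lambda>(tx, ty). layer a' (\<lambda>s. s * \<omega> s) (U h) (z h) * tx + a (U h * z h) * \<omega> (z h) * ty)) (at (U h, z h))"
    by simp
  have "((\<lambda>h. (U h, z h)) has_derivative (\<lambda>t. (U' * t, z' * t))) (at h)"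
    using U(1) z(1) by (intro has_derivative_Pair) (simp_all add: has_field_derivative_def)
  from has_derivative_compose[OF this D, unfolded prod.case]
  show ?thesis
    unfolding has_field_derivative_def prod.case
    by (rule has_derivative_eq_rhs) (auto simp: algebra_simps)
qed

section \<open>Powers capped to linear growth\<close>

text \<open>This is \<open>s powr p\<close> with \<open>p - 1\<close> of the factors \<open>s\<close> replaced by half the harmonic mean of \<open>k\<close> and \<open>s\<close>. It
  increases to \<open>s powr p\<close> as \<open>k\<close> grows and is Lipschitz for fixed \<open>k\<close>.\<close>

definition capped_power :: "real \<Rightarrow> real \<Rightarrow> real \<Rightarrow> real" where
  "capped_power p k s = s * (k * s / (k + s)) powr (p - 1)"

definition capped_power' :: "real \<Rightarrow> real \<Rightarrow> real \<Rightarrow> real" where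
  "capped_power' p k s = (k * s / (k + s)) powr (p - 1) * (1 + (p - 1) * (k / (k + s)))"

definition capped_power'' :: "real \<Rightarrow> real \<Rightarrow> real \<Rightarrow> real" where
  "capped_power'' p k s = (k * s / (k + s)) powr (p - 1) * (p * (p - 1) * (k / (k + s))\<^sup>2 / s)"

lemma capped_quotient_deriv:
  assumes "k > 0" "s > (0::real)"
  shows "((\<lambda>s. (k * s / (k + s)) powr r) has_real_derivative
           (k * s / (k + s)) powr r * (r * (k / (k + s)) / s)) (at s)"
proof -
  have ks: "k + s \<noteq> 0" and pos: "k * s / (k + s) > 0" using assms by auto
  have "((\<lambda>s. k * s / (k + s)) has_real_derivative (k / (k + s))\<^sup>2) (at s)"
    using ks by (auto intro!: derivative_eq_intros simp: field_simps power2_eq_square)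
  from DERIV_fun_powr[OF this pos, of r]
  have "((\<lambda>s. (k * s / (k + s)) powr r) has_real_derivative
      r * (k * s / (k + s)) powr (r - 1) * (k / (k + s))\<^sup>2) (at s)" by simp
  moreover have "(k * s / (k + s)) powr (r - 1) = (k * s / (k + s)) powr r * ((k + s) / (k * s))"
  proof -
    have "x powr (r - 1) = x powr r * (1 / x)" if "x > 0" for x :: real
      using that by (simp add: powr_diff)
    from this[OF pos] show ?thesis by simp
  qed
  moreover have "r * (G * (t / (k * s))) * (k / t)\<^sup>2 = G * (r * (k / t) / s)" if "t \<noteq> 0" for G t
    using that assms by (simp add: field_simps power2_eq_square)
  ultimately show ?thesis using ks by metis
qed

lemma capped_power_deriv:
  assumes "k > 0" "s > 0"
  shows "(capped_power p k has_real_derivative capped_power' p k s) (at s)"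
proof -
  have "1 * G + G * ((p - 1) * C / s) * s = G * (1 + (p - 1) * C)" for G C
    using assms by (simp add: field_simps)
  then have "((\<lambda>s. s * (k * s / (k + s)) powr (p - 1)) has_real_derivative capped_power' p k s) (at s)"
    unfolding capped_power'_def
    by (intro DERIV_cong[OF DERIV_mult[OF DERIV_ident capped_quotient_deriv[OF assms]]])
  then show ?thesis by (simp add: capped_power_def[abs_def])
qed

lemma capped_power'_deriv:
  assumes "k > 0" "s > 0"
  shows "(capped_power' p k has_real_derivative capped_power'' p k s) (at s)"
proof -
  have ks: "k + s \<noteq> 0" using assms by auto
  have d: "((\<lambda>s. 1 + (p - 1) * (k / (k + s))) has_real_derivative - (p - 1) * (k / (k + s)\<^sup>2)) (at s)"
    using ks by (auto intro!: derivative_eq_intros simp: field_simps power2_eq_square)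
  have e: "s / (k + s) = 1 - k / (k + s)" using ks by (simp add: field_simps)
  have "((\<lambda>s. (k * s / (k + s)) powr (p - 1) * (1 + (p - 1) * (k / (k + s)))) has_real_derivative capped_power'' p k s) (at s)"
  proof (rule DERIV_cong[OF DERIV_mult[OF capped_quotient_deriv[OF assms] d]])
    define c where "c = k / (k + s)"
    have "k / (k + s)\<^sup>2 = c * (1 - c) / s"
      unfolding c_def e[symmetric] using assms by (simp add: power2_eq_square)
    moreover have "G * ((p - 1) * c / s) * (1 + (p - 1) * c) + - (p - 1) * (c * (1 - c) / s) * G
        = G * (p * (p - 1) * c\<^sup>2 / s)" for G
      using assms by (simp add: field_simps power2_eq_square)
    ultimately show "(k * s / (k + s)) powr (p - 1) * ((p - 1) * (k / (k + s)) / s) * (1 + (p - 1) * (k / (k + s))) +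
          - (p - 1) * (k / (k + s)\<^sup>2) * (k * s / (k + s)) powr (p - 1) = capped_power'' p k s"
      unfolding capped_power''_def c_def[symmetric] by metis
  qed
  then show ?thesis by (simp add: capped_power'_def[abs_def])
qed

lemma continuous_on_capped_power'':
  assumes "k > 0" shows "continuous_on {0<..} (capped_power'' p k)"
  unfolding capped_power''_def by (intro continuous_intros) (use assms in auto)

text \<open>The bounds on the second derivative say that the first derivative is nondecreasing, but grows no faster
  than \<open>s powr (p - 1)\<close> in the logarithmic sense. These are the two properties of a power that the
  dissipation estimate uses.\<close>

lemma capped_power_bounds:
  assumes "k > 0" "s > 0" "p \<ge> 1"
  shows "0 \<le> capped_power p k s" "0 \<le> capped_power' p k s" "0 \<le> capped_power'' p k s"
    and "s * capped_power'' p k s \<le> (p - 1) * capped_power' p k s"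
    and "capped_power' p k s \<le> p * k powr (p - 1)"
    and "capped_power p k s \<le> s powr p" "capped_power p k s \<le> s * k powr (p - 1)"
proof -
  define c where "c = k / (k + s)"
  define g where "g = (k * s / (k + s)) powr (p - 1)"
  have c: "0 < c" "c < 1" and g: "g \<ge> 0" using assms by (auto simp: c_def g_def)
  have gk: "g \<le> k powr (p - 1)" "g \<le> s powr (p - 1)"
    unfolding g_def using assms by (auto intro!: powr_mono2 simp: field_simps)
  have e: "capped_power p k s = s * g" "capped_power' p k s = g * (1 + (p - 1) * c)"
    "capped_power'' p k s = g * (p * (p - 1) * c\<^sup>2 / s)"
    by (simp_all add: capped_power_def capped_power'_def capped_power''_def c_def g_def)
  have c1: "(p - 1) * c \<le> p - 1" using c assms by (simp add: mult_left_le)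
  show "0 \<le> capped_power p k s" "0 \<le> capped_power' p k s" "0 \<le> capped_power'' p k s"
    unfolding e using assms c g by auto
  have "c * c \<le> c" using c by (simp add: mult_left_le)
  then have "p * c\<^sup>2 \<le> p * c" using assms by (simp add: power2_eq_square)
  also have "\<dots> \<le> 1 + (p - 1) * c" using c by (simp add: algebra_simps)
  finally have "g * (p - 1) * (p * c\<^sup>2) \<le> g * (p - 1) * (1 + (p - 1) * c)"
    using g assms by (intro mult_left_mono) auto
  then show "s * capped_power'' p k s \<le> (p - 1) * capped_power' p k s"
    unfolding e using assms by (simp add: mult_ac)
  have "g * (1 + (p - 1) * c) \<le> k powr (p - 1) * p"
    using gk(1) c1 g c assms by (intro mult_mono) auto
  then show "capped_power' p k s \<le> p * k powr (p - 1)" unfolding e by (simp add: mult_ac)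
  have "s * g \<le> s * s powr (p - 1)" using gk assms by (intro mult_left_mono) auto
  also have "\<dots> = s powr p" using assms by (simp add: powr_diff)
  finally show "capped_power p k s \<le> s powr p" unfolding e .
  show "capped_power p k s \<le> s * k powr (p - 1)"
    unfolding e using gk assms by (intro mult_left_mono) auto
qed

lemma capped_power_mono:
  assumes "k > 0" "p \<ge> 1" "0 < s" "s \<le> t"
  shows "capped_power p k s \<le> capped_power p k t"
  by (rule DERIV_nonneg_imp_nondecreasing[OF assms(4)])
     (use assms capped_power_deriv capped_power_bounds(2) in \<open>meson less_le_trans\<close>)

lemma capped_power_lipschitz:
  assumes "k > 0" "p \<ge> 1" "0 \<le> a" "0 \<le> b"
  shows "capped_power p k a \<le> capped_power p k b + p * k powr (p - 1) * \<bar>a - b\<bar>"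
proof (cases "a = 0 \<or> a \<le> b")
  case True
  have "capped_power p k a \<le> capped_power p k b"
  proof (cases "a = 0")
    case True
    then show ?thesis using assms capped_power_bounds(1)[of k b p] by (cases "b = 0") (auto simp: capped_power_def)
  qed (use True assms capped_power_mono in auto)
  moreover have "p * k powr (p - 1) * \<bar>a - b\<bar> \<ge> 0" using assms by auto
  ultimately show ?thesis by linarith
next
  case False
  show ?thesis
  proof (cases "b = 0")
    case True
    have "a * k powr (p - 1) \<le> p * k powr (p - 1) * a"
      using assms mult_right_mono[of 1 p "k powr (p - 1) * a"] by (simp add: mult_ac)
    moreover have "capped_power p k a \<le> a * k powr (p - 1)"
      using False assms by (intro capped_power_bounds) auto
    moreover have "capped_power p k b = 0" "\<bar>a - b\<bar> = a"
      using True assms by (auto simp: capped_power_def)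
    ultimately show ?thesis by simp
  next
    case b: False
    then have "b < a" "0 < b" using False assms by auto
    obtain z where z: "b < z" "z < a" "capped_power p k a - capped_power p k b = (a - b) * capped_power' p k z"
      using MVT2[of b a "capped_power p k" "capped_power' p k"] capped_power_deriv[OF assms(1)] \<open>0 < b\<close> \<open>b < a\<close>
      by (meson less_le_trans)
    have "(a - b) * capped_power' p k z \<le> (a - b) * (p * k powr (p - 1))"
      using capped_power_bounds(5)[of k z p] assms z \<open>0 < b\<close> by (intro mult_left_mono) auto
    moreover have "p * k powr (p - 1) * \<bar>a - b\<bar> = (a - b) * (p * k powr (p - 1))"
      using \<open>b < a\<close> by simp
    ultimately show ?thesis using z(3) by linarith
  qed
qed

lemma capped_power_tendsto:
  assumes "s \<ge> 0" "p \<ge> 1"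
  shows "(\<lambda>n. capped_power p (real (Suc n)) s) \<longlonglongrightarrow> s powr p"
proof (cases "s = 0")
  case False
  have "(\<lambda>n. s / (1 + s * inverse (real (Suc n)))) \<longlonglongrightarrow> s / (1 + s * 0)"
    by (intro tendsto_intros LIMSEQ_inverse_real_of_nat) auto
  moreover have "s / (1 + s * inverse (real (Suc n))) = real (Suc n) * s / (real (Suc n) + s)" for n
    using assms(1) by (simp add: field_simps)
  ultimately have "(\<lambda>n. real (Suc n) * s / (real (Suc n) + s)) \<longlonglongrightarrow> s" by simp
  then have "(\<lambda>n. capped_power p (real (Suc n)) s) \<longlonglongrightarrow> s * s powr (p - 1)"
    unfolding capped_power_def by (intro tendsto_intros) (use False in auto)
  then show ?thesis using False assms by (simp add: powr_diff)
qed (simp add: capped_power_def)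

section \<open>The dissipation estimate\<close>

text \<open>The pointwise inequality behind the monotonicity of the energy. Here \<open>u\<close> is the solution and \<open>U\<close> the barrier,
  \<open>z = u/U\<close>, the index \<open>b\<close> runs through the coordinate directions, \<open>ub\<close>, \<open>ubb\<close> and \<open>zb\<close> are derivatives of \<open>u\<close> and
  \<open>z\<close>, and \<open>P\<close>, \<open>Lbb\<close> are the first and second derivatives of \<open>log U\<close>. The left-hand side is \<open>\<partial>\<^sub>t J\<close>. The right-hand
  side is the divergence of \<open>f(u) \<eta>(z) u\<^bsup>m-1\<^esup> \<nabla>u - M U\<^sup>m \<nabla> log U\<close>, where \<open>M\<close> (with value \<open>Mh\<close>) is the integral of
  \<open>f(U s) s\<^sup>m \<eta>'(s)\<close> over \<open>s \<le> z\<close>. The second field is chosen so that its divergence contains the indefinite term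
  \<open>f(u) \<eta>'(z) u\<^sup>m \<nabla>z \<bullet> \<nabla> log U\<close> that is left over once the squares have been discarded.\<close>

lemma flux_dissipation:
  fixes m p :: real and B :: "'b set"
  assumes "u > 0" "U > 0" and zu: "u = U * z"
    and pos: "fv \<ge> 0" "f'v \<ge> 0" "\<eta>v \<ge> 0" "\<eta>'v \<ge> 0" "Mh \<ge> 0" "Mh \<le> A"
    and MU: "U * MU \<le> (p - 1) * Mh"
    and zb: "\<And>b. b \<in> B \<Longrightarrow> ub b = U * zb b + u * P b"
    and S: "(\<Sum>b\<in>B. (p - 1 + m) * (P b)\<^sup>2 + Lbb b) \<ge> 0"
      "U powr m * (\<Sum>b\<in>B. (p - 1 + m) * (P b)\<^sup>2 + Lbb b) \<le> Ut"
  shows "fv * \<eta>v * (\<Sum>b\<in>B. u powr (m - 1) * ubb b + (m - 1) * u powr (m - 2) * (ub b)\<^sup>2) - Ut * A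
     \<le> (\<Sum>b\<in>B. (f'v * ub b * \<eta>v + fv * (\<eta>'v * zb b)) * (u powr (m - 1) * ub b)
        + fv * \<eta>v * ((m - 1) * u powr (m - 2) * (ub b)\<^sup>2 + u powr (m - 1) * ubb b)
        - ((U * P b * MU + zb b * (fv * (z powr m * \<eta>'v))) * (U powr m * P b)
           + Mh * (m * U powr m * (P b)\<^sup>2 + U powr m * Lbb b)))"
proof -
  have z: "z > 0" using assms(1,2) zu by (simp add: zero_less_mult_iff)
  have um: "u powr m = U powr m * z powr m" using assms(2) z by (simp add: zu powr_mult)
  have u1: "u powr m = u powr (m - 1) * u" using assms(1) by (simp add: powr_diff)
  have summand: "(f'v * ub b * \<eta>v + fv * (\<eta>'v * zb b)) * (u powr (m - 1) * ub b)
      - ((U * P b * MU + zb b * (fv * (z powr m * \<eta>'v))) * (U powr m * P b)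
           + Mh * (m * U powr m * (P b)\<^sup>2 + U powr m * Lbb b))
      \<ge> - (Mh * U powr m * ((p - 1 + m) * (P b)\<^sup>2 + Lbb b))" if b: "b \<in> B" for b
  proof -
    \<comment> \<open>The two discarded squares, the bound for the derivative of \<open>M\<close>, and the identity in which the indefinite
      terms cancel.\<close>
    have 1: "0 \<le> f'v * \<eta>v * u powr (m - 1) * (ub b)\<^sup>2" using pos by auto
    have 2: "0 \<le> fv * \<eta>'v * u powr (m - 1) * U * (zb b)\<^sup>2" using pos assms(2) by auto
    have 3: "U powr m * (P b)\<^sup>2 * (U * MU) \<le> U powr m * (P b)\<^sup>2 * ((p - 1) * Mh)"
      by (rule mult_left_mono[OF MU]) auto
    have "fv * (\<eta>'v * zb b) * (u powr (m - 1) * ub b) - zb b * (fv * (z powr m * \<eta>'v)) * (U powr m * P b)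
      = fv * \<eta>'v * zb b * (u powr (m - 1) * ub b - u powr m * P b)"
      unfolding um by (simp add: algebra_simps)
    also have "\<dots> = fv * \<eta>'v * u powr (m - 1) * U * (zb b)\<^sup>2"
      unfolding u1 zb[OF b] by (simp add: algebra_simps power2_eq_square)
    finally have 4: "fv * (\<eta>'v * zb b) * (u powr (m - 1) * ub b) - zb b * (fv * (z powr m * \<eta>'v)) * (U powr m * P b)
      = fv * \<eta>'v * u powr (m - 1) * U * (zb b)\<^sup>2" .
    show ?thesis using 1 2 3 4 by (simp add: algebra_simps power2_eq_square)
  qed
  have "Mh * (U powr m * (\<Sum>b\<in>B. (p - 1 + m) * (P b)\<^sup>2 + Lbb b)) \<le> A * Ut"
    using pos S by (intro mult_mono) auto
  also have "Mh * (U powr m * (\<Sum>b\<in>B. (p - 1 + m) * (P b)\<^sup>2 + Lbb b))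
     = (\<Sum>b\<in>B. Mh * U powr m * ((p - 1 + m) * (P b)\<^sup>2 + Lbb b))"
    by (simp add: sum_distrib_left mult.assoc)
  finally have "- (Ut * A) \<le> (\<Sum>b\<in>B. - (Mh * U powr m * ((p - 1 + m) * (P b)\<^sup>2 + Lbb b)))"
    by (simp add: sum_negf mult.commute)
  also have "\<dots> \<le> (\<Sum>b\<in>B. (f'v * ub b * \<eta>v + fv * (\<eta>'v * zb b)) * (u powr (m - 1) * ub b)
      - ((U * P b * MU + zb b * (fv * (z powr m * \<eta>'v))) * (U powr m * P b)
           + Mh * (m * U powr m * (P b)\<^sup>2 + U powr m * Lbb b)))"
    by (rule sum_mono) (rule summand)
  finally show ?thesis
    by (simp add: sum_subtractf sum.distrib sum_distrib_left[symmetric] algebra_simps)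
qed

section \<open>Truncated energies\<close>

lemma layer_const_cutoff':
  assumes "U > 0" "z > 0"
  shows "layer (\<lambda>_. C) cutoff' U z = C * cutoff z"
proof (cases "z \<le> 1")
  case False
  have "(cutoff' has_integral cutoff z - cutoff (1/2)) {1/2..z}"
    by (rule fundamental_theorem_of_calculus)
       (use False cutoff_deriv in \<open>auto simp: has_real_derivative_iff_has_vector_derivative[symmetric] intro: DERIV_subset\<close>)
  then show ?thesis
    using False assms by (simp add: layer_eq_integral continuous_on_cutoff' cutoff_left integral_unique)
qed (simp add: layer_eq_0 cutoff_left)

text \<open>Integration by parts in \<open>v\<close> turns \<open>\<integral> E'(v) \<eta>(v/U) dv\<close> into this expression. In this form the
  terms with \<open>\<eta>'(u/U)\<close> cancel when it is differentiated.\<close>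

definition truncated_energy :: "(real \<Rightarrow> real) \<Rightarrow> real \<Rightarrow> real \<Rightarrow> real" where
  "truncated_energy E U v = E v * cutoff (v / U) - layer E cutoff' U (v / U)"

lemma truncated_energy_bounds:
  assumes "U > 0" "v > 0" "k > 0" "p \<ge> 1"
  defines "E \<equiv> capped_power p k"
  shows "0 \<le> truncated_energy E U v" "truncated_energy E U v \<le> E v"
    and "E v \<le> truncated_energy E U v + E (2 * U)"
proof -
  let ?z = "v / U"
  have z: "?z > 0" "U * ?z = v" using assms by auto
  have mono: "E s \<le> E t" if "0 < s" "s \<le> t" for s t
    using capped_power_mono that assms(3,4) by (simp add: E_def)
  have nonneg: "E s \<ge> 0" if "s > 0" for s
    using capped_power_bounds(1) that assms(3,4) by (simp add: E_def)
  have cont: "continuous_on {0<..} E"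
    unfolding E_def by (rule DERIV_continuous_on) (use assms in \<open>auto intro!: DERIV_subset[OF capped_power_deriv]\<close>)
  note lm = layer_mono[OF cont continuous_on_cutoff' cutoff_left(2) continuous_on_const continuous_on_cutoff' cutoff_left(2) assms(1)]
  have "1 * layer E cutoff' U ?z \<le> 1 * layer (\<lambda>_. E v) cutoff' U ?z"
  proof (rule lm)
    fix s assume s: "1 \<le> s" "s \<le> ?z"
    then have "U * s \<le> U * ?z" using assms(1) by (intro mult_left_mono) auto
    then have "E (U * s) \<le> E v" using s assms(1) by (intro mono) auto
    then show "1 * (E (U * s) * cutoff' s) \<le> 1 * (E v * cutoff' s)"
      using cutoff'_nonneg by (simp add: mult_right_mono)
  qed
  then show 0: "0 \<le> truncated_energy E U v"
    using z assms(1) by (simp add: truncated_energy_def layer_const_cutoff')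
  have "0 * layer E cutoff' U ?z \<le> 1 * layer E cutoff' U ?z"
    by (rule layer_mono) (use assms(1) cont cutoff_left(2) continuous_on_cutoff' cutoff'_nonneg nonneg in auto)
  moreover have "E v * cutoff ?z \<le> E v" using cutoff_le_1 nonneg assms by (simp add: mult_left_le)
  ultimately show "truncated_energy E U v \<le> E v" by (simp add: truncated_energy_def)
  show "E v \<le> truncated_energy E U v + E (2 * U)"
  proof (cases "?z \<le> 2")
    case True
    then have "E v \<le> E (2 * U)" using assms by (intro mono) (auto simp: field_simps)
    then show ?thesis using 0 by simp
  next
    case False
    have "1 * layer E cutoff' U ?z \<le> 1 * layer (\<lambda>_. E (2 * U)) cutoff' U ?z"
    proof (rule lm)
      fix s assume s: "1 \<le> s" "s \<le> ?z"
      show "1 * (E (U * s) * cutoff' s) \<le> 1 * (E (2 * U) * cutoff' s)"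
      proof (cases "s \<le> 2")
        case True
        then have "E (U * s) \<le> E (2 * U)" using s assms(1) by (intro mono) auto
        then show ?thesis using cutoff'_nonneg by (simp add: mult_right_mono)
      qed (simp add: cutoff_right)
    qed
    then show ?thesis
      using False z assms(1) by (simp add: truncated_energy_def layer_const_cutoff' cutoff_right)
  qed
qed

section \<open>The barrier\<close>

text \<open>Its power \<open>1 - m\<close> is \<open>\<kappa> R\<^sup>2 \<theta> / (R\<^sup>2 - dist x x0 ^ 2)\<^sup>2\<close>: linear in time, with the inverse square of the
  distance to the sphere as singularity, which is the natural scaling of the equation.\<close>

definition barrier :: "real \<Rightarrow> real \<Rightarrow> 'a::euclidean_space \<Rightarrow> real \<Rightarrow> real \<Rightarrow> 'a \<Rightarrow> real" where
  "barrier m \<kappa> x0 R \<theta> x = (\<kappa> * R\<^sup>2 * \<theta>) powr (1 / (1 - m)) * (R\<^sup>2 - (x - x0) \<bullet> (x - x0)) powr (- 2 / (1 - m))"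

lemma barrier_pos:
  assumes "\<kappa> > 0" "R > 0" "\<theta> > 0" "R\<^sup>2 - (x - x0) \<bullet> (x - x0) > 0"
  shows "barrier m \<kappa> x0 R \<theta> x > 0"
  using assms by (simp add: barrier_def)

lemma barrier_deriv_time:
  assumes "\<kappa> > 0" "R > 0" "\<theta> > 0" "m < 1"
  shows "((\<lambda>\<theta>. barrier m \<kappa> x0 R \<theta> x) has_real_derivative 1 / (1 - m) / \<theta> * barrier m \<kappa> x0 R \<theta> x) (at \<theta>)"
proof -
  let ?s = "1 / (1 - m)"
  have pos: "\<kappa> * R\<^sup>2 * \<theta> > 0" using assms by simp
  have "((\<lambda>\<theta>. \<kappa> * R\<^sup>2 * \<theta>) has_real_derivative \<kappa> * R\<^sup>2) (at \<theta>)"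
    by (auto intro!: derivative_eq_intros)
  from DERIV_fun_powr[OF this pos, of ?s]
  have "((\<lambda>\<theta>. (\<kappa> * R\<^sup>2 * \<theta>) powr ?s) has_real_derivative ?s * (\<kappa> * R\<^sup>2 * \<theta>) powr (?s - 1) * (\<kappa> * R\<^sup>2)) (at \<theta>)"
    by simp
  moreover have "?s * (\<kappa> * R\<^sup>2 * \<theta>) powr (?s - 1) * (\<kappa> * R\<^sup>2) = ?s / \<theta> * (\<kappa> * R\<^sup>2 * \<theta>) powr ?s"
    using pos assms by (simp add: powr_diff)
  ultimately have "((\<lambda>\<theta>. (\<kappa> * R\<^sup>2 * \<theta>) powr ?s) has_real_derivative ?s / \<theta> * (\<kappa> * R\<^sup>2 * \<theta>) powr ?s) (at \<theta>)"
    by simp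
  from DERIV_cmult_right[OF this] show ?thesis
    unfolding barrier_def by (rule DERIV_cong) simp
qed

lemma paraboloid_deriv_line:
  "((\<lambda>h. R\<^sup>2 - (x + h *\<^sub>R b - x0) \<bullet> (x + h *\<^sub>R b - x0)) has_real_derivative - 2 * ((x - x0) \<bullet> b)) (at 0)"
proof -
  have eq: "R\<^sup>2 - (x + h *\<^sub>R b - x0) \<bullet> (x + h *\<^sub>R b - x0)
      = R\<^sup>2 - (x - x0) \<bullet> (x - x0) - 2 * h * ((x - x0) \<bullet> b) - h\<^sup>2 * (b \<bullet> b)" for h
    by (simp add: inner_diff_left inner_diff_right inner_add_left inner_add_right inner_commute
        power2_eq_square algebra_simps)
  show ?thesis unfolding eq by (auto intro!: derivative_eq_intros)
qed

lemma barrier_deriv_line: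
  fixes x x0 b :: "'a::euclidean_space"
  assumes "R\<^sup>2 - (x - x0) \<bullet> (x - x0) > 0" "m < 1"
  shows "((\<lambda>h. barrier m \<kappa> x0 R \<theta> (x + h *\<^sub>R b)) has_real_derivative
     barrier m \<kappa> x0 R \<theta> x * (4 / (1 - m) * ((x - x0) \<bullet> b) / (R\<^sup>2 - (x - x0) \<bullet> (x - x0)))) (at 0)"
proof -
  let ?s = "- 2 / (1 - m)"
  let ?e = "R\<^sup>2 - (x - x0) \<bullet> (x - x0)"
  have "((\<lambda>h. (R\<^sup>2 - (x + h *\<^sub>R b - x0) \<bullet> (x + h *\<^sub>R b - x0)) powr ?s) has_real_derivative
     ?s * ?e powr (?s - 1) * (- 2 * ((x - x0) \<bullet> b))) (at 0)"
    using DERIV_fun_powr[OF paraboloid_deriv_line, of R x b x0 ?s] assms(1) by simp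
  moreover have "?s * ?e powr (?s - 1) * (- 2 * ((x - x0) \<bullet> b)) = ?e powr ?s * (4 / (1 - m) * ((x - x0) \<bullet> b) / ?e)"
  proof -
    have "v powr (?s - 1) = v powr ?s / v" if "v > 0" for v using that by (simp add: powr_diff)
    from this[OF assms(1)] show ?thesis using assms(2) by (simp add: field_simps)
  qed
  ultimately have "((\<lambda>h. (R\<^sup>2 - (x + h *\<^sub>R b - x0) \<bullet> (x + h *\<^sub>R b - x0)) powr ?s) has_real_derivative
     ?e powr ?s * (4 / (1 - m) * ((x - x0) \<bullet> b) / ?e)) (at 0)" by (rule DERIV_cong)
  from DERIV_cmult[OF this] show ?thesis
    unfolding barrier_def by (rule DERIV_cong) simp
qed

lemma barrier_log_deriv_line:
  fixes x x0 b :: "'a::euclidean_space"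
  assumes "R\<^sup>2 - (x - x0) \<bullet> (x - x0) > 0" "b \<in> Basis"
  shows "((\<lambda>h. c * ((x + h *\<^sub>R b - x0) \<bullet> b) / (R\<^sup>2 - (x + h *\<^sub>R b - x0) \<bullet> (x + h *\<^sub>R b - x0))) has_real_derivative
     c / (R\<^sup>2 - (x - x0) \<bullet> (x - x0)) + 2 * c * ((x - x0) \<bullet> b)\<^sup>2 / (R\<^sup>2 - (x - x0) \<bullet> (x - x0))\<^sup>2) (at 0)"
proof -
  let ?e = "R\<^sup>2 - (x - x0) \<bullet> (x - x0)"
  have n: "((\<lambda>h. c * ((x + h *\<^sub>R b - x0) \<bullet> b)) has_real_derivative c) (at 0)"
    using assms(2) by (auto intro!: derivative_eq_intros simp: inner_add_left inner_diff_left)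
  have "R\<^sup>2 - (x + 0 *\<^sub>R b - x0) \<bullet> (x + 0 *\<^sub>R b - x0) \<noteq> 0" using assms(1) by simp
  note d = DERIV_divide[OF n paraboloid_deriv_line this]
  have alg: "(c * E - c * Y * (- 2 * Y)) / (E * E) = c / E + 2 * c * Y\<^sup>2 / E\<^sup>2" if "E \<noteq> 0" for E Y :: real
    using that by (simp add: field_simps power2_eq_square)
  have "x + 0 *\<^sub>R b = x" by simp
  from d[unfolded this] show ?thesis
    by (rule DERIV_cong) (rule alg, use assms(1) in simp)
qed

text \<open>Since \<open>U powr (m - 1) = e\<^sup>2 / (\<kappa> R\<^sup>2 \<theta>)\<close>, the claim amounts to \<open>e\<^sup>2 S \<le> \<kappa> R\<^sup>2 / (1 - m)\<close>. The three summands of \<open>\<kappa>\<close>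
  are the contributions of the \<open>DIM('a)\<close> terms \<open>1/e\<close> in the Laplacian, of its terms \<open>1/e\<^sup>2\<close>, and of the squared
  gradient, whose factor \<open>p - 1 + m\<close> equals \<open>(1 - m) (p / (1 - m) - 1)\<close>. The exponent \<open>p\<close> enters \<open>\<kappa>\<close> linearly, and this
  is where the linear dependence of the final constant on \<open>p\<close> comes from.\<close>

lemma barrier_supersolution:
  fixes x x0 :: "'a::euclidean_space"
  assumes "m < 1" "1 - m < p" "\<theta> > 0" "R > 0"
  defines "\<kappa> \<equiv> 4 * real DIM('a) + 8 + 16 * (p / (1 - m) - 1)"
  defines "e \<equiv> R\<^sup>2 - (x - x0) \<bullet> (x - x0)"
  defines "U \<equiv> barrier m \<kappa> x0 R \<theta> x"
  assumes e: "e > 0"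
  defines "S \<equiv> (\<Sum>b\<in>Basis. (p - 1 + m) * (4 / (1 - m) * ((x - x0) \<bullet> b) / e)\<^sup>2
       + (4 / (1 - m) / e + 2 * (4 / (1 - m)) * ((x - x0) \<bullet> b)\<^sup>2 / e\<^sup>2))"
  shows "S \<ge> 0" "U powr m * S \<le> 1 / (1 - m) / \<theta> * U"
proof -
  define s where "s = 1 / (1 - m)"
  define r2 where "r2 = (x - x0) \<bullet> (x - x0)"
  have s: "s > 0" and ps: "(p - 1 + m) * s = p / (1 - m) - 1" "p / (1 - m) > 1"
    using assms(1,2) by (auto simp: s_def field_simps)
  have s4: "4 / (1 - m) = 4 * s" by (simp add: s_def)
  have r2: "0 \<le> r2" "r2 \<le> R\<^sup>2" "e \<le> R\<^sup>2" using e by (auto simp: r2_def e_def)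
  have \<kappa>: "\<kappa> > 0" using ps(2) by (simp add: \<kappa>_def add_pos_nonneg)
  have "(\<Sum>b\<in>Basis. ((x - x0) \<bullet> b)\<^sup>2) = r2"
    unfolding r2_def by (subst euclidean_inner) (simp add: power2_eq_square)
  moreover have "S = (\<Sum>b\<in>Basis. (16 * (p - 1 + m) * s\<^sup>2 + 8 * s) / e\<^sup>2 * ((x - x0) \<bullet> b)\<^sup>2 + 4 * s / e)"
  proof -
    have "a * (4 * s * Y / e)\<^sup>2 + (4 * s / e + 2 * (4 * s) * Y\<^sup>2 / e\<^sup>2)
        = (16 * a * s\<^sup>2 + 8 * s) / e\<^sup>2 * Y\<^sup>2 + 4 * s / e" for a Y
      using e by (simp add: field_simps power2_eq_square)
    from this[of "p - 1 + m"] show ?thesis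
      unfolding S_def s4 by (intro sum.cong refl) (simp only: mult.assoc)
  qed
  moreover have "(\<Sum>b\<in>Basis. C * g b + D) = C * (\<Sum>b\<in>Basis. g b) + real DIM('a) * D"
    for C D and g :: "'a \<Rightarrow> real"
    by (simp add: sum.distrib sum_distrib_left)
  ultimately have S: "S = (16 * (p - 1 + m) * s\<^sup>2 + 8 * s) / e\<^sup>2 * r2 + real DIM('a) * (4 * s / e)"
    by metis
  show "S \<ge> 0"
  proof -
    have "0 \<le> (p - 1 + m) * s\<^sup>2" using assms(2) by (intro mult_nonneg_nonneg) auto
    then have "0 \<le> 16 * (p - 1 + m) * s\<^sup>2 + 8 * s"
      unfolding mult.assoc using s by (intro add_nonneg_nonneg) auto
    then show ?thesis
      unfolding S using s r2 e by (intro add_nonneg_nonneg[OF mult_nonneg_nonneg[OF divide_nonneg_nonneg]]) auto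
  qed
  have "e\<^sup>2 * S = s * ((16 * ((p - 1 + m) * s) + 8) * r2 + real DIM('a) * 4 * e)"
    unfolding S using e by (simp add: field_simps power2_eq_square)
  also have "\<dots> \<le> s * ((16 * ((p - 1 + m) * s) + 8) * R\<^sup>2 + real DIM('a) * 4 * R\<^sup>2)"
    using s ps r2 by (intro mult_left_mono add_mono) auto
  also have "\<dots> = s * (\<kappa> * R\<^sup>2)" unfolding ps \<kappa>_def by (simp add: algebra_simps)
  finally have eS: "e\<^sup>2 * S \<le> s * (\<kappa> * R\<^sup>2)" .
  have U: "U > 0" unfolding U_def using \<kappa> assms(3,4) e by (intro barrier_pos) (auto simp: e_def)
  have pos: "\<kappa> * R\<^sup>2 * \<theta> > 0" using \<kappa> assms by auto
  have ex: "1 / (1 - m) * (m - 1) = - 1" "- 2 / (1 - m) * (m - 1) = 2"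
    using assms(1) by (simp_all add: field_simps)
  have "U powr (m - 1) = (\<kappa> * R\<^sup>2 * \<theta>) powr (- 1) * e powr 2"
    unfolding U_def barrier_def e_def[symmetric] by (subst powr_mult) (simp only: powr_powr ex)
  also have "\<dots> = e\<^sup>2 / (\<kappa> * R\<^sup>2 * \<theta>)"
    using pos e by (simp add: powr_minus_divide)
  finally have Um: "U powr (m - 1) = e\<^sup>2 / (\<kappa> * R\<^sup>2 * \<theta>)" .
  have "U powr m * S = U * (U powr (m - 1) * S)" using U by (simp add: powr_diff)
  also have "\<dots> = U * ((e\<^sup>2 * S) / (\<kappa> * R\<^sup>2 * \<theta>))" by (simp add: Um)
  also have "\<dots> \<le> U * (s * (\<kappa> * R\<^sup>2) / (\<kappa> * R\<^sup>2 * \<theta>))"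
    using eS U pos by (intro mult_left_mono divide_right_mono) auto
  also have "\<dots> = s / \<theta> * U" using \<kappa> assms(3,4) by simp
  finally show "U powr m * S \<le> 1 / (1 - m) / \<theta> * U" by (simp add: s_def)
qed

section \<open>Monotonicity of the truncated energy\<close>

text \<open>The parametric version of \<open>continuous_on_zero_extension\<close>, for the differentiation under the integral over
  a closed time interval.\<close>

lemma continuous_on_zero_extension_slab:
  fixes g :: "'b::topological_space \<times> 'a::t2_space \<Rightarrow> real"
  assumes "open S" "closed K" "K \<subseteq> S" "continuous_on (I \<times> S) g"
    and "\<And>t x. t \<in> I \<Longrightarrow> x \<in> S - K \<Longrightarrow> g (t, x) = 0"
  shows "continuous_on (I \<times> UNIV) (\<lambda>(t, x). if x \<in> S then g (t, x) else 0)"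
proof -
  let ?h = "\<lambda>(t, x). if x \<in> S then g (t, x) else 0"
  have eq: "I \<times> S \<union> I \<times> (- K) = I \<times> UNIV" using assms(3) by auto
  have "continuous_on (I \<times> S \<union> I \<times> (- K)) ?h"
  proof (rule continuous_on_Un_local_open)
    show "openin (top_of_set (I \<times> S \<union> I \<times> - K)) (I \<times> S)"
         "openin (top_of_set (I \<times> S \<union> I \<times> - K)) (I \<times> - K)"
      unfolding eq using assms(1,2) by (auto intro!: openin_Times simp: open_Compl)
    show "continuous_on (I \<times> S) ?h" by (rule continuous_on_eq[OF assms(4)]) auto
    show "continuous_on (I \<times> - K) ?h"
      by (rule continuous_on_eq[OF continuous_on_const[of _ 0]]) (use assms(5) in auto)
  qed
  then show ?thesis unfolding eq .
qed

lemma dt_partial: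
  fixes w :: "real \<times> 'a::euclidean_space \<Rightarrow> real"
  assumes "w differentiable (at (t, x))"
  shows "((\<lambda>t. w (t, x)) has_real_derivative dt w (t, x)) (at t)"
  using dir_deriv_line[OF assms, of "(1, 0)"] DERIV_shift[of "\<lambda>t. w (t, x)" _ 0 t]
  by (simp add: dt_def add.commute)

text \<open>Where \<open>u \<le> U\<close> the density \<open>J\<close> and the flux vanish. On a compact time interval \<open>u\<close> is bounded on the closed
  ball, so this happens near the sphere, uniformly in time: both have compact support in the open ball. The
  integral of the divergence of the flux is then zero, and \<open>flux_dissipation\<close> bounds the time derivative of the
  energy by it.\<close>

lemma truncated_energy_decreasing:
  fixes u :: "real \<Rightarrow> 'a::euclidean_space \<Rightarrow> real"
  assumes weak: "weak_solution m T \<Omega> u" and smooth: "positive_smooth_unless_extinct T \<Omega> u"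
    and \<Omega>: "open \<Omega>" and live: "{t0..t1} \<times> cball x0 R1 \<subseteq> live_set T \<Omega> u"
    and t: "t0 < t1" and R1: "0 < R1"
    and m: "m < 1" and p: "1 \<le> p" "1 - m < p" and k: "k > 0" and \<rho>: "\<rho> > 0"
  defines "\<kappa> \<equiv> 4 * real DIM('a) + 8 + 16 * (p / (1 - m) - 1)"
  defines "J \<equiv> (\<lambda>\<tau> x. if x \<in> ball x0 R1
      then truncated_energy (capped_power p k) (barrier m \<kappa> x0 R1 (\<rho> + \<tau> - t0) x) (u \<tau> x) else 0)"
  obtains I0 I1 where "(J t0 has_integral I0) UNIV" "(J t1 has_integral I1) UNIV" "I1 \<le> I0"
proof -
  define w where "w = case_prod u"
  define S where "S = ball x0 R1"
  define I where "I = {t0..t1}"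
  define e where "e = (\<lambda>x. R1\<^sup>2 - (x - x0) \<bullet> (x - x0))"
  define E where "E = capped_power p k"
  define f where "f = capped_power' p k"
  define f' where "f' = capped_power'' p k"
  define \<theta> where "\<theta> = (\<lambda>z :: real \<times> 'a. \<rho> + fst z - t0)"
  define U where "U = (\<lambda>z. barrier m \<kappa> x0 R1 (\<theta> z) (snd z))"
  define P where "P = (\<lambda>b x. 4 / (1 - m) * ((x - x0) \<bullet> b) / e x)"
  define L where "L = (\<lambda>b x. 4 / (1 - m) / e x + 2 * (4 / (1 - m)) * ((x - x0) \<bullet> b)\<^sup>2 / (e x)\<^sup>2)"
  define Ut where "Ut = (\<lambda>z. 1 / (1 - m) / \<theta> z * U z)"
  define wb where "wb = (\<lambda>b. dir_deriv w (0, b))"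
  define wbb where "wbb = (\<lambda>b. dir_deriv (dir_deriv w (0, b)) (0, b))"
  define q where "q = (\<lambda>z. w z / U z)"
  define qb where "qb = (\<lambda>b z. (wb b z - w z * P b (snd z)) / U z)"
  define \<omega> where "\<omega> = (\<lambda>s. s powr m * cutoff' s)"
  define A where "A = (\<lambda>z. layer f (\<lambda>s. s * cutoff' s) (U z) (q z))"
  define M where "M = (\<lambda>z. layer f \<omega> (U z) (q z))"
  define MU where "MU = (\<lambda>z. layer f' (\<lambda>s. s * \<omega> s) (U z) (q z))"
  define Jz where "Jz = (\<lambda>z. truncated_energy E (U z) (w z))"
  define Jt where "Jt = (\<lambda>z. f (w z) * cutoff (q z) * dt w z - Ut z * A z)"
  define W where "W = (\<lambda>b z. f (w z) * cutoff (q z) * (w z powr (m - 1) * wb b z)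
     - M z * (U z powr m * P b (snd z)))"
  define W' where "W' = (\<lambda>b z. (f' (w z) * wb b z * cutoff (q z) + f (w z) * (cutoff' (q z) * qb b z))
        * (w z powr (m - 1) * wb b z)
      + f (w z) * cutoff (q z) * ((m - 1) * w z powr (m - 2) * (wb b z)\<^sup>2 + w z powr (m - 1) * wbb b z)
      - ((U z * P b (snd z) * MU z + qb b z * (f (w z) * (q z powr m * cutoff' (q z)))) * (U z powr m * P b (snd z))
         + M z * (m * U z powr m * (P b (snd z))\<^sup>2 + U z powr m * L b (snd z))))"
  have e_eq: "R1\<^sup>2 - (x - x0) \<bullet> (x - x0) = e x" for x by (simp add: e_def)
  have q_eq: "w z / U z = q z" for z by (simp add: q_def)
  note caps = E_def f_def f'_def
  have S: "open S" "S \<subseteq> cball x0 R1" by (auto simp: S_def)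
  have I: "t0 \<in> I" "t1 \<in> I" using t by (auto simp: I_def)
  have sub: "I \<times> S \<subseteq> live_set T \<Omega> u" using live S(2) by (auto simp: I_def)
  have e: "e x > 0" if "x \<in> S" for x
    using that power_strict_mono[of "norm (x - x0)" R1 2]
    by (simp add: S_def e_def dist_norm norm_minus_commute dot_square_norm)
  have \<theta>: "\<theta> z > 0" "\<theta> z \<ge> \<rho>" if "z \<in> I \<times> UNIV" for z using that \<rho> by (auto simp: \<theta>_def I_def)
  have "p / (1 - m) > 1" using m p by simp
  then have \<kappa>: "\<kappa> > 0" by (simp add: \<kappa>_def add_pos_nonneg)
  have pos: "w z > 0" "U z > 0" "q z > 0" "U z * q z = w z" if "z \<in> I \<times> S" for z
  proof -
    show w: "w z > 0" using live_setD(1)[OF smooth] that sub by (auto simp: w_def)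
    show U: "U z > 0"
      unfolding U_def by (rule barrier_pos) (use that \<kappa> R1 \<theta> e in \<open>auto simp: e_def\<close>)
    show "q z > 0" "U z * q z = w z" using w U by (auto simp: q_def)
  qed
  have Ck: "Ck_on k w (live_set T \<Omega> u)" for k
    using live_setD(2)[OF smooth] by (simp add: smooth_on_def w_def)
  have Ck1: "Ck_on k (dir_deriv w v) (live_set T \<Omega> u)" for k v
    using Ck[of "Suc k"] unfolding Ck_on.simps by blast
  have Ck2: "Ck_on k (dir_deriv (dir_deriv w v) v') (live_set T \<Omega> u)" for k v v'
    using Ck1[of "Suc k"] unfolding Ck_on.simps by blast
  have dw: "w differentiable (at z)" "dir_deriv w v differentiable (at z)" if "z \<in> I \<times> S" for z v
    using Ck[of 1] Ck1[of 1] that sub unfolding One_nat_def Ck_on.simps by blast+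
  note contL = Ck_on_imp_continuous_on[OF Ck] Ck_on_imp_continuous_on[OF Ck1] Ck_on_imp_continuous_on[OF Ck2]
  have cw: "continuous_on (I \<times> S) w" "continuous_on (I \<times> S) (dt w)"
       "continuous_on (I \<times> S) (wb b)" "continuous_on (I \<times> S) (wbb b)" for b
    unfolding wb_def wbb_def dt_def by (rule continuous_on_subset[OF _ sub], rule contL)+
  have d1: "(E has_real_derivative f v) (at v)" "(f has_real_derivative f' v) (at v)" if "v > 0" for v
    using that k capped_power_deriv capped_power'_deriv by (auto simp: caps)
  have cP: "continuous_on {0<..} E" "continuous_on {0<..} f" "continuous_on {0<..} f'"
    using d1 continuous_on_capped_power''[OF k]
    by (auto intro!: DERIV_continuous_on intro: DERIV_subset simp: f'_def)
  have ccut: "continuous_on X cutoff" for X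
    using cutoff_deriv by (intro DERIV_continuous_on) (auto intro: DERIV_subset)
  have c\<omega>: "continuous_on {0<..} \<omega>" "continuous_on {0<..} (\<lambda>s. s * \<omega> s)" "continuous_on {0<..} (\<lambda>s. s * cutoff' s)"
    unfolding \<omega>_def by (intro continuous_intros continuous_on_cutoff'; force)+
  have \<omega>0: "\<omega> s = 0" "s * \<omega> s = 0" "s * cutoff' s = 0" if "s \<le> 1" for s
    using that by (simp_all add: \<omega>_def cutoff_left)
  have ce: "continuous_on X e" for X unfolding e_def by (intro continuous_intros)
  have ce': "continuous_on (I \<times> S) (\<lambda>z. e (snd z))"
    by (rule continuous_on_compose2[OF ce[of UNIV]]) (auto intro: continuous_intros)
  have cU: "continuous_on (I \<times> S) U"
    unfolding U_def barrier_def e_eq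
    using \<theta>(1) e \<kappa> R1 unfolding \<theta>_def by (intro continuous_intros ce') force+
  have cUt: "continuous_on (I \<times> S) Ut"
    using \<theta>(1) unfolding Ut_def \<theta>_def by (intro continuous_intros cU) (use m in force)+
  have cq: "continuous_on (I \<times> S) q"
    unfolding q_def using pos by (intro continuous_intros cU cw) force
  have cPL: "continuous_on (I \<times> S) (\<lambda>z. P b (snd z))" "continuous_on (I \<times> S) (\<lambda>z. L b (snd z))" for b
    unfolding P_def L_def using e by (intro continuous_intros ce'; use m in force)+
  have cqb: "continuous_on (I \<times> S) (qb b)" for b
    unfolding qb_def using pos by (intro continuous_intros cU cw cPL) force
  have clay: "continuous_on (I \<times> S) (\<lambda>z. layer a c (U z) (q z))"
    if "continuous_on {0<..} a" "continuous_on {0<..} c" for a c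
  proof -
    have "(\<lambda>z. (U z, q z)) ` (I \<times> S) \<subseteq> {0<..} \<times> {0<..}" using pos(2,3) by blast
    from continuous_on_compose2[OF continuous_on_layer[OF that] continuous_on_Pair[OF cU cq] this]
    show ?thesis by simp
  qed
  have cA: "continuous_on (I \<times> S) A" "continuous_on (I \<times> S) M" "continuous_on (I \<times> S) MU"
       "continuous_on (I \<times> S) (\<lambda>z. layer E cutoff' (U z) (q z))"
    unfolding A_def M_def MU_def by (intro clay cP c\<omega> continuous_on_cutoff')+
  have cE: "continuous_on (I \<times> S) (\<lambda>z. E (w z))" "continuous_on (I \<times> S) (\<lambda>z. f (w z))"
       "continuous_on (I \<times> S) (\<lambda>z. f' (w z))"
    using pos by (intro continuous_on_compose2[OF cP(1) cw(1)] continuous_on_compose2[OF cP(2) cw(1)]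
          continuous_on_compose2[OF cP(3) cw(1)]; force)+
  have ccq: "continuous_on (I \<times> S) (\<lambda>z. cutoff (q z))" "continuous_on (I \<times> S) (\<lambda>z. cutoff' (q z))"
    by (intro continuous_on_compose2[OF ccut[of UNIV] cq] continuous_on_compose2[OF continuous_on_cutoff'[of UNIV] cq]; simp)+
  have cJ: "continuous_on (I \<times> S) Jz"
    unfolding Jz_def truncated_energy_def q_eq by (intro continuous_intros cE ccq cA)
  have cJt: "continuous_on (I \<times> S) Jt"
    unfolding Jt_def by (intro continuous_intros cE ccq cA cUt cw)
  have cW: "continuous_on (I \<times> S) (W b)" "continuous_on (I \<times> S) (W' b)" for b
    unfolding W_def W'_def using pos
    by (intro continuous_intros cE ccq cA cUt cU cw cPL cqb cq; force)+
  have slice: "continuous_on S (\<lambda>x. g (\<tau>, x))" if "\<tau> \<in> I" "continuous_on (I \<times> S) g" for \<tau> and g :: "real \<times> 'a \<Rightarrow> real"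
    using that(1) by (intro continuous_on_compose2[OF that(2)] continuous_intros) auto

  have "compact (w ` (I \<times> cball x0 R1))"
    using continuous_on_subset[OF contL(1) live] unfolding I_def
    by (intro compact_continuous_image compact_Times) auto
  then obtain B0 where "\<forall>y\<in>w ` (I \<times> cball x0 R1). norm y \<le> B0"
    using compact_imp_bounded bounded_iff by metis
  then have B0: "w z \<le> B0" if "z \<in> I \<times> S" for z using that S(2) by fastforce
  \<comment> \<open>\<open>C0\<close> is the time-dependent factor of the barrier at the start, where it is smallest. Where \<open>e < e0\<close> the spatial
    factor is at least \<open>B / C0\<close>.\<close>
  define C0 where "C0 = (\<kappa> * R1\<^sup>2 * \<rho>) powr (1 / (1 - m))"
  define B where "B = max 1 B0"
  define e0 where "e0 = min (R1\<^sup>2) ((C0 / B) powr ((1 - m) / 2))"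
  have C0: "C0 > 0" and B: "B > 0" and e0: "e0 > 0"
    using \<kappa> R1 \<rho> by (auto simp: C0_def B_def e0_def)
  have q1: "q z \<le> 1" if z: "z \<in> I \<times> S" "e (snd z) < e0" for z
  proof -
    have es: "e (snd z) > 0" using z e by auto
    have "(C0 / B) powr ((1 - m) / 2) \<ge> e (snd z)" using z by (simp add: e0_def)
    then have "((C0 / B) powr ((1 - m) / 2)) powr (- 2 / (1 - m)) \<le> e (snd z) powr (- 2 / (1 - m))"
      using es m by (intro powr_mono2') auto
    moreover have "((C0 / B) powr ((1 - m) / 2)) powr (- 2 / (1 - m)) = B / C0"
      using C0 B m by (simp add: powr_powr powr_minus field_simps)
    ultimately have 1: "B / C0 \<le> e (snd z) powr (- 2 / (1 - m))" by simp
    have "\<theta> z \<ge> \<rho>" using \<theta>(2) z by auto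
    then have "\<kappa> * R1\<^sup>2 * \<rho> \<le> \<kappa> * R1\<^sup>2 * \<theta> z" using \<kappa> by (intro mult_left_mono) auto
    then have 2: "C0 \<le> (\<kappa> * R1\<^sup>2 * \<theta> z) powr (1 / (1 - m))"
      unfolding C0_def using \<kappa> \<rho> m by (intro powr_mono2) auto
    have "C0 * (B / C0) \<le> U z"
      unfolding U_def barrier_def e_eq using 1 2 C0 B by (intro mult_mono) auto
    then have "w z \<le> U z" using B0[OF z(1)] C0 by (simp add: B_def)
    then show ?thesis using pos(2)[OF z(1)] by (simp add: q_def)
  qed
  define K where "K = {x \<in> cball x0 R1. e x \<ge> e0}"
  have "K = cball x0 R1 \<inter> e -` {e0..}" by (auto simp: K_def)
  then have Kc: "compact K"
    using continuous_closed_preimage[OF ce[of "cball x0 R1"] closed_cball, of "{e0..}"]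
    by (metis compact_Int_closed compact_cball closed_atLeast closed_cball bounded_subset bounded_cball compact_eq_bounded_closed inf_le1)
  have KS: "K \<subseteq> S"
  proof
    fix x assume "x \<in> K"
    then have "(norm (x - x0))\<^sup>2 < R1\<^sup>2" using e0 by (simp add: K_def e_def dot_square_norm)
    then show "x \<in> S" using R1 power2_less_imp_less[of "norm (x - x0)" R1]
      by (simp add: S_def dist_norm norm_minus_commute)
  qed
  have out: "q z \<le> 1" if "fst z \<in> I" "snd z \<in> S - K" for z
    using that S(2) by (intro q1) (auto simp: K_def mem_Times_iff)
  have Z: "Jz z = 0" "Jt z = 0" "W b z = 0" if "fst z \<in> I" "snd z \<in> S - K" for z b
    using out[OF that] \<omega>0 cutoff_left
    by (simp_all add: Jz_def truncated_energy_def q_eq Jt_def W_def A_def M_def layer_eq_0)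

  \<comment> \<open>The terms with \<open>\<eta>'(q)\<close> from the product rule and from the endpoint of the layer integral cancel.\<close>
  have DJ: "((\<lambda>\<tau>. Jz (\<tau>, x)) has_real_derivative Jt (\<tau>, x)) (at \<tau>)" if z: "(\<tau>, x) \<in> I \<times> S" for \<tau> x
  proof -
    have "((\<lambda>\<tau>. \<rho> + \<tau> - t0) has_real_derivative 1) (at \<tau>)" by (auto intro!: derivative_eq_intros)
    from DERIV_chain2[OF barrier_deriv_time this, of \<kappa> R1 m x0 x]
    have dU: "((\<lambda>\<tau>. U (\<tau>, x)) has_real_derivative Ut (\<tau>, x)) (at \<tau>)"
      using \<kappa> R1 m \<theta>(1)[of "(\<tau>, x)"] z by (simp add: U_def Ut_def \<theta>_def)
    note dW = dt_partial[OF dw(1)[OF z]]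
    note ps = pos[OF z]
    define q' where "q' = (dt w (\<tau>, x) * U (\<tau>, x) - w (\<tau>, x) * Ut (\<tau>, x)) / (U (\<tau>, x) * U (\<tau>, x))"
    have dq: "((\<lambda>\<tau>. q (\<tau>, x)) has_real_derivative q') (at \<tau>)"
      unfolding q_def q'_def using ps by (intro DERIV_divide dW dU) auto
    have dl: "((\<lambda>\<tau>. layer E cutoff' (U (\<tau>, x)) (q (\<tau>, x))) has_real_derivative
        Ut (\<tau>, x) * layer f (\<lambda>s. s * cutoff' s) (U (\<tau>, x)) (q (\<tau>, x))
          + q' * (E (U (\<tau>, x) * q (\<tau>, x)) * cutoff' (q (\<tau>, x)))) (at \<tau>)"
      by (rule layer_has_real_derivative[OF d1(1) cP(2) continuous_on_cutoff' cutoff_left(2) dU _ dq]) (use ps in auto)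
    show ?thesis
      unfolding Jz_def truncated_energy_def Jt_def A_def
      unfolding q_eq
      by (rule DERIV_cong[OF DERIV_diff[OF DERIV_mult[OF DERIV_chain2[OF d1(1) dW] DERIV_chain2[OF cutoff_deriv dq]] dl]])
         (use ps in \<open>auto simp: algebra_simps\<close>)
  qed

  have DW: "((\<lambda>h. W b (\<tau>, x + h *\<^sub>R b)) has_real_derivative W' b (\<tau>, x)) (at 0)"
    if z: "(\<tau>, x) \<in> I \<times> S" and b: "b \<in> Basis" for \<tau> x b
  proof -
    note ps = pos[OF z]
    have ex: "e x > 0" using e z by auto
    have line: "(\<tau>, x) + h *\<^sub>R (0, b) = (\<tau>, x + h *\<^sub>R b)" for h :: real by simp
    have dwb: "((\<lambda>h. w (\<tau>, x + h *\<^sub>R b)) has_real_derivative wb b (\<tau>, x)) (at 0)"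
      using dir_deriv_line[OF dw(1)[OF z], of "(0, b)"] unfolding line wb_def .
    have dwbb: "((\<lambda>h. wb b (\<tau>, x + h *\<^sub>R b)) has_real_derivative wbb b (\<tau>, x)) (at 0)"
      using dir_deriv_line[OF dw(2)[OF z], of "(0, b)" "(0, b)"] unfolding line wb_def wbb_def .
    have dU: "((\<lambda>h. U (\<tau>, x + h *\<^sub>R b)) has_real_derivative U (\<tau>, x) * P b x) (at 0)"
      using barrier_deriv_line[of R1 x x0 m \<kappa> "\<rho> + \<tau> - t0" b] ex m
      by (simp add: U_def P_def \<theta>_def e_def)
    have dP: "((\<lambda>h. P b (x + h *\<^sub>R b)) has_real_derivative L b x) (at 0)"
      unfolding P_def L_def e_def by (rule barrier_log_deriv_line) (use ex b in \<open>auto simp: e_def\<close>)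
    have p0: "w (\<tau>, x + 0 *\<^sub>R b) > 0" "U (\<tau>, x + 0 *\<^sub>R b) > 0" "q (\<tau>, x + 0 *\<^sub>R b) > 0" using ps by auto
    have dq: "((\<lambda>h. q (\<tau>, x + h *\<^sub>R b)) has_real_derivative qb b (\<tau>, x)) (at 0)"
    proof -
      have "U (\<tau>, x + 0 *\<^sub>R b) \<noteq> 0" using p0 by auto
      from DERIV_divide[OF dwb dU this] show ?thesis
        unfolding q_def qb_def by (rule DERIV_cong) (use ps in \<open>simp add: field_simps\<close>)
    qed
    have dl: "((\<lambda>h. M (\<tau>, x + h *\<^sub>R b)) has_real_derivative
        U (\<tau>, x) * P b x * MU (\<tau>, x) + qb b (\<tau>, x) * (f (w (\<tau>, x)) * \<omega> (q (\<tau>, x)))) (at 0)"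
      using layer_has_real_derivative[OF d1(2) cP(3) c\<omega>(1) \<omega>0(1) dU p0(2) dq p0(3)] ps
      by (simp add: M_def MU_def)
    have dwp: "((\<lambda>h. w (\<tau>, x + h *\<^sub>R b) powr (m - 1)) has_real_derivative
        (m - 1) * w (\<tau>, x) powr (m - 2) * wb b (\<tau>, x)) (at 0)"
      using DERIV_fun_powr[OF dwb p0(1), of "m - 1"] by simp
    have dUp: "((\<lambda>h. U (\<tau>, x + h *\<^sub>R b) powr m) has_real_derivative m * U (\<tau>, x) powr m * P b x) (at 0)"
      by (rule DERIV_cong[OF DERIV_fun_powr[OF dU p0(2), of m]]) (use ps in \<open>simp add: powr_diff\<close>)
    have dfw: "((\<lambda>h. f (w (\<tau>, x + h *\<^sub>R b))) has_real_derivative f' (w (\<tau>, x)) * wb b (\<tau>, x)) (at 0)"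
      by (rule DERIV_cong[OF DERIV_chain2[OF d1(2) dwb]]) (use ps in auto)
    have dcq: "((\<lambda>h. cutoff (q (\<tau>, x + h *\<^sub>R b))) has_real_derivative cutoff' (q (\<tau>, x)) * qb b (\<tau>, x)) (at 0)"
      by (rule DERIV_cong[OF DERIV_chain2[OF cutoff_deriv dq]]) auto
    show ?thesis
      unfolding W_def W'_def snd_conv
      by (rule DERIV_cong[OF DERIV_diff[OF DERIV_mult[OF DERIV_mult[OF dfw dcq] DERIV_mult[OF dwp dwbb]]
            DERIV_mult[OF dl DERIV_mult[OF dUp dP]]]])
         (simp add: \<omega>_def power2_eq_square algebra_simps)
  qed

  have Jt_le: "Jt z \<le> (\<Sum>b\<in>Basis. W' b z)" if z: "z \<in> I \<times> S" for z
  proof -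
    note ps = pos[OF z]
    have ez: "e (snd z) > 0" using e z by auto
    have eq: "dt w z = (\<Sum>b\<in>Basis. w z powr (m - 1) * wbb b z + (m - 1) * w z powr (m - 2) * (wb b z)\<^sup>2)"
      unfolding wb_def wbb_def w_def
      by (rule classical_equation[OF weak smooth \<Omega>]) (use z sub in auto)
    note sup = barrier_supersolution[OF m p(2) \<theta>(1) R1, of z "snd z" x0, folded \<kappa>_def, unfolded e_eq]
    have bnd: "0 \<le> f v" "0 \<le> f' v" "v * f' v \<le> (p - 1) * f v" if "v > 0" for v
      using capped_power_bounds[OF k that p(1)] by (auto simp: caps)
    have wpos: "0 \<le> \<omega> s" for s by (simp add: \<omega>_def cutoff'_nonneg)
    have M0: "0 \<le> M z"
    proof -
      have "0 * layer f \<omega> (U z) (q z) \<le> 1 * layer f \<omega> (U z) (q z)"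
        by (rule layer_mono) (use ps cP c\<omega> \<omega>0 wpos bnd in auto)
      then show ?thesis by (simp add: M_def)
    qed
    have MA: "M z \<le> A z"
    proof -
      have "1 * layer f \<omega> (U z) (q z) \<le> 1 * layer f (\<lambda>s. s * cutoff' s) (U z) (q z)"
      proof (rule layer_mono)
        fix s assume s: "1 \<le> s" "s \<le> q z"
        \<comment> \<open>Here \<open>m < 1\<close> enters, together with the fact that \<open>\<eta>'\<close> lives on \<open>s \<ge> 1\<close>.\<close>
        have "s powr m \<le> s powr 1" using s m by (intro powr_mono) auto
        then have "\<omega> s \<le> s * cutoff' s"
          unfolding \<omega>_def using s cutoff'_nonneg by (intro mult_right_mono) auto
        then show "1 * (f (U z * s) * \<omega> s) \<le> 1 * (f (U z * s) * (s * cutoff' s))"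
          using bnd(1)[of "U z * s"] ps s by (simp add: mult_left_mono)
      qed (use ps cP c\<omega> \<omega>0 in auto)
      then show ?thesis by (simp add: M_def A_def)
    qed
    have MUM: "U z * MU z \<le> (p - 1) * M z"
      unfolding M_def MU_def
    proof (rule layer_mono)
      fix s assume s: "1 \<le> s" "s \<le> q z"
      have "(U z * s) * f' (U z * s) * \<omega> s \<le> (p - 1) * f (U z * s) * \<omega> s"
        using bnd(3)[of "U z * s"] ps s wpos by (intro mult_right_mono) auto
      then show "U z * (f' (U z * s) * (s * \<omega> s)) \<le> (p - 1) * (f (U z * s) * \<omega> s)"
        by (simp add: mult_ac)
    qed (use ps cP c\<omega> \<omega>0 in auto)
    have *: "z \<in> I \<times> UNIV" using z by auto
    show ?thesis
      unfolding Jt_def eq W'_def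
    proof (rule flux_dissipation[OF ps(1,2) ps(4)[symmetric] _ _ _ _ M0 MA MUM])
      show "wb b z = U z * qb b z + w z * P b (snd z)" for b
        using ps by (simp add: qb_def)
      show "0 \<le> (\<Sum>b\<in>Basis. (p - 1 + m) * (P b (snd z))\<^sup>2 + L b (snd z))"
           "U z powr m * (\<Sum>b\<in>Basis. (p - 1 + m) * (P b (snd z))\<^sup>2 + L b (snd z)) \<le> Ut z"
        using sup[OF *] ez by (simp_all add: U_def Ut_def P_def L_def)
    qed (use bnd ps cutoff_nonneg cutoff'_nonneg in auto)
  qed

  \<comment> \<open>Differentiation under the integral needs a box as domain; the extensions by zero are continuous on it.\<close>
  define Jx where "Jx = (\<lambda>\<tau> x. if x \<in> S then Jz (\<tau>, x) else 0)"
  define Gx where "Gx = (\<lambda>\<tau> x. if x \<in> S then Jt (\<tau>, x) else 0)"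
  obtain a where a: "K \<subseteq> cbox (- a) a"
    using bounded_subset_cbox_symmetric compact_imp_bounded[OF Kc] by metis
  have Kcl: "closed K" using Kc by (rule compact_imp_closed)
  have cJx: "continuous_on (I \<times> UNIV) (\<lambda>(\<tau>, x). Jx \<tau> x)" and cGx: "continuous_on (I \<times> UNIV) (\<lambda>(\<tau>, x). Gx \<tau> x)"
    unfolding Jx_def Gx_def
    by (rule continuous_on_zero_extension_slab[OF S(1) Kcl KS], use cJ cJt Z in auto)+
  have hi: "(g \<tau> has_integral integral (cbox (- a) a) (g \<tau>)) UNIV" "g \<tau> integrable_on cbox (- a) a"
    if "continuous_on (I \<times> UNIV) (\<lambda>(\<tau>, x). g \<tau> x)" "\<tau> \<in> I" "\<And>x. x \<notin> K \<Longrightarrow> g \<tau> x = 0"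
    for g :: "real \<Rightarrow> 'a \<Rightarrow> real" and \<tau>
  proof -
    have "continuous_on (cbox (- a) a) (\<lambda>x. (\<lambda>(\<tau>, x). g \<tau> x) (\<tau>, x))"
      using that(2) by (intro continuous_on_compose2[OF that(1)] continuous_intros) auto
    then show i: "g \<tau> integrable_on cbox (- a) a" by (auto intro: integrable_continuous)
    show "(g \<tau> has_integral integral (cbox (- a) a) (g \<tau>)) UNIV"
      by (rule has_integral_on_superset[OF integrable_integral[OF i]]) (use that(3) a in auto)
  qed
  have Jx0: "Jx \<tau> x = 0" "Gx \<tau> x = 0" if "\<tau> \<in> I" "x \<notin> K" for \<tau> x
    using Z(1,2)[of "(\<tau>, x)"] that by (auto simp: Jx_def Gx_def)
  note hJ = hi[OF cJx _ Jx0(1)] and hG = hi[OF cGx _ Jx0(2)]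
  define F where "F = (\<lambda>\<tau>. integral (cbox (- a) a) (Jx \<tau>))"
  have dF: "(F has_real_derivative integral (cbox (- a) a) (Gx \<tau>)) (at \<tau> within I)" if \<tau>: "\<tau> \<in> I" for \<tau>
    unfolding F_def
  proof (rule leibniz_rule_field_derivative)
    show "((\<lambda>\<tau>. Jx \<tau> x) has_real_derivative Gx \<tau> x) (at \<tau> within I)" if "\<tau> \<in> I" for \<tau> x
      using DERIV_subset[OF DJ, of \<tau> x I] that by (auto simp: Jx_def Gx_def)
    show "Jx \<tau> integrable_on cbox (- a) a" if "\<tau> \<in> I" for \<tau> using hJ(2) that by auto
    show "continuous_on (I \<times> cbox (- a) a) (\<lambda>(\<tau>, x). Gx \<tau> x)"
      by (rule continuous_on_subset[OF cGx]) auto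
  qed (use \<tau> in \<open>auto simp: I_def\<close>)
  have G0: "integral (cbox (- a) a) (Gx \<tau>) \<le> 0" if \<tau>: "\<tau> \<in> I" for \<tau>
  proof -
    have "((\<lambda>x. if x \<in> S then W' b (\<tau>, x) else 0) has_integral 0) UNIV" if "b \<in> Basis" for b
    proof (rule integral_directional_derivative_eq_0[OF S(1) Kc KS, where v = b])
      show "continuous_on S (\<lambda>x. W b (\<tau>, x))" "continuous_on S (\<lambda>x. W' b (\<tau>, x))"
        by (rule slice[OF \<tau> cW(1)], rule slice[OF \<tau> cW(2)])
    qed (use Z(3) DW \<tau> that in auto)
    then have 1: "((\<lambda>x. \<Sum>b\<in>Basis. if x \<in> S then W' b (\<tau>, x) else 0) has_integral (\<Sum>b\<in>(Basis::'a set). 0)) UNIV"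
      by (intro has_integral_sum finite_Basis)
    have 2: "Gx \<tau> x \<le> (\<Sum>b\<in>Basis. if x \<in> S then W' b (\<tau>, x) else 0)" for x
    proof (cases "x \<in> S")
      case True
      with Jt_le[of "(\<tau>, x)"] \<tau> show ?thesis unfolding Gx_def by auto
    qed (simp add: Gx_def)
    have 3: "(Gx \<tau> has_integral integral (cbox (- a) a) (Gx \<tau>)) UNIV"
      by (rule hG(1)) (use \<tau> in auto)
    have "integral (cbox (- a) a) (Gx \<tau>) \<le> (\<Sum>b\<in>(Basis::'a set). 0)"
      by (rule has_integral_le[OF 3 1 2])
    then show ?thesis by simp
  qed
  have "F t1 \<le> F t0"
  proof (rule DERIV_nonpos_imp_decreasing_open[of t0 t1 F])
    show "\<exists>y. (F has_real_derivative y) (at \<tau>) \<and> y \<le> 0" if "t0 < \<tau>" "\<tau> < t1" for \<tau>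
    proof -
      have "\<tau> \<in> I" "at \<tau> within I = at \<tau>" using that by (auto simp: I_def at_within_Icc_at)
      with dF[of \<tau>] G0[of \<tau>] show ?thesis by auto
    qed
    show "continuous_on {t0..t1} F"
      unfolding I_def[symmetric] by (rule DERIV_continuous_on[OF dF])
  qed (use t in auto)
  moreover have "Jx = J"
    by (auto simp: Jx_def J_def Jz_def S_def U_def \<theta>_def w_def E_def fun_eq_iff)
  ultimately show ?thesis
    using that hJ(1)[OF I(1) I(1)] hJ(1)[OF I(2) I(2)] by (simp add: F_def)
qed

text \<open>Below the barrier the solution is controlled by the barrier, above twice the barrier by the energy. At the
  later time this costs the mass of the barrier; at the earlier time the energy is below the mass.\<close>

lemma truncated_mass_estimate:
  fixes u :: "real \<Rightarrow> 'a::euclidean_space \<Rightarrow> real"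
  assumes weak: "weak_solution m T \<Omega> u" and smooth: "positive_smooth_unless_extinct T \<Omega> u"
    and \<Omega>: "open \<Omega>" and live: "{t0..t1} \<times> cball x0 R1 \<subseteq> live_set T \<Omega> u"
    and t: "t0 < t1" and R1: "R \<le> R1" "0 < R1"
    and m: "m < 1" and p: "1 \<le> p" "1 - m < p" and k: "k > 0" and \<rho>: "\<rho> > 0"
  defines "\<kappa> \<equiv> 4 * real DIM('a) + 8 + 16 * (p / (1 - m) - 1)"
  shows "(\<integral>\<^sup>+x\<in>ball x0 R. ennreal (capped_power p k (u t1 x)) \<partial>lebesgue)
     \<le> (\<integral>\<^sup>+x\<in>ball x0 R1. ennreal (capped_power p k (u t0 x)) \<partial>lebesgue)
       + (\<integral>\<^sup>+x\<in>ball x0 R. ennreal ((2 * barrier m \<kappa> x0 R1 (\<rho> + t1 - t0) x) powr p) \<partial>lebesgue)"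
proof -
  define U where "U = (\<lambda>\<tau>. barrier m \<kappa> x0 R1 (\<rho> + \<tau> - t0))"
  define E where "E = capped_power p k"
  define J where "J = (\<lambda>\<tau> x. if x \<in> ball x0 R1 then truncated_energy E (U \<tau> x) (u \<tau> x) else 0)"
  obtain I0 I1 where I: "(J t0 has_integral I0) UNIV" "(J t1 has_integral I1) UNIV" "I1 \<le> I0"
    using truncated_energy_decreasing[OF weak smooth \<Omega> live t R1(2) m p k \<rho>]
    unfolding J_def E_def U_def \<kappa>_def by blast
  have "p / (1 - m) > 1" using m p by simp
  then have \<kappa>: "\<kappa> > 0" by (simp add: \<kappa>_def add_pos_nonneg)
  have upos: "u \<tau> x > 0" if "\<tau> \<in> {t0, t1}" "x \<in> ball x0 R1" for \<tau> x
  proof -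
    have "(\<tau>, x) \<in> live_set T \<Omega> u" using live that t by (auto simp: subset_iff)
    from live_setD(1)[OF smooth this] show ?thesis by simp
  qed
  have e: "R1\<^sup>2 - (x - x0) \<bullet> (x - x0) > 0" if "x \<in> ball x0 R1" for x
    using that power_strict_mono[of "norm (x - x0)" R1 2]
    by (simp add: dist_norm norm_minus_commute dot_square_norm)
  have Upos: "U \<tau> x > 0" if "\<tau> \<in> {t0, t1}" "x \<in> ball x0 R1" for \<tau> x
    unfolding U_def using that \<kappa> R1 t \<rho> e by (intro barrier_pos) auto
  note bnd = truncated_energy_bounds[OF Upos upos k p(1), folded E_def]
  have J0: "0 \<le> J \<tau> x" if "\<tau> \<in> {t0, t1}" for \<tau> x
    using bnd(1)[of \<tau> x] that by (auto simp: J_def)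
  have NI: "(\<integral>\<^sup>+x. ennreal (J t0 x) \<partial>lebesgue) = ennreal I0" "(\<integral>\<^sup>+x. ennreal (J t1 x) \<partial>lebesgue) = ennreal I1"
     "J t1 \<in> borel_measurable lebesgue"
    using has_integral_iff_nn_integral_lebesgue[of "J t0" I0] has_integral_iff_nn_integral_lebesgue[of "J t1" I1] I J0
    by auto
  have "continuous_on (ball x0 R) (\<lambda>x. (2 * U t1 x) powr p)"
    unfolding U_def barrier_def using e R1(1) \<rho> t \<kappa> R1(2) by (intro continuous_intros) force+
  then have "(\<lambda>x. indicator (ball x0 R) x *\<^sub>R (2 * U t1 x) powr p) \<in> borel_measurable borel"
    by (intro borel_measurable_continuous_on_indicator) auto
  then have "(\<lambda>x. indicator (ball x0 R) x *\<^sub>R (2 * U t1 x) powr p) \<in> borel_measurable lebesgue"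
    by (simp add: measurable_completion)
  then have meas: "(\<lambda>x. ennreal (indicator (ball x0 R) x *\<^sub>R (2 * U t1 x) powr p)) \<in> borel_measurable lebesgue"
    by measurable
  have eq: "ennreal (indicator (ball x0 R) x *\<^sub>R (2 * U t1 x) powr p)
      = ennreal ((2 * U t1 x) powr p) * indicator (ball x0 R) x" for x
    by (simp add: indicator_def)
  have Bm: "(\<lambda>x. ennreal ((2 * U t1 x) powr p) * indicator (ball x0 R) x) \<in> borel_measurable lebesgue"
    using meas unfolding eq .
  have "(\<integral>\<^sup>+x\<in>ball x0 R. ennreal (E (u t1 x)) \<partial>lebesgue)
    \<le> (\<integral>\<^sup>+x. ennreal (J t1 x) + ennreal ((2 * U t1 x) powr p) * indicator (ball x0 R) x \<partial>lebesgue)"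
  proof (rule nn_integral_mono)
    fix x
    show "ennreal (E (u t1 x)) * indicator (ball x0 R) x
       \<le> ennreal (J t1 x) + ennreal ((2 * U t1 x) powr p) * indicator (ball x0 R) x"
    proof (cases "x \<in> ball x0 R")
      case True
      then have x: "x \<in> ball x0 R1" using R1(1) by auto
      have "E (u t1 x) \<le> J t1 x + E (2 * U t1 x)" using bnd(3)[of t1 x] x by (simp add: J_def)
      also have "E (2 * U t1 x) \<le> (2 * U t1 x) powr p"
        unfolding E_def using Upos[of t1 x] x k p(1) by (intro capped_power_bounds) auto
      finally have "ennreal (E (u t1 x)) \<le> ennreal (J t1 x + (2 * U t1 x) powr p)"
        by (simp add: ennreal_leI)
      also have "\<dots> = ennreal (J t1 x) + ennreal ((2 * U t1 x) powr p)"
        using J0 by (simp add: ennreal_plus)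
      finally show ?thesis using True by simp
    qed simp
  qed
  also have "\<dots> = ennreal I1 + (\<integral>\<^sup>+x\<in>ball x0 R. ennreal ((2 * U t1 x) powr p) \<partial>lebesgue)"
    using NI Bm by (subst nn_integral_add) auto
  also have "ennreal I1 \<le> ennreal I0" using I(3) by (rule ennreal_leI)
  also have "ennreal I0 \<le> (\<integral>\<^sup>+x\<in>ball x0 R1. ennreal (E (u t0 x)) \<partial>lebesgue)"
    unfolding NI(1)[symmetric]
  proof (rule nn_integral_mono)
    show "ennreal (J t0 x) \<le> ennreal (E (u t0 x)) * indicator (ball x0 R1) x" for x
      using bnd(2)[of t0 x] by (auto simp: J_def ennreal_leI)
  qed
  finally show ?thesis by (simp add: E_def U_def add_right_mono)
qed

section \<open>The mass of the barrier\<close>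

lemma midpoint_power_le:
  fixes a b :: real
  assumes "a \<ge> 0" "b \<ge> 0"
  shows "2 * ((a + b) / 2) ^ n \<le> a ^ n + b ^ n"
proof (induction n)
  case (Suc n)
  have "0 \<le> (a - b) * (a ^ n - b ^ n)"
    using assms by (cases "a \<le> b") (simp_all add: zero_le_mult_iff power_mono)
  then have "(a + b) * (a ^ n + b ^ n) \<le> 2 * (a ^ Suc n + b ^ Suc n)" by (simp add: algebra_simps)
  moreover have "(a + b) * (2 * ((a + b) / 2) ^ n) \<le> (a + b) * (a ^ n + b ^ n)"
    using Suc assms by (intro mult_left_mono) auto
  ultimately show ?case by simp
qed simp

lemma measure_ball_diff:
  assumes "R \<le> R1" "0 \<le> R1"
  shows "measure lebesgue (ball x0 R1 - ball (x0 :: 'a::euclidean_space) R)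
     = unit_ball_vol (real DIM('a)) * (R1 ^ DIM('a) - max 0 R ^ DIM('a))"
proof -
  have "measure lebesgue (ball x0 R1 - ball x0 R) = measure lebesgue (ball x0 R1) - measure lebesgue (ball x0 R)"
    using assms by (intro measurable_measure_Diff) auto
  moreover have "measure lebesgue (ball x0 R) = unit_ball_vol (real DIM('a)) * max 0 R ^ DIM('a)"
    by (cases "R \<ge> 0") (auto simp: content_ball max_def ball_empty zero_power)
  moreover have "measure lebesgue (ball x0 R1) = unit_ball_vol (real DIM('a)) * R1 ^ DIM('a)"
    using assms by (simp add: content_ball)
  ultimately show ?thesis by (simp add: algebra_simps)
qed

text \<open>Doubling the distance to the outer sphere at most doubles the volume of the shell, while it divides the
  integrand by at least four. The masses of the successive shells therefore decay geometrically, with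
  sum at most twice the first. The induction counts the doublings until the inner ball is empty. The volume of the
  shell, rather than that of the ball, is what makes the final constant sharp enough for \<open>R\<close> close to \<open>R1\<close>.\<close>

lemma radial_singularity_integral:
  fixes x0 :: "'a::euclidean_space"
  assumes "2 \<le> a" "R < R1" "0 < R1"
  shows "(\<integral>\<^sup>+x\<in>ball x0 R. ennreal ((R1 - dist x0 x) powr (- a)) \<partial>lebesgue)
     \<le> ennreal (2 * (R1 - R) powr (- a) * measure lebesgue (ball x0 R1 - ball x0 R))"
proof -
  define G where "G = (\<lambda>x. ennreal ((R1 - dist x0 x) powr (- a)))"
  define V where "V = (\<lambda>R R'. measure lebesgue (ball x0 R - ball x0 R'))"
  have Gm[measurable]: "G \<in> borel_measurable lebesgue"
    unfolding G_def by (intro measurable_completion) (measurable; simp)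
  have step: "R \<le> R1 * (1 - (1/2) ^ n) \<Longrightarrow> R < R1 \<Longrightarrow>
     (\<integral>\<^sup>+x\<in>ball x0 R. G x \<partial>lebesgue) \<le> ennreal (2 * (R1 - R) powr (- a) * V R1 R)" for n R
  proof (induction n arbitrary: R)
    case 0
    then show ?case by (simp add: ball_empty)
  next
    case (Suc n)
    define d where "d = R1 - R"
    have d: "d > 0" using Suc.prems by (simp add: d_def)
    define R' where "R' = R - d"
    have R': "R1 - R' = 2 * d" "R' < R" "R' < R1" using d by (auto simp: R'_def d_def)
    have "R' \<le> R1 * (1 - (1/2) ^ n)" using Suc.prems(1) by (simp add: R'_def d_def algebra_simps)
    from Suc.IH[OF this R'(3)]
    have IH: "(\<integral>\<^sup>+x\<in>ball x0 R'. G x \<partial>lebesgue) \<le> ennreal (2 * (2 * d) powr (- a) * V R1 R')"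
      unfolding R'(1) .
    have sub: "ball x0 R' \<subseteq> ball x0 R" using R' by auto
    have Vpos: "0 \<le> V r s" for r s by (simp add: V_def)
    have "(\<integral>\<^sup>+x\<in>ball x0 R - ball x0 R'. G x \<partial>lebesgue)
        \<le> (\<integral>\<^sup>+x\<in>ball x0 R - ball x0 R'. ennreal (d powr (- a)) \<partial>lebesgue)"
    proof (rule nn_integral_mono)
      fix x
      show "G x * indicator (ball x0 R - ball x0 R') x \<le> ennreal (d powr (- a)) * indicator (ball x0 R - ball x0 R') x"
      proof (cases "x \<in> ball x0 R - ball x0 R'")
        case True
        then have "(R1 - dist x0 x) powr (- a) \<le> d powr (- a)"
          using assms(1) d by (intro powr_mono2') (auto simp: d_def)
        then show ?thesis using True by (simp add: G_def ennreal_leI)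
      qed simp
    qed
    also have "\<dots> = ennreal (d powr (- a)) * emeasure lebesgue (ball x0 R - ball x0 R')"
      by (subst nn_integral_cmult_indicator) auto
    also have "emeasure lebesgue (ball x0 R - ball x0 R') = ennreal (V R R')"
      unfolding V_def by (intro emeasure_eq_measure2) (auto simp: fmeasurable.Diff)
    finally have shell: "(\<integral>\<^sup>+x\<in>ball x0 R - ball x0 R'. G x \<partial>lebesgue) \<le> ennreal (d powr (- a) * V R R')"
      by (simp add: ennreal_mult Vpos)
    have VV: "V R R' \<le> V R1 R" "V R1 R' = V R1 R + V R R'"
    proof -
      let ?w = "unit_ball_vol (real DIM('a))" and ?d = "DIM('a)"
      have V: "V r s = ?w * (max 0 r ^ ?d - max 0 s ^ ?d)" if "s \<le> r" for r s
      proof (cases "r \<ge> 0")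
        case False
        then have "ball x0 r = {}" by (simp add: ball_empty)
        then show ?thesis using False that by (simp add: V_def del: ball_eq_empty)
      qed (use measure_ball_diff[OF that] in \<open>simp add: V_def\<close>)
      show "V R1 R' = V R1 R + V R R'" using R' d by (simp add: V d_def algebra_simps)
      have "2 * max 0 R ^ ?d \<le> max 0 R1 ^ ?d + max 0 R' ^ ?d"
      proof (cases "R' \<ge> 0")
        case True
        moreover have "(R1 + R') / 2 = R" by (simp add: R'_def d_def)
        ultimately show ?thesis using midpoint_power_le[of R1 R' ?d] assms(3) R' by simp
      next
        case False
        then have le: "2 * max 0 R \<le> R1" using assms(3) by (simp add: R'_def d_def max_def)
        have "2 * ((2 * max 0 R + 0) / 2) ^ ?d \<le> (2 * max 0 R) ^ ?d + 0 ^ ?d"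
          by (rule midpoint_power_le) auto
        also have "(2 * max 0 R) ^ ?d \<le> R1 ^ ?d" using le by (intro power_mono) auto
        finally show ?thesis using assms(3) False by (simp add: max_def)
      qed
      then have "?w * (2 * max 0 R ^ ?d) \<le> ?w * (max 0 R1 ^ ?d + max 0 R' ^ ?d)"
        by (intro mult_left_mono) (auto simp: less_imp_le)
      then show "V R R' \<le> V R1 R" using R' d by (simp add: V d_def algebra_simps)
    qed
    have "(2 * d) powr (- a) = 2 powr (- a) * d powr (- a)" by (simp add: powr_mult)
    also have "\<dots> \<le> 1/4 * d powr (- a)"
    proof (rule mult_right_mono)
      have "2 powr (- a) \<le> 2 powr (- (2::real))" using assms(1) by (intro powr_mono) auto
      also have "\<dots> = 1/4" by (simp add: powr_minus)
      finally show "2 powr (- a) \<le> 1/4" .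
    qed simp
    finally have quarter: "(2 * d) powr (- a) \<le> 1/4 * d powr (- a)" .
    \<comment> \<open>The factor 2 in the claim is the fixed point of \<open>c \<mapsto> c/4 * 2 + 1\<close>.\<close>
    have "2 * (2 * d) powr (- a) * V R1 R' + d powr (- a) * V R R'
       \<le> 2 * (1/4 * d powr (- a)) * (2 * V R1 R) + d powr (- a) * V R1 R"
      using quarter VV Vpos by (intro add_mono mult_mono) auto
    then have fin: "2 * (2 * d) powr (- a) * V R1 R' + d powr (- a) * V R R' \<le> 2 * d powr (- a) * V R1 R"
      by (simp add: mult_ac)
    have "(\<integral>\<^sup>+x\<in>ball x0 R. G x \<partial>lebesgue)
      = (\<integral>\<^sup>+x. G x * indicator (ball x0 R') x + G x * indicator (ball x0 R - ball x0 R') x \<partial>lebesgue)"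
      using sub by (intro nn_integral_cong) (auto simp: indicator_def)
    also have "\<dots> = (\<integral>\<^sup>+x\<in>ball x0 R'. G x \<partial>lebesgue) + (\<integral>\<^sup>+x\<in>ball x0 R - ball x0 R'. G x \<partial>lebesgue)"
    proof (rule nn_integral_add)
      have [measurable]: "ball x0 r \<in> sets lebesgue" for r by simp
      show "(\<lambda>x. G x * indicator (ball x0 R') x) \<in> borel_measurable lebesgue"
           "(\<lambda>x. G x * indicator (ball x0 R - ball x0 R') x) \<in> borel_measurable lebesgue"
        by measurable
    qed
    also have "\<dots> \<le> ennreal (2 * (2 * d) powr (- a) * V R1 R') + ennreal (d powr (- a) * V R R')"
      by (intro add_mono IH shell)
    also have "\<dots> = ennreal (2 * (2 * d) powr (- a) * V R1 R' + d powr (- a) * V R R')"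
      by (intro ennreal_plus[symmetric]) (auto simp: Vpos)
    also have "\<dots> \<le> ennreal (2 * (R1 - R) powr (- a) * V R1 R)"
      using fin by (intro ennreal_leI) (simp add: d_def)
    finally show ?case .
  qed
  have "(\<lambda>n. R1 * (1 - (1/2) ^ n)) \<longlonglongrightarrow> R1 * (1 - 0)"
    by (intro tendsto_intros LIMSEQ_realpow_zero) auto
  then have "\<forall>\<^sub>F n in sequentially. R < R1 * (1 - (1/2) ^ n)"
    using assms(2) by (intro order_tendstoD(1)) auto
  then obtain n where "R \<le> R1 * (1 - (1/2) ^ n)"
    by (metis eventually_happens less_imp_le sequentially_bot)
  from step[OF this assms(2)] show ?thesis by (simp add: G_def V_def)
qed

text \<open>Since \<open>R1\<^sup>2 - r\<^sup>2 \<ge> R1 (R1 - r)\<close>, the factor \<open>R1\<^sup>2\<close> in the barrier cancels and only the distance \<open>R1 - r\<close> to the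
  sphere remains.\<close>

lemma barrier_mass:
  fixes x0 :: "'a::euclidean_space"
  assumes "m < 1" "1 - m < p" "\<theta> > 0" "0 < R" "R < R1" "\<kappa> > 0"
  shows "(\<integral>\<^sup>+x\<in>ball x0 R. ennreal ((2 * barrier m \<kappa> x0 R1 \<theta> x) powr p) \<partial>lebesgue)
     \<le> ennreal (2 powr p * (\<kappa> * \<theta>) powr (p / (1 - m)) *
        (2 * (R1 - R) powr (- (2 * (p / (1 - m)))) * measure lebesgue (ball x0 R1 - ball x0 R)))"
proof -
  define q where "q = p / (1 - m)"
  have q: "q > 1" using assms by (simp add: q_def)
  let ?C = "2 powr p * (\<kappa> * \<theta>) powr q"
  have pt: "(2 * barrier m \<kappa> x0 R1 \<theta> x) powr p \<le> ?C * (R1 - dist x0 x) powr (- (2 * q))" if x: "x \<in> ball x0 R" for x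
  proof -
    define r where "r = dist x0 x"
    have r: "0 \<le> r" "r < R1" using x assms(5) by (auto simp: r_def)
    define e where "e = R1\<^sup>2 - r\<^sup>2"
    have e: "R1\<^sup>2 - (x - x0) \<bullet> (x - x0) = e"
      by (simp add: e_def r_def dist_norm norm_minus_commute dot_square_norm)
    have "e = (R1 - r) * (R1 + r)" by (simp add: e_def power2_eq_square algebra_simps)
    then have e1: "(R1 - r) * R1 \<le> e" using r by (simp add: mult_left_mono)
    have pos: "0 < (R1 - r) * R1" using r by simp
    have ex: "1 / (1 - m) * p = q" "- 2 / (1 - m) * p = - (2 * q)" by (simp_all add: q_def)
    have "(2 * barrier m \<kappa> x0 R1 \<theta> x) powr p = 2 powr p * ((\<kappa> * R1\<^sup>2 * \<theta>) powr q * e powr (- (2 * q)))"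
      unfolding barrier_def e by (simp only: powr_mult powr_powr ex)
    also have "\<dots> \<le> 2 powr p * ((\<kappa> * R1\<^sup>2 * \<theta>) powr q * ((R1 - r) * R1) powr (- (2 * q)))"
      using e1 pos q by (intro mult_left_mono powr_mono2') auto
    also have "(\<kappa> * R1\<^sup>2 * \<theta>) powr q = (\<kappa> * \<theta>) powr q * (R1\<^sup>2) powr q"
      by (simp add: powr_mult)
    also have "(R1\<^sup>2) powr q = R1 powr (2 * q)"
      using assms by (simp add: powr_powr flip: powr_numeral)
    also have "((R1 - r) * R1) powr (- (2 * q)) = (R1 - r) powr (- (2 * q)) * R1 powr (- (2 * q))"
      by (simp add: powr_mult)
    also have "2 powr p * ((\<kappa> * \<theta>) powr q * R1 powr (2 * q) * ((R1 - r) powr (- (2 * q)) * R1 powr (- (2 * q))))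
       = ?C * (R1 - r) powr (- (2 * q)) * (R1 powr (2 * q) * R1 powr (- (2 * q)))"
      by (simp add: mult_ac)
    also have "R1 powr (2 * q) * R1 powr (- (2 * q)) = 1"
      using assms by (simp flip: powr_add)
    finally show ?thesis by (simp add: r_def)
  qed
  have "(\<integral>\<^sup>+x\<in>ball x0 R. ennreal ((2 * barrier m \<kappa> x0 R1 \<theta> x) powr p) \<partial>lebesgue)
     \<le> (\<integral>\<^sup>+x. ennreal ?C * (ennreal ((R1 - dist x0 x) powr (- (2 * q))) * indicator (ball x0 R) x) \<partial>lebesgue)"
  proof (rule nn_integral_mono)
    show "ennreal ((2 * barrier m \<kappa> x0 R1 \<theta> x) powr p) * indicator (ball x0 R) x
      \<le> ennreal ?C * (ennreal ((R1 - dist x0 x) powr (- (2 * q))) * indicator (ball x0 R) x)" for x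
      using pt[of x] by (cases "x \<in> ball x0 R") (auto simp: ennreal_mult[symmetric] ennreal_leI)
  qed
  also have "\<dots> = ennreal ?C * (\<integral>\<^sup>+x\<in>ball x0 R. ennreal ((R1 - dist x0 x) powr (- (2 * q))) \<partial>lebesgue)"
  proof (rule nn_integral_cmult)
    have "(\<lambda>x. ennreal ((R1 - dist x0 x) powr (- (2 * q)))) \<in> borel_measurable lebesgue"
      by (intro measurable_completion) (measurable; simp)
    moreover have "ball x0 R \<in> sets lebesgue" by simp
    ultimately show "(\<lambda>x. ennreal ((R1 - dist x0 x) powr (- (2 * q))) * indicator (ball x0 R) x) \<in> borel_measurable lebesgue"
      by measurable
  qed
  also have "\<dots> \<le> ennreal ?C * ennreal (2 * (R1 - R) powr (- (2 * q)) * measure lebesgue (ball x0 R1 - ball x0 R))"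
    using q assms by (intro mult_left_mono radial_singularity_integral) auto
  also have "\<dots> = ennreal (?C * (2 * (R1 - R) powr (- (2 * q)) * measure lebesgue (ball x0 R1 - ball x0 R)))"
    by (simp add: ennreal_mult)
  finally show ?thesis by (simp add: q_def)
qed

section \<open>Removing the regularizations\<close>

lemma Lp_loc_1_imp_set_integrable:
  assumes "Lp_loc 1 \<Omega> f" "compact K" "K \<subseteq> \<Omega>"
  shows "set_integrable lebesgue K f"
proof -
  have K: "K \<in> sets lebesgue" using assms(2) by (simp add: compact_imp_closed)
  have [measurable]: "(\<lambda>x. indicator \<Omega> x *\<^sub>R f x) \<in> borel_measurable lebesgue"
    using assms(1) by (simp add: Lp_loc_def set_borel_measurable_def)
  have m: "(\<lambda>x. indicator K x *\<^sub>R (indicator \<Omega> x *\<^sub>R f x)) \<in> borel_measurable lebesgue"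
    using K by measurable
  have eq: "indicator K x *\<^sub>R (indicator \<Omega> x *\<^sub>R f x) = indicator K x *\<^sub>R f x" for x
    using assms(3) by (auto simp: indicator_def)
  note m = m[unfolded eq]
  have "set_integrable lebesgue K (\<lambda>x. \<bar>f x\<bar> powr 1)"
    using assms by (auto simp: Lp_loc_def)
  then have "integrable lebesgue (\<lambda>x. norm (indicator K x *\<^sub>R f x))"
    by (simp add: set_integrable_def abs_mult)
  then show ?thesis using integrable_norm_iff[OF m] by (simp add: set_integrable_def)
qed

lemma Lp_loc_measurable:
  assumes "Lp_loc p \<Omega> f" "ball x0 R \<subseteq> \<Omega>" "g \<in> borel_measurable borel"
  shows "(\<lambda>x. ennreal (g (f x)) * indicator (ball x0 R) x) \<in> borel_measurable lebesgue"
proof -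
  have "(\<lambda>x. indicator \<Omega> x *\<^sub>R f x) \<in> borel_measurable lebesgue"
    using assms(1) by (simp add: Lp_loc_def set_borel_measurable_def)
  from measurable_compose[OF this assms(3)]
  have [measurable]: "(\<lambda>x. g (indicator \<Omega> x *\<^sub>R f x)) \<in> borel_measurable lebesgue" .
  have [measurable]: "ball x0 R \<in> sets lebesgue" by simp
  have "(\<lambda>x. ennreal (g (indicator \<Omega> x *\<^sub>R f x)) * indicator (ball x0 R) x) \<in> borel_measurable lebesgue"
    by measurable
  moreover have "ennreal (g (indicator \<Omega> x *\<^sub>R f x)) * indicator (ball x0 R) x
      = ennreal (g (f x)) * indicator (ball x0 R) x" for x
    using assms(2) by (auto simp: indicator_def)
  ultimately show ?thesis by simp
qed

text \<open>The starting time may be moved to a time \<open>\<alpha>\<close> that is attained only in \<open>L\<^sup>1\<^sub>l\<^sub>o\<^sub>c\<close>, be it the initial time or a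
  time of extinction, because the capped power is globally Lipschitz. The barrier depends monotonically on the elapsed
  time, so its mass is bounded uniformly in this limit.\<close>

lemma capped_mass_estimate:
  fixes u :: "real \<Rightarrow> 'a::euclidean_space \<Rightarrow> real"
  assumes weak: "weak_solution m T \<Omega> u" and smooth: "positive_smooth_unless_extinct T \<Omega> u"
    and \<Omega>: "open \<Omega>" "cball x0 R1 \<subseteq> \<Omega>" and R: "0 < R" "R < R1"
    and m: "m < 1" and p: "1 \<le> p" "1 - m < p" and k: "k > 0" and \<rho>: "\<rho> > 0"
    and \<alpha>: "0 \<le> \<alpha>" "\<alpha> < t" "t < T" and live: "\<And>\<tau>. \<alpha> < \<tau> \<Longrightarrow> \<tau> \<le> t \<Longrightarrow> \<exists>y\<in>\<Omega>. u \<tau> y \<noteq> 0"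
    and start: "Lp_loc 1 \<Omega> (u \<alpha>)" "L1_loc_limit \<Omega> u (u \<alpha>) (at_right \<alpha>)"
  defines "\<kappa> \<equiv> 4 * real DIM('a) + 8 + 16 * (p / (1 - m) - 1)"
  shows "(\<integral>\<^sup>+x\<in>ball x0 R. ennreal (capped_power p k (u t x)) \<partial>lebesgue)
     \<le> (\<integral>\<^sup>+x\<in>ball x0 R1. ennreal (\<bar>u \<alpha> x\<bar> powr p) \<partial>lebesgue)
       + ennreal (2 powr p * (\<kappa> * (\<rho> + (t - \<alpha>))) powr (p / (1 - m)) *
           (2 * (R1 - R) powr (- (2 * (p / (1 - m)))) * measure lebesgue (ball x0 R1 - ball x0 R)))"
    (is "?X \<le> ?A + ennreal ?D")
proof -
  define E where "E = capped_power p k"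
  define Lk where "Lk = p * k powr (p - 1)"
  define g where "g = (\<lambda>s. LINT x:cball x0 R1|lebesgue. \<bar>u s x - u \<alpha> x\<bar>)"
  have Lk: "Lk \<ge> 0" using p by (simp add: Lk_def)
  have "p / (1 - m) > 1" using m p by simp
  then have \<kappa>: "\<kappa> > 0" by (simp add: \<kappa>_def add_pos_nonneg)
  have bound: "?X \<le> ?A + ennreal (Lk * g s) + ennreal ?D" if s: "\<alpha> < s" "s < t" for s
  proof -
    have cyl: "{s..t} \<times> cball x0 R1 \<subseteq> live_set T \<Omega> u"
    proof safe
      fix \<tau> x assume "\<tau> \<in> {s..t}" "x \<in> cball x0 R1"
      then show "(\<tau>, x) \<in> live_set T \<Omega> u"
        using s \<alpha> \<Omega>(2) live[of \<tau>] by (auto simp: live_set_def)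
    qed
    have "?X \<le> (\<integral>\<^sup>+x\<in>ball x0 R1. ennreal (E (u s x)) \<partial>lebesgue)
       + (\<integral>\<^sup>+x\<in>ball x0 R. ennreal ((2 * barrier m \<kappa> x0 R1 (\<rho> + t - s) x) powr p) \<partial>lebesgue)"
      unfolding E_def \<kappa>_def
      by (rule truncated_mass_estimate[OF weak smooth \<Omega>(1) cyl s(2) _ _ m p k \<rho>]) (use R in auto)
    also have "(\<integral>\<^sup>+x\<in>ball x0 R. ennreal ((2 * barrier m \<kappa> x0 R1 (\<rho> + t - s) x) powr p) \<partial>lebesgue)
        \<le> ennreal (2 powr p * (\<kappa> * (\<rho> + t - s)) powr (p / (1 - m)) *
           (2 * (R1 - R) powr (- (2 * (p / (1 - m)))) * measure lebesgue (ball x0 R1 - ball x0 R)))"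
      by (rule barrier_mass) (use m p \<rho> s R \<kappa> in auto)
    also have "\<dots> \<le> ennreal ?D"
      using s \<rho> \<kappa> m p by (intro ennreal_leI mult_right_mono mult_left_mono powr_mono2) auto
    also have "(\<integral>\<^sup>+x\<in>ball x0 R1. ennreal (E (u s x)) \<partial>lebesgue) \<le> ?A + ennreal (Lk * g s)"
    proof -
      have us: "Lp_loc 1 \<Omega> (u s)" using weak s \<alpha> by (simp add: weak_solution_def continuous_L1_loc_def)
      have "set_integrable lebesgue (cball x0 R1) (\<lambda>x. \<bar>u s x - u \<alpha> x\<bar>)"
        using set_integrable_abs[OF set_integral_diff(1)[OF Lp_loc_1_imp_set_integrable[OF us compact_cball \<Omega>(2)]
              Lp_loc_1_imp_set_integrable[OF start(1) compact_cball \<Omega>(2)]]] .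
      then have int: "integrable lebesgue (\<lambda>x. Lk * (indicator (cball x0 R1) x *\<^sub>R \<bar>u s x - u \<alpha> x\<bar>))"
        by (simp add: set_integrable_def)
      have eq: "(\<integral>\<^sup>+x. ennreal (Lk * (indicator (cball x0 R1) x *\<^sub>R \<bar>u s x - u \<alpha> x\<bar>)) \<partial>lebesgue) = ennreal (Lk * g s)"
        using Lk by (subst nn_integral_eq_integral[OF int]) (auto simp: g_def set_lebesgue_integral_def)
      have mA: "(\<lambda>x. ennreal (\<bar>u \<alpha> x\<bar> powr p) * indicator (ball x0 R1) x) \<in> borel_measurable lebesgue"
        by (rule Lp_loc_measurable[OF start(1)]) (use \<Omega>(2) ball_subset_cball in \<open>auto\<close>)
      have "(\<integral>\<^sup>+x\<in>ball x0 R1. ennreal (E (u s x)) \<partial>lebesgue)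
          \<le> (\<integral>\<^sup>+x. ennreal (\<bar>u \<alpha> x\<bar> powr p) * indicator (ball x0 R1) x
              + ennreal (Lk * (indicator (cball x0 R1) x *\<^sub>R \<bar>u s x - u \<alpha> x\<bar>)) \<partial>lebesgue)"
      proof (rule nn_integral_mono)
        fix x
        show "ennreal (E (u s x)) * indicator (ball x0 R1) x \<le> ennreal (\<bar>u \<alpha> x\<bar> powr p) * indicator (ball x0 R1) x
              + ennreal (Lk * (indicator (cball x0 R1) x *\<^sub>R \<bar>u s x - u \<alpha> x\<bar>))"
        proof (cases "x \<in> ball x0 R1")
          case True
          then have "(s, x) \<in> live_set T \<Omega> u" using cyl s(2) by auto
          from live_setD(1)[OF smooth this] have pos: "u s x > 0" by simp
          have "E (u s x) \<le> E \<bar>u \<alpha> x\<bar> + Lk * \<bar>u s x - \<bar>u \<alpha> x\<bar>\<bar>"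
            unfolding E_def Lk_def using pos k p(1) by (intro capped_power_lipschitz) auto
          also have "E \<bar>u \<alpha> x\<bar> \<le> \<bar>u \<alpha> x\<bar> powr p"
            unfolding E_def using k p(1)
            by (cases "u \<alpha> x = 0") (auto simp: capped_power_def[of _ _ 0] intro!: capped_power_bounds)
          also have "Lk * \<bar>u s x - \<bar>u \<alpha> x\<bar>\<bar> \<le> Lk * \<bar>u s x - u \<alpha> x\<bar>"
            using pos Lk by (intro mult_left_mono) auto
          finally have "ennreal (E (u s x)) \<le> ennreal (\<bar>u \<alpha> x\<bar> powr p + Lk * \<bar>u s x - u \<alpha> x\<bar>)"
            by (simp add: ennreal_leI)
          also have "\<dots> = ennreal (\<bar>u \<alpha> x\<bar> powr p) + ennreal (Lk * \<bar>u s x - u \<alpha> x\<bar>)"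
            using Lk by (simp add: ennreal_plus)
          finally show ?thesis using True by simp
        qed simp
      qed
      also have "\<dots> = ?A + ennreal (Lk * g s)"
      proof -
        note [measurable] = borel_measurable_integrable[OF int]
        have mB: "(\<lambda>x. ennreal (Lk * (indicator (cball x0 R1) x *\<^sub>R \<bar>u s x - u \<alpha> x\<bar>))) \<in> borel_measurable lebesgue"
          by measurable
        show ?thesis using nn_integral_add[OF mA mB] unfolding eq .
      qed
      finally show ?thesis .
    qed
    finally show ?thesis by (simp add: add_mono)
  qed
  have "((\<lambda>s. g s) \<longlongrightarrow> 0) (at_right \<alpha>)"
    using start(2) \<Omega>(2) compact_cball unfolding L1_loc_limit_def g_def by blast
  then have "((\<lambda>s. ?A + ennreal (Lk * g s) + ennreal ?D) \<longlongrightarrow> ?A + ennreal (Lk * 0) + ennreal ?D) (at_right \<alpha>)"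
    by (intro tendsto_intros tendsto_ennrealI)
  moreover have "\<forall>\<^sub>F s in at_right \<alpha>. ?X \<le> ?A + ennreal (Lk * g s) + ennreal ?D"
    using eventually_at_right_less[of \<alpha>] order_tendstoD(2)[OF tendsto_ident_at \<alpha>(2)]
    by eventually_elim (rule bound)
  ultimately have "?X \<le> ?A + ennreal (Lk * 0) + ennreal ?D"
    by (rule tendsto_lowerbound) simp
  then show ?thesis by simp
qed

text \<open>On the left the cap is removed by Fatou's lemma; on the right it has already disappeared.\<close>

lemma mass_estimate_closed_subball:
  fixes u :: "real \<Rightarrow> 'a::euclidean_space \<Rightarrow> real"
  assumes weak: "weak_solution m T \<Omega> u" and smooth: "positive_smooth_unless_extinct T \<Omega> u"
    and \<Omega>: "open \<Omega>" "cball x0 R1 \<subseteq> \<Omega>" and R: "0 < R" "R < R1"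
    and m: "m < 1" and p: "1 \<le> p" "1 - m < p" and \<rho>: "\<rho> > 0"
    and \<alpha>: "0 \<le> \<alpha>" "\<alpha> < t" "t < T" and live: "\<And>\<tau>. \<alpha> < \<tau> \<Longrightarrow> \<tau> \<le> t \<Longrightarrow> \<exists>y\<in>\<Omega>. u \<tau> y \<noteq> 0"
    and start: "Lp_loc 1 \<Omega> (u \<alpha>)" "L1_loc_limit \<Omega> u (u \<alpha>) (at_right \<alpha>)"
  defines "\<kappa> \<equiv> 4 * real DIM('a) + 8 + 16 * (p / (1 - m) - 1)"
  shows "ball_mass p x0 R (u t) \<le> ball_mass p x0 R1 (u \<alpha>)
       + ennreal (2 powr p * (\<kappa> * (\<rho> + (t - \<alpha>))) powr (p / (1 - m)) *
           (2 * (R1 - R) powr (- (2 * (p / (1 - m)))) * measure lebesgue (ball x0 R1 - ball x0 R)))"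
    (is "_ \<le> ?C")
proof -
  define F where "F = (\<lambda>n x. ennreal (capped_power p (real (Suc n)) (u t x)) * indicator (ball x0 R) x)"
  have B: "ball x0 R \<subseteq> \<Omega>" using R \<Omega>(2) by (auto simp: subset_iff)
  have ut: "Lp_loc 1 \<Omega> (u t)" using weak \<alpha> by (simp add: weak_solution_def continuous_L1_loc_def)
  have Fm: "F n \<in> borel_measurable lebesgue" for n
    unfolding F_def by (rule Lp_loc_measurable[OF ut B]) (unfold capped_power_def, measurable)
  have "liminf (\<lambda>n. F n x) = ennreal (\<bar>u t x\<bar> powr p) * indicator (ball x0 R) x" for x
  proof (cases "x \<in> ball x0 R")
    case True
    then have "(t, x) \<in> live_set T \<Omega> u" using \<alpha> B live[of t] by (auto simp: live_set_def)
    from live_setD(1)[OF smooth this] have pos: "u t x > 0" by simp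
    then have "(\<lambda>n. ennreal (capped_power p (real (Suc n)) (u t x))) \<longlonglongrightarrow> ennreal (u t x powr p)"
      using p(1) by (intro tendsto_ennrealI capped_power_tendsto) auto
    then show ?thesis using True pos by (simp add: F_def lim_imp_Liminf)
  qed (simp add: F_def Liminf_const)
  then have "ball_mass p x0 R (u t) = (\<integral>\<^sup>+x. liminf (\<lambda>n. F n x) \<partial>lebesgue)"
    by (simp add: ball_mass_def)
  also have "\<dots> \<le> liminf (\<lambda>n. \<integral>\<^sup>+x. F n x \<partial>lebesgue)"
    by (rule nn_integral_liminf[OF Fm])
  also have "\<dots> \<le> liminf (\<lambda>n. ?C)"
  proof (rule Liminf_mono, rule always_eventually, rule allI)
    show "(\<integral>\<^sup>+x. F n x \<partial>lebesgue) \<le> ?C" for n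
      unfolding F_def ball_mass_def \<kappa>_def
      by (rule capped_mass_estimate[OF weak smooth \<Omega> R m p _ \<rho> \<alpha> live start]) auto
  qed
  also have "\<dots> = ?C" by (rule Liminf_const) simp
  finally show ?thesis .
qed

lemma ball_mass_mono: "R \<le> R' \<Longrightarrow> ball_mass p x0 R f \<le> ball_mass p x0 R' f"
  unfolding ball_mass_def by (rule nn_integral_mono) (auto simp: indicator_def)

text \<open>Letting \<open>\<rho>\<close> tend to 0 and \<open>R1\<close> to \<open>R0\<close> removes the remaining parameters. The closed ball of
  radius \<open>R0\<close> may leave \<open>\<Omega>\<close>, so the largest ball is only reached in the limit.\<close>

lemma mass_estimate:
  fixes u :: "real \<Rightarrow> 'a::euclidean_space \<Rightarrow> real"
  assumes weak: "weak_solution m T \<Omega> u" and smooth: "positive_smooth_unless_extinct T \<Omega> u"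
    and \<Omega>: "open \<Omega>" "ball x0 R0 \<subseteq> \<Omega>" and R: "0 < R" "R < R0"
    and m: "m < 1" and p: "1 \<le> p" "1 - m < p"
    and \<alpha>: "0 \<le> \<alpha>" "\<alpha> < t" "t < T" and live: "\<And>\<tau>. \<alpha> < \<tau> \<Longrightarrow> \<tau> \<le> t \<Longrightarrow> \<exists>y\<in>\<Omega>. u \<tau> y \<noteq> 0"
    and start: "Lp_loc 1 \<Omega> (u \<alpha>)" "L1_loc_limit \<Omega> u (u \<alpha>) (at_right \<alpha>)"
  defines "\<kappa> \<equiv> 4 * real DIM('a) + 8 + 16 * (p / (1 - m) - 1)"
  shows "ball_mass p x0 R (u t) \<le> ball_mass p x0 R0 (u \<alpha>)
       + ennreal (2 powr p * (\<kappa> * (t - \<alpha>)) powr (p / (1 - m)) *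
           (2 * (R0 - R) powr (- (2 * (p / (1 - m)))) * measure lebesgue (ball x0 R0 - ball x0 R)))"
proof -
  define q where "q = p / (1 - m)"
  have q: "q > 1" using m p by (simp add: q_def)
  then have \<kappa>: "\<kappa> > 0" by (simp add: \<kappa>_def q_def add_pos_nonneg)
  define V where "V = measure lebesgue (ball x0 R0 - ball x0 R)"
  define D where "D = (\<lambda>\<rho> R1. 2 powr p * (\<kappa> * (\<rho> + (t - \<alpha>))) powr q * (2 * (R1 - R) powr (- (2 * q)) * V))"
  define \<rho> where "\<rho> = (\<lambda>n. inverse (real (Suc n)))"
  define R1 where "R1 = (\<lambda>n. R0 - (R0 - R) / 2 * inverse (real (Suc n)))"
  have "ball_mass p x0 R (u t) \<le> ball_mass p x0 R0 (u \<alpha>) + ennreal (D (\<rho> n) (R1 n))" for n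
  proof -
    define h where "h = (R0 - R) / 2 * inverse (real (Suc n))"
    have "inverse (real (Suc n)) \<le> 1" by (simp add: inverse_eq_divide)
    then have "h \<le> (R0 - R) / 2 * 1"
      unfolding h_def using R by (intro mult_left_mono) auto
    moreover have "h > 0" unfolding h_def using R by (intro mult_pos_pos) auto
    moreover have "R1 n = R0 - h" by (simp only: R1_def h_def)
    ultimately have R1: "R < R1 n" "R1 n < R0" using R by auto
    have sub: "cball x0 (R1 n) \<subseteq> \<Omega>" using R1(2) \<Omega>(2) by (auto simp: subset_iff)
    have "measure lebesgue (ball x0 (R1 n) - ball x0 R) \<le> V"
      unfolding V_def using R1 by (intro measure_mono_fmeasurable) (auto simp: fmeasurable.Diff)
    then have D: "2 powr p * (\<kappa> * (\<rho> n + (t - \<alpha>))) powr q *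
           (2 * (R1 n - R) powr (- (2 * q)) * measure lebesgue (ball x0 (R1 n) - ball x0 R)) \<le> D (\<rho> n) (R1 n)"
      unfolding D_def by (intro mult_left_mono) auto
    have "ball_mass p x0 R (u t) \<le> ball_mass p x0 (R1 n) (u \<alpha>) +
        ennreal (2 powr p * (\<kappa> * (\<rho> n + (t - \<alpha>))) powr q *
           (2 * (R1 n - R) powr (- (2 * q)) * measure lebesgue (ball x0 (R1 n) - ball x0 R)))"
      unfolding \<kappa>_def q_def
      by (rule mass_estimate_closed_subball[OF weak smooth \<Omega>(1) sub R(1) R1(1) m p _ \<alpha> live start])
         (simp_all add: \<rho>_def)
    also have "\<dots> \<le> ball_mass p x0 R0 (u \<alpha>) + ennreal (D (\<rho> n) (R1 n))"
      using R1 D by (intro add_mono ball_mass_mono ennreal_leI) auto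
    finally show ?thesis .
  qed
  moreover have "(\<lambda>n. ball_mass p x0 R0 (u \<alpha>) + ennreal (D (\<rho> n) (R1 n))) \<longlonglongrightarrow> ball_mass p x0 R0 (u \<alpha>) + ennreal (D 0 R0)"
  proof -
    have "\<rho> \<longlonglongrightarrow> 0" unfolding \<rho>_def by (rule LIMSEQ_inverse_real_of_nat)
    moreover have "R1 \<longlonglongrightarrow> R0 - (R0 - R) / 2 * 0"
      unfolding R1_def by (intro tendsto_intros LIMSEQ_inverse_real_of_nat)
    then have "R1 \<longlonglongrightarrow> R0" by simp
    ultimately have "(\<lambda>n. D (\<rho> n) (R1 n)) \<longlonglongrightarrow> D 0 R0"
      unfolding D_def using \<kappa> \<alpha> R by (intro tendsto_intros) auto
    then show ?thesis by (intro tendsto_intros tendsto_ennrealI)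
  qed
  ultimately have "ball_mass p x0 R (u t) \<le> ball_mass p x0 R0 (u \<alpha>) + ennreal (D 0 R0)"
    by (intro tendsto_lowerbound[where F = sequentially]) auto
  then show ?thesis by (simp add: D_def q_def V_def)
qed

section \<open>The local estimate\<close>

lemma powr_add_le:
  fixes a b r :: real
  assumes "a \<ge> 0" "b \<ge> 0" "0 < r" "r \<le> 1"
  shows "(a + b) powr r \<le> a powr r + b powr r"
proof (cases "a + b = 0")
  case False
  then have s: "a + b > 0" using assms by simp
  have frac: "v / (a + b) \<le> (v / (a + b)) powr r" if "0 \<le> v" "v \<le> a + b" for v
  proof (cases "v = 0")
    case False
    then have "(v / (a + b)) powr 1 \<le> (v / (a + b)) powr r"
      using that s assms by (intro powr_mono') auto
    then show ?thesis using that s by simp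
  qed (use assms in simp)
  have "1 = a / (a + b) + b / (a + b)" using s by (simp add: add_divide_distrib[symmetric])
  also have "\<dots> \<le> (a / (a + b)) powr r + (b / (a + b)) powr r"
    using assms by (intro add_mono frac) auto
  also have "\<dots> = (a powr r + b powr r) / (a + b) powr r"
    using assms s by (simp add: powr_divide add_divide_distrib)
  finally show ?thesis using s by (simp add: le_divide_eq)
qed (use assms in \<open>simp add: add_nonneg_eq_0_iff\<close>)

lemma ennpowr_mono:
  assumes "X \<le> Y" "a > 0" shows "ennpowr X a \<le> ennpowr Y a"
  using assms by (cases X; cases Y)
    (auto simp: ennpowr_def top_unique intro!: ennreal_leI powr_mono2)

lemma ennpowr_add_le:
  assumes "D \<ge> 0" "0 < r" "r \<le> 1"
  shows "ennpowr (A + ennreal D) r \<le> ennpowr A r + ennreal (D powr r)"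
proof (cases A)
  case (real a)
  then have "A + ennreal D = ennreal (a + D)" using assms by (simp add: ennreal_plus)
  then show ?thesis
    using real assms powr_add_le[of a D r]
    by (simp add: ennpowr_def ennreal_plus[symmetric] ennreal_leI del: ennreal_plus)
qed (simp add: ennpowr_def)

text \<open>With \<open>q = p / (1 - m)\<close> the left-hand side is
  \<open>2 powr (1 - m) * \<kappa> \<tau> * 2 powr (1/q) / \<delta>\<^sup>2 * V powr (1/q)\<close>, and \<open>\<kappa> \<le> (4 d + 16) q\<close>. This is the origin of the constant in
  the theorem.\<close>

lemma smoothing_constant_le:
  fixes m p d :: real
  assumes m: "m < 1" and p: "1 \<le> p" "1 - m < p" and d: "0 \<le> d" and "0 < \<delta>" "0 \<le> V" "0 \<le> \<tau>"
  shows "(2 powr p * ((4 * d + 8 + 16 * (p / (1 - m) - 1)) * \<tau>) powr (p / (1 - m)) *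
           (2 * \<delta> powr (- (2 * (p / (1 - m)))) * V)) powr ((1 - m) / p)
     \<le> p * (2 powr (2 - m) * (4 * d + 16) / (1 - m)) / \<delta>\<^sup>2 * V powr ((1 - m) / p) * \<tau>"
proof -
  define q where "q = p / (1 - m)"
  define \<kappa> where "\<kappa> = 4 * d + 8 + 16 * (q - 1)"
  have q: "q > 1" using m p by (simp add: q_def)
  have \<kappa>: "\<kappa> > 0" using q d by (simp add: \<kappa>_def add_nonneg_pos)
  have ex: "(1 - m) / p = 1 / q" "p * (1 / q) = 1 - m" "q * (1 / q) = 1" "- (2 * q) * (1 / q) = - 2"
    using m p q by (simp_all add: q_def)
  have "d * 1 \<le> d * q" using d q by (intro mult_left_mono) auto
  then have \<kappa>q: "\<kappa> \<le> (4 * d + 16) * q" using q by (simp add: \<kappa>_def algebra_simps)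
  have "(2 powr p * (\<kappa> * \<tau>) powr q * (2 * \<delta> powr (- (2 * q)) * V)) powr (1 / q)
    = 2 powr (1 - m) * (\<kappa> * \<tau>) powr 1 * (2 powr (1 / q) * \<delta> powr (- 2) * V powr (1 / q))"
    by (simp only: powr_mult powr_powr ex)
  also have "\<dots> = 2 powr (1 - m) * (\<kappa> * \<tau>) * (2 powr (1 / q) * (1 / \<delta>\<^sup>2) * V powr (1 / q))"
    using \<kappa> assms by (simp add: powr_minus_divide)
  also have "\<dots> \<le> 2 powr (1 - m) * ((4 * d + 16) * q * \<tau>) * (2 * (1 / \<delta>\<^sup>2) * V powr (1 / q))"
  proof -
    have "2 powr (1 / q) \<le> 2 powr (1::real)" using q by (intro powr_mono) auto
    then show ?thesis using \<kappa> \<kappa>q assms by (intro mult_mono) auto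
  qed
  also have "\<dots> = p * (2 powr (1 - m) * 2 * (4 * d + 16) / (1 - m)) / \<delta>\<^sup>2 * V powr (1 / q) * \<tau>"
    by (simp add: q_def)
  also have "2 powr (1 - m) * 2 = 2 powr (2 - m)"
    by (simp add: powr_mult_base mult.commute algebra_simps)
  finally show ?thesis unfolding \<kappa>_def q_def[symmetric] ex(1) .
qed

text \<open>If the solution is extinct somewhere between \<open>s\<close> and \<open>t\<close>, the last such time can serve as starting time: it is
  attained because the live set is open, and the mass vanishes there. This also covers weak solutions with \<open>m \<le> 0\<close> that
  become positive again, about which the weak formulation says nothing across the extinct times.\<close>

lemma last_extinction_time:
  fixes u :: "real \<Rightarrow> 'a::euclidean_space \<Rightarrow> real"
  assumes smooth: "positive_smooth_unless_extinct T \<Omega> u" and \<Omega>: "open \<Omega>"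
    and t: "0 \<le> s" "s < t" "t < T" and alive: "\<exists>y\<in>\<Omega>. u t y \<noteq> 0"
  obtains \<alpha> where "s \<le> \<alpha>" "\<alpha> < t" "\<And>\<tau>. \<alpha> < \<tau> \<Longrightarrow> \<tau> \<le> t \<Longrightarrow> \<exists>y\<in>\<Omega>. u \<tau> y \<noteq> 0"
    "\<alpha> = s \<or> (\<forall>y\<in>\<Omega>. u \<alpha> y = 0)"
proof (cases "\<exists>\<tau>. s < \<tau> \<and> \<tau> < t \<and> (\<forall>y\<in>\<Omega>. u \<tau> y = 0)")
  case False
  show ?thesis
    by (rule that[of s]) (use False t alive in \<open>force simp: le_less\<close>)+
next
  case True
  define Z where "Z = {\<tau>. s < \<tau> \<and> \<tau> < t \<and> (\<forall>y\<in>\<Omega>. u \<tau> y = 0)}"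
  have Z: "Z \<noteq> {}" "bdd_above Z" using True by (auto simp: Z_def intro!: bdd_aboveI[of _ t])
  have nbhd: "\<exists>\<epsilon>>0. \<forall>\<sigma>. \<bar>\<sigma> - \<tau>\<bar> < \<epsilon> \<longrightarrow> (\<exists>y\<in>\<Omega>. u \<sigma> y \<noteq> 0)"
    if \<tau>: "0 < \<tau>" "\<tau> < T" and y: "y \<in> \<Omega>" "u \<tau> y \<noteq> 0" for \<tau> y
  proof -
    have "(\<tau>, y) \<in> live_set T \<Omega> u" using \<tau> y by (auto simp: live_set_def)
    then obtain \<epsilon> where "\<epsilon> > 0" "ball (\<tau>, y) \<epsilon> \<subseteq> live_set T \<Omega> u"
      using open_live_set[OF smooth \<Omega>] open_contains_ball by blast
    then have "(\<sigma>, y) \<in> live_set T \<Omega> u" if "\<bar>\<sigma> - \<tau>\<bar> < \<epsilon>" for \<sigma>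
      using that by (auto simp: subset_iff dist_Pair_Pair dist_real_def)
    then show ?thesis using \<open>\<epsilon> > 0\<close> by (auto simp: live_set_def)
  qed
  define \<alpha> where "\<alpha> = Sup Z"
  obtain \<tau>0 where \<tau>0: "\<tau>0 \<in> Z" using Z by auto
  have "\<tau>0 \<le> \<alpha>" unfolding \<alpha>_def using \<tau>0 Z by (intro cSup_upper)
  then have s\<alpha>: "s < \<alpha>" using \<tau>0 by (auto simp: Z_def)
  have \<alpha>t: "\<alpha> \<le> t" unfolding \<alpha>_def using Z by (intro cSup_least) (auto simp: Z_def)
  have dead: "u \<alpha> y = 0" if y: "y \<in> \<Omega>" for y
  proof (rule ccontr)
    assume "u \<alpha> y \<noteq> 0"
    with nbhd[of \<alpha> y] y s\<alpha> \<alpha>t t obtain \<epsilon> where \<epsilon>: "\<epsilon> > 0" "\<And>\<sigma>. \<bar>\<sigma> - \<alpha>\<bar> < \<epsilon> \<Longrightarrow> \<exists>y\<in>\<Omega>. u \<sigma> y \<noteq> 0"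
      by force
    obtain \<tau> where "\<tau> \<in> Z" "\<alpha> - \<epsilon> < \<tau>"
      using less_cSup_iff[OF Z, of "\<alpha> - \<epsilon>"] \<epsilon>(1) by (auto simp: \<alpha>_def)
    moreover have "\<tau> \<le> \<alpha>" unfolding \<alpha>_def using \<open>\<tau> \<in> Z\<close> Z by (intro cSup_upper)
    ultimately show False using \<epsilon>(2)[of \<tau>] by (auto simp: Z_def)
  qed
  then have "\<alpha> \<noteq> t" using alive by auto
  then have "\<alpha> < t" using \<alpha>t by simp
  moreover have "\<exists>y\<in>\<Omega>. u \<tau> y \<noteq> 0" if "\<alpha> < \<tau>" "\<tau> \<le> t" for \<tau>
  proof (cases "\<tau> = t")
    case False
    have "\<tau> \<notin> Z" using cSup_upper[of \<tau> Z] Z that(1) by (auto simp: \<alpha>_def)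
    then show ?thesis using False that s\<alpha> by (auto simp: Z_def)
  qed (use alive in simp)
  ultimately show ?thesis using that[of \<alpha>] s\<alpha> dead by auto
qed

lemma ball_mass_extinct:
  fixes x0 :: "'a::euclidean_space"
  assumes "\<And>y. y \<in> \<Omega> \<Longrightarrow> f y = 0" "ball x0 R \<subseteq> \<Omega>"
  shows "ball_mass p x0 R f = 0"
proof -
  have "ball_mass p x0 R f = (\<integral>\<^sup>+(x::'a). 0 \<partial>lebesgue)"
    unfolding ball_mass_def by (rule nn_integral_cong) (use assms in \<open>auto simp: indicator_def\<close>)
  then show ?thesis by simp
qed

text \<open>If \<open>\<alpha>\<close> is a time of extinction after \<open>s\<close>, the estimate from \<open>\<alpha>\<close> has no initial term and a smaller elapsed
  time, so it implies the one from \<open>s\<close>.\<close>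

lemma local_Lp_estimate:
  fixes u :: "real \<Rightarrow> 'a::euclidean_space \<Rightarrow> real"
  assumes m: "m < 1"
    and \<Omega>: "open \<Omega>" "ball x0 R0 \<subseteq> \<Omega>" and R: "0 < R" "R < R0"
    and weak: "weak_solution m T \<Omega> u" and smooth: "positive_smooth_unless_extinct T \<Omega> u"
    and p: "1 \<le> p" "1 - m < p" and t: "0 \<le> s" "s \<le> t" "t < T"
    and init: "s = 0 \<Longrightarrow> initial_datum \<Omega> u"
  defines "c \<equiv> 2 powr (2 - m) * (4 * real DIM('a) + 16) / (1 - m)"
  shows "0 < K_const c m x0 R R0 p"
    and "ennpowr (ball_mass p x0 R (u t)) ((1 - m) / p)
          \<le> ennpowr (ball_mass p x0 R0 (u s)) ((1 - m) / p) + ennreal (K_const c m x0 R R0 p * (t - s))"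
proof -
  define r where "r = (1 - m) / p"
  have r: "0 < r" "r \<le> 1" using m p by (auto simp: r_def)
  have c: "c > 0" unfolding c_def using m by (intro divide_pos_pos mult_pos_pos) (auto intro: add_nonneg_pos)
  define V where "V = measure lebesgue (ball x0 R0 - ball x0 R)"
  have "V = unit_ball_vol (real DIM('a)) * (R0 ^ DIM('a) - R ^ DIM('a))"
    unfolding V_def using measure_ball_diff[of R R0 x0] R by simp
  moreover have "R ^ DIM('a) < R0 ^ DIM('a)" using R by (intro power_strict_mono) auto
  ultimately have V: "V > 0" by simp
  define K where "K = K_const c m x0 R R0 p"
  have K: "K = p * c / (R0 - R)\<^sup>2 * V powr r" by (simp add: K_def K_const_def V_def r_def)
  show K0: "0 < K_const c m x0 R R0 p"
    unfolding K_def[symmetric] K using p c R V by (intro mult_pos_pos divide_pos_pos) auto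
  have from_alpha: "ennpowr (ball_mass p x0 R (u t)) r \<le> ennpowr (ball_mass p x0 R0 (u \<alpha>)) r + ennreal (K * (t - \<alpha>))"
    if \<alpha>: "s \<le> \<alpha>" "\<alpha> < t" and live: "\<And>\<tau>. \<alpha> < \<tau> \<Longrightarrow> \<tau> \<le> t \<Longrightarrow> \<exists>y\<in>\<Omega>. u \<tau> y \<noteq> 0" for \<alpha>
  proof -
    have start: "Lp_loc 1 \<Omega> (u \<alpha>)" "L1_loc_limit \<Omega> u (u \<alpha>) (at_right \<alpha>)"
    proof -
      have "Lp_loc 1 \<Omega> (u \<alpha>) \<and> L1_loc_limit \<Omega> u (u \<alpha>) (at_right \<alpha>)"
      proof (cases "\<alpha> = 0")
        case True
        then show ?thesis using init \<alpha> t by (auto simp: initial_datum_def)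
      next
        case False
        then have "Lp_loc 1 \<Omega> (u \<alpha>)" "L1_loc_limit \<Omega> u (u \<alpha>) (at \<alpha>)"
          using weak \<alpha> t by (auto simp: weak_solution_def continuous_L1_loc_def)
        then show ?thesis
          unfolding L1_loc_limit_def using filterlim_at_split by blast
      qed
      then show "Lp_loc 1 \<Omega> (u \<alpha>)" "L1_loc_limit \<Omega> u (u \<alpha>) (at_right \<alpha>)" by auto
    qed
    define D where "D = 2 powr p * ((4 * real DIM('a) + 8 + 16 * (p / (1 - m) - 1)) * (t - \<alpha>)) powr (p / (1 - m)) *
           (2 * (R0 - R) powr (- (2 * (p / (1 - m)))) * V)"
    have D0: "D \<ge> 0" using V by (simp add: D_def)
    have "0 \<le> \<alpha>" using \<alpha> t by simp
    have "ball_mass p x0 R (u t) \<le> ball_mass p x0 R0 (u \<alpha>) + ennreal D"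
      unfolding D_def V_def
      by (rule mass_estimate[OF weak smooth \<Omega> R m p \<open>0 \<le> \<alpha>\<close> \<alpha>(2) t(3) live start])
    then have "ennpowr (ball_mass p x0 R (u t)) r \<le> ennpowr (ball_mass p x0 R0 (u \<alpha>) + ennreal D) r"
      by (rule ennpowr_mono) (rule r)
    also have "\<dots> \<le> ennpowr (ball_mass p x0 R0 (u \<alpha>)) r + ennreal (D powr r)"
      by (rule ennpowr_add_le[OF D0 r])
    also have "D powr r \<le> K * (t - \<alpha>)"
      unfolding D_def K r_def c_def by (rule smoothing_constant_le) (use m p R V \<alpha> in auto)
    finally show ?thesis by (simp add: add_left_mono ennreal_leI)
  qed
  have "ennpowr (ball_mass p x0 R (u t)) r \<le> ennpowr (ball_mass p x0 R0 (u s)) r + ennreal (K * (t - s))"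
  proof (cases "s = t")
    case True
    have "ennpowr (ball_mass p x0 R (u t)) r \<le> ennpowr (ball_mass p x0 R0 (u t)) r"
      using R r by (intro ennpowr_mono ball_mass_mono) auto
    then show ?thesis using True by simp
  next
    case False
    then have st: "s < t" using t by simp
    have zero: "ennpowr 0 r = 0" by (simp add: ennpowr_def)
    show ?thesis
    proof (cases "\<exists>y\<in>\<Omega>. u t y \<noteq> 0")
      case False
      have "ball_mass p x0 R (u t) = 0"
        by (rule ball_mass_extinct[of \<Omega>]) (use False \<Omega>(2) R in \<open>auto simp: subset_iff\<close>)
      then show ?thesis by (simp add: zero)
    next
      case True
      obtain \<alpha> where \<alpha>: "s \<le> \<alpha>" "\<alpha> < t" "\<And>\<tau>. \<alpha> < \<tau> \<Longrightarrow> \<tau> \<le> t \<Longrightarrow> \<exists>y\<in>\<Omega>. u \<tau> y \<noteq> 0"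
          "\<alpha> = s \<or> (\<forall>y\<in>\<Omega>. u \<alpha> y = 0)"
        using last_extinction_time[OF smooth \<Omega>(1) t(1) st t(3) True] by blast
      note est = from_alpha[OF \<alpha>(1-3)]
      show ?thesis
      proof (cases "\<alpha> = s")
        case True
        then show ?thesis using est by simp
      next
        case False
        then have "ball_mass p x0 R0 (u \<alpha>) = 0"
          using \<alpha>(4) \<Omega>(2) by (intro ball_mass_extinct[of \<Omega>]) auto
        then have "ennpowr (ball_mass p x0 R (u t)) r \<le> ennreal (K * (t - \<alpha>))"
          using est by (simp add: zero)
        also have "\<dots> \<le> ennreal (K * (t - s))"
          using \<alpha>(1) K0 by (intro ennreal_leI mult_left_mono) (auto simp: K_def)
        finally show ?thesis by (simp add: add_increasing)
      qed
    qed
  qed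
  then show "ennpowr (ball_mass p x0 R (u t)) ((1 - m) / p)
          \<le> ennpowr (ball_mass p x0 R0 (u s)) ((1 - m) / p) + ennreal (K_const c m x0 R R0 p * (t - s))"
    unfolding r_def K_def .
qed

theorem theorem2p3:
  fixes m :: real
  assumes "m < 1" and "CARD('n::finite) \<ge> 3"
  shows "\<exists>c>0. \<forall>(\<Omega> :: (real ^ 'n) set) x0 R R0 T (u :: real \<Rightarrow> real ^ 'n \<Rightarrow> real) p s t.
    open \<Omega> \<and> connected \<Omega> \<and> ball x0 R0 \<subseteq> \<Omega> \<and> 0 < R \<and> R < R0 \<and>
    weak_solution m T \<Omega> u \<and>
    (\<forall>r\<in>{0<..<T}. \<forall>x\<in>\<Omega>. 0 \<le> u r x) \<and>
    positive_smooth_unless_extinct T \<Omega> u \<and>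
    1 \<le> p \<and> 1 - m < p \<and> (\<forall>r\<in>{0<..<T}. Lp_loc p \<Omega> (u r)) \<and>
    0 \<le> s \<and> s \<le> t \<and> t < T \<and> (s = 0 \<longrightarrow> initial_datum \<Omega> u)
    \<longrightarrow> 0 < K_const c m x0 R R0 p \<and>
        ennpowr (ball_mass p x0 R (u t)) ((1 - m) / p)
          \<le> ennpowr (ball_mass p x0 R0 (u s)) ((1 - m) / p)
             + ennreal (K_const c m x0 R R0 p * (t - s))"
proof (intro exI conjI allI impI; (elim conjE)?)
  let ?c = "2 powr (2 - m) * (4 * real DIM(real ^ 'n) + 16) / (1 - m)"
  show "0 < ?c"
    using assms(1) by (intro divide_pos_pos mult_pos_pos) (auto intro: add_nonneg_pos)
qed (use assms(1) in \<open>rule local_Lp_estimate; blast\<close>)+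

end
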